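(* Let $0<q\leq1$, $s\geq0$, $S=\begin{pmatrix}A&B\\C&D\end{pmatrix}\in\mathrm{Sp}(d,\mathbb{R})$ with $d\times d$ blocks and $\det A\ne0$. Let $T_I$ be a Fourier integral operator of type I with symbol $\sigma\in M^{\infty,q}_{1\otimes v_s}(\mathbb{R}^{2d})$ and quadratic phase $$\Phi(x,\eta)=\tfrac12x\cdot CA^{-1}x+\eta\cdot A^{-1}x-\tfrac12\eta\cdot A^{-1}B\eta,$$ and let $T_{II}=T_I^*$ be its $L^2$-adjoint (a Fourier integral operator of type II). If $T_I\in FIO(S,M^{\infty,q}_{1\otimes v_s})$, then $T_{II}\in FIO(S^{-1},M^{\infty,q}_{1\otimes v_s})$.
   Context: Conventions: $\hat f(\xi)=\int f(x)e^{-2\pi i\xi\cdot x}dx$; $\langle\cdot,\cdot\rangle$ is the $\mathcal{S}'$–$\mathcal{S}$ pairing, linear in the first and antilinear in the second entry. $\mathrm{Sp}(d,\mathbb{R})$ is the group of real $2d\times 2d$ symplectic matrices. Type I: $T_If(x)=\int_{\mathbb{R}^d}e^{2\pi i\Phi(x,\eta)}\sigma(x,\eta)\hat f(\eta)d\eta$, understood weakly as $\langle T_If,g\rangle=\langle\sigma,e^{-2\pi i\Phi}(g\otimes\overline{\hat f})\rangle$ for $f,g\in\mathcal{S}(\mathbb{R}^d)$. With symbols $\sigma\in M^{\infty,q}_{1\otimes v_s}(\mathbb{R}^{2d})$, $0<q\leq1$, $s\geq0$, and quadratic phase $\Phi(x,\eta)=\tfrac12x\cdot CA^{-1}x+\eta\cdot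 A^{-1}x-\tfrac12\eta\cdot A^{-1}B\eta$, where $S=\begin{pmatrix}A&B\\C&D\end{pmatrix}\in\mathrm{Sp}(d,\mathbb{R})$ and $\det A\ne0$, such operators and their adjoints are bounded on $L^2(\mathbb{R}^d)$. Type II (the $L^2$-adjoint of a type I operator) is formally $T_{II}f(x)=\int_{\mathbb{R}^{2d}}e^{-2\pi i[\Phi(y,\xi)-x\cdot\xi]}\tau(y,\xi)f(y)\,dy\,d\xi$ with $\tau\in M^{\infty,q}_{1\otimes v_s}(\mathbb{R}^{2d})$. Modulation spaces: for $n\ge1$, a weight $m$ on $\mathbb{R}^{2n}$, $0<p,q\le\infty$ and a fixed nonzero $g\in\mathcal{S}(\mathbb{R}^n)$, $M^{p,q}_m(\mathbb{R}^n)$ is the space of $f\in\mathcal{S}'(\mathbb{R}^n)$ such that $$\|f\|_{M^{p,q}_m}=\Big(\int_{\mathbb{R}^n}\Big(\int_{\mathbb{R}^n}|V_gf(x,\xi)|^p m(x,\xi)^p\,dx\Big)^{q/p}d\xi\Big)^{1/q}<\infty$$ (usual modifications if $p$ or $q$ is $\infty$), where $V_gf(x,\xi)=\int f(t)\overline{g(t-x)}e^{-2\pi i\xi\cdot t}dt$; different windows give equivalent quasi-norms. Here $v_s(z)=(1+|z|^2)^{s/2}$ and $(1\otimes v_s)(x,\xi)=v_s(\xi)$. Wigner kernel: $W(f,g)(x,\xi)=\int_{\mathbb{R}^d}f(x+t/2)\overline{g(x-t/2)}e^{-2\pi i\xi\cdot t}dt$, extended to $f,g\in\mathcal{S}'(\mathbb{R}^d)$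 in the distributional sense. For every continuous linear $T:\mathcal{S}(\mathbb{R}^d)\to\mathcal{S}'(\mathbb{R}^d)$ there is a unique continuous linear $K:\mathcal{S}(\mathbb{R}^{2d})\to\mathcal{S}'(\mathbb{R}^{2d})$ with $K W(f,g)=W(Tf,Tg)$ for all $f,g\in\mathcal{S}(\mathbb{R}^d)$; its Schwartz kernel $k\in\mathcal{S}'(\mathbb{R}^{4d})$ is the Wigner kernel of $T$, formally $KF(z)=\int_{\mathbb{R}^{2d}}k(z,w)F(w)\,dw$. The class $FIO(S,M^{\infty,q}_{1\otimes v_s})$ ($S\in\mathrm{Sp}(d,\mathbb{R})$): the set of continuous linear $T:\mathcal{S}(\mathbb{R}^d)\to\mathcal{S}'(\mathbb{R}^d)$ whose Wigner kernel satisfies $k(z,w)=h(z,Sw)$ (linear change of variables of distributions), where $h$ is the Schwartz kernel of a Kohn–Nirenberg pseudodifferential operator $\sigma(z,D)F(z)=\int_{\mathbb{R}^{2d}}\sigma(z,\zeta)\hat F(\zeta)e^{2\pi i z\cdot\zeta}d\zeta$ on $\mathbb{R}^{2d}$ with symbol $\sigma\in M^{\infty,q}_{1\otimes v_s}(\mathbb{R}^{4d})$. *)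

theory Defs
  imports "HOL-Analysis.Analysis" "HOL-Probability.Essential_Supremum"
begin

section \<open>Schwartz functions and tempered distributions\<close>

fun iterated_deriv :: "'a::euclidean_space list \<Rightarrow> ('a \<Rightarrow> complex) \<Rightarrow> 'a \<Rightarrow> complex" where
  "iterated_deriv [] f = f"
| "iterated_deriv (v # vs) f = (\<lambda>x. frechet_derivative (iterated_deriv vs f) (at x) v)"

definition schwartz :: "('a::euclidean_space \<Rightarrow> complex) set" where
  "schwartz = {f. \<forall>vs\<in>lists Basis.
     (\<forall>x. iterated_deriv vs f differentiable (at x)) \<and>
     (\<forall>N. \<exists>C. \<forall>x. (1 + norm x) ^ N * norm (iterated_deriv vs f x) \<le> C)}"

text \<open>An increasing family of norms generating the topology of the Schwartz space; the supremum
  is finite for Schwartz functions, and the norm is used for these only.\<close>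

definition schwartz_norm :: "nat \<Rightarrow> ('a::euclidean_space \<Rightarrow> complex) \<Rightarrow> real" where
  "schwartz_norm N f =
     (SUP (vs, x) \<in> {vs \<in> lists Basis. length vs \<le> N} \<times> UNIV.
        (1 + norm x) ^ N * norm (iterated_deriv vs f x))"

text \<open>The pairing of a tempered distribution with a Schwartz function is linear in the first and
  antilinear in the second entry. A distribution \<open>u\<close> is represented by the functional
  \<open>\<phi> \<mapsto> \<langle>u, \<phi>\<rangle>\<close>, which is therefore antilinear; a function \<open>F\<close> corresponds to
  \<open>\<phi> \<mapsto> \<integral> F(x) cnj (\<phi>(x)) dx\<close>. Values at arguments that are not Schwartz functions carry no
  meaning, and two distributions are compared on Schwartz functions only. The same holds for
  operators, so \<open>T f \<phi>\<close> is \<open>\<langle>T f, \<phi>\<rangle>\<close>.\<close>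

type_synonym 'a distr = "('a \<Rightarrow> complex) \<Rightarrow> complex"
type_synonym 'a operator = "('a \<Rightarrow> complex) \<Rightarrow> 'a distr"

definition tempered :: "'a::euclidean_space distr set" where
  "tempered = {u.
     (\<forall>f\<in>schwartz. \<forall>g\<in>schwartz. \<forall>a b.
        u (\<lambda>x. a * f x + b * g x) = cnj a * u f + cnj b * u g) \<and>
     (\<exists>N C. \<forall>f\<in>schwartz. norm (u f) \<le> C * schwartz_norm N f)}"

text \<open>Continuity refers to the weak-* topology of the distributions. As the Schwartz space is a
  Frechet space, this is the same as continuity for the strong dual topology.\<close>

definition continuous_operator :: "'a::euclidean_space operator \<Rightarrow> bool" where
  "continuous_operator T \<longleftrightarrow>
     (\<forall>f\<in>schwartz. T f \<in> tempered) \<and>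
     (\<forall>f\<in>schwartz. \<forall>g\<in>schwartz. \<forall>\<phi>\<in>schwartz. \<forall>a b.
        T (\<lambda>x. a * f x + b * g x) \<phi> = a * T f \<phi> + b * T g \<phi>) \<and>
     (\<forall>\<phi>\<in>schwartz. \<exists>N C. \<forall>f\<in>schwartz. norm (T f \<phi>) \<le> C * schwartz_norm N f)"

definition is_schwartz_kernel ::
    "'a::euclidean_space operator \<Rightarrow> ('a \<times> 'a) distr \<Rightarrow> bool" where
  "is_schwartz_kernel K k \<longleftrightarrow> k \<in> tempered \<and>
     (\<forall>f\<in>schwartz. \<forall>g\<in>schwartz. K f g = k (\<lambda>(z, w). g z * cnj (f w)))"

text \<open>The adjoint with respect to the \<open>L\<^sup>2\<close> inner product, \<open>\<langle>T* f, g\<rangle> = \<langle>f, T g\<rangle>\<close>. If \<open>T\<close> is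
  bounded on \<open>L\<^sup>2\<close>, it is the restriction of the Hilbert space adjoint to Schwartz functions.\<close>

definition L2_adjoint :: "'a::euclidean_space operator \<Rightarrow> 'a operator" where
  "L2_adjoint T = (\<lambda>f g. cnj (T g f))"

definition fourier :: "('a::euclidean_space \<Rightarrow> complex) \<Rightarrow> 'a \<Rightarrow> complex" where
  "fourier f \<xi> = (\<integral>x. f x * cis (- 2 * pi * (\<xi> \<bullet> x)) \<partial>lborel)"


section \<open>Modulation spaces\<close>

definition stft ::
    "('a::euclidean_space \<Rightarrow> complex) \<Rightarrow> 'a distr \<Rightarrow> 'a \<times> 'a \<Rightarrow> complex" where
  "stft g u = (\<lambda>(x, \<xi>). u (\<lambda>t. cis (2 * pi * (\<xi> \<bullet> t)) * g (t - x)))"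

text \<open>Real powers with positive exponent on \<open>[0, \<infinity>]\<close>.\<close>

definition ennpowr :: "ennreal \<Rightarrow> real \<Rightarrow> ennreal" where
  "ennpowr x r = (if x = \<infinity> then \<infinity> else ennreal (enn2real x powr r))"

definition Lp_qnorm :: "ennreal \<Rightarrow> ('a::euclidean_space \<Rightarrow> ennreal) \<Rightarrow> ennreal" where
  "Lp_qnorm p F =
     (if p = \<infinity> then esssup lborel F
      else ennpowr (\<integral>\<^sup>+x. ennpowr (F x) (enn2real p) \<partial>lborel) (1 / enn2real p))"

definition modulation_qnorm ::
    "('a::euclidean_space \<Rightarrow> complex) \<Rightarrow> ennreal \<Rightarrow> ennreal \<Rightarrow> ('a \<times> 'a \<Rightarrow> real) \<Rightarrow> 'a distr \<Rightarrow> ennreal"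
  where
  "modulation_qnorm g p q m u =
     Lp_qnorm q (\<lambda>\<xi>. Lp_qnorm p (\<lambda>x. ennreal (norm (stft g u (x, \<xi>)) * m (x, \<xi>))))"

definition modulation_space ::
    "('a::euclidean_space \<Rightarrow> complex) \<Rightarrow> ennreal \<Rightarrow> ennreal \<Rightarrow> ('a \<times> 'a \<Rightarrow> real) \<Rightarrow> 'a distr set"
  where
  "modulation_space g p q m = {u \<in> tempered. modulation_qnorm g p q m u < \<infinity>}"

definition v_weight :: "real \<Rightarrow> 'a::euclidean_space \<Rightarrow> real" where
  "v_weight s z = (1 + (norm z)\<^sup>2) powr (s / 2)"

definition one_tensor_v :: "real \<Rightarrow> 'a::euclidean_space \<times> 'a \<Rightarrow> real" where
  "one_tensor_v s = (\<lambda>(x, \<xi>). v_weight s \<xi>)"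


section \<open>Fourier integral operators of type I\<close>

text \<open>The weak definition \<open>\<langle>T f, g\<rangle> = \<langle>\<sigma>, e\<^bsup>-2\<pi>i\<Phi>\<^esup> (g \<otimes> cnj (fourier f))\<rangle>\<close>.\<close>

definition type_I ::
    "('a::euclidean_space \<Rightarrow> 'a \<Rightarrow> real) \<Rightarrow> ('a \<times> 'a) distr \<Rightarrow> 'a operator" where
  "type_I \<Phi> \<sigma> = (\<lambda>f g.
     \<sigma> (\<lambda>(x, \<eta>). cis (- 2 * pi * \<Phi> x \<eta>) * (g x * cnj (fourier f \<eta>))))"

text \<open>The Kohn--Nirenberg operator \<open>\<sigma>(z,D)\<close> is the case \<open>\<Phi>(z,\<zeta>) = z \<bullet> \<zeta>\<close>.\<close>

definition kohn_nirenberg :: "('a::euclidean_space \<times> 'a) distr \<Rightarrow> 'a operator" where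
  "kohn_nirenberg \<sigma> = type_I (\<lambda>z \<zeta>. z \<bullet> \<zeta>) \<sigma>"

definition quadratic_phase ::
    "real^'d^'d \<Rightarrow> real^'d^'d \<Rightarrow> real^'d^'d \<Rightarrow> real^'d \<Rightarrow> real^'d \<Rightarrow> real" where
  "quadratic_phase A B C x \<eta> =
     1/2 * (x \<bullet> ((C ** matrix_inv A) *v x)) + \<eta> \<bullet> (matrix_inv A *v x)
       - 1/2 * (\<eta> \<bullet> ((matrix_inv A ** B) *v \<eta>))"


section \<open>Symplectic matrices\<close>

definition block_matrix ::
    "real^'d^'d \<Rightarrow> real^'d^'d \<Rightarrow> real^'d^'d \<Rightarrow> real^'d^'d \<Rightarrow> real^('d::finite + 'd)^('d + 'd)" where
  "block_matrix A B C D = (\<chi> i j. case (i, j) of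
       (Inl a, Inl b) \<Rightarrow> A $ a $ b | (Inl a, Inr b) \<Rightarrow> B $ a $ b
     | (Inr a, Inl b) \<Rightarrow> C $ a $ b | (Inr a, Inr b) \<Rightarrow> D $ a $ b)"

definition Sp :: "(real^('d::finite + 'd)^('d + 'd)) set" where
  "Sp = {S. transpose S ** block_matrix 0 (mat 1) (- mat 1) 0 ** S
              = block_matrix 0 (mat 1) (- mat 1) 0}"

text \<open>Phase space is \<open>\<real>\<^sup>d \<times> \<real>\<^sup>d\<close>, written as a product type. A matrix acts on it through the
  identification of \<open>(x, \<xi>)\<close> with the column vector with upper half \<open>x\<close> and lower half \<open>\<xi>\<close>.\<close>

type_synonym 'd phase = "(real^'d) \<times> (real^'d)"

definition phase_vec :: "'d phase \<Rightarrow> real^('d::finite + 'd)" where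
  "phase_vec = (\<lambda>(x, \<xi>). \<chi> i. case i of Inl a \<Rightarrow> x $ a | Inr a \<Rightarrow> \<xi> $ a)"

definition vec_phase :: "real^('d::finite + 'd) \<Rightarrow> 'd phase" where
  "vec_phase v = (\<chi> a. v $ Inl a, \<chi> a. v $ Inr a)"

definition phase_apply :: "real^('d::finite + 'd)^('d + 'd) \<Rightarrow> 'd phase \<Rightarrow> 'd phase" where
  "phase_apply S z = vec_phase (S *v phase_vec z)"

lemma phase_apply_block_matrix:
  "phase_apply (block_matrix A B C D) (x, \<xi>) = (A *v x + B *v \<xi>, C *v x + D *v \<xi>)"
  by (simp add: phase_apply_def vec_phase_def phase_vec_def block_matrix_def
      matrix_vector_mult_def vec_eq_iff sum.Plus flip: UNIV_Plus_UNIV)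

text \<open>The distribution \<open>h(z, S w)\<close>.\<close>

definition pullback_snd ::
    "real^('d::finite + 'd)^('d + 'd) \<Rightarrow> ('d phase \<times> 'd phase) distr \<Rightarrow> ('d phase \<times> 'd phase) distr" where
  "pullback_snd S h =
     (\<lambda>\<phi>. h (\<lambda>(z, w). \<phi> (z, phase_apply (matrix_inv S) w)) / of_real \<bar>det S\<bar>)"


section \<open>The Wigner kernel and the class of Fourier integral operators\<close>

definition wigner :: "(real^'d \<Rightarrow> complex) \<Rightarrow> (real^'d \<Rightarrow> complex) \<Rightarrow> 'd phase \<Rightarrow> complex" where
  "wigner f g = (\<lambda>(x, \<xi>).
     \<integral>t. f (x + t /\<^sub>R 2) * cnj (g (x - t /\<^sub>R 2)) * cis (- 2 * pi * (\<xi> \<bullet> t)) \<partial>lborel)"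

text \<open>For distributions, the change of variables \<open>a = x + t/2\<close>, \<open>b = x - t/2\<close> in the integral
  for \<open>\<langle>W(u,v), \<Phi>\<rangle>\<close> gives \<open>\<langle>u \<otimes> cnj v, \<Psi>\<rangle>\<close> with
  \<open>\<Psi>(a,b) = \<integral> \<Phi>((a+b)/2, \<xi>) e\<^bsup>2\<pi>i \<xi>\<bullet>(a-b)\<^esup> d\<xi>\<close>, and
  \<open>\<langle>u \<otimes> cnj v, \<Psi>\<rangle> = \<langle>u, a \<mapsto> \<langle>v, cnj (\<Psi>(a, \<cdot>))\<rangle>\<rangle>\<close>.\<close>

definition distr_tensor_cnj ::
    "'a::euclidean_space distr \<Rightarrow> 'a distr \<Rightarrow> ('a \<times> 'a) distr" where
  "distr_tensor_cnj u v = (\<lambda>\<Psi>. u (\<lambda>a. v (\<lambda>b. cnj (\<Psi> (a, b)))))"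

definition wigner_distr :: "(real^'d) distr \<Rightarrow> (real^'d) distr \<Rightarrow> 'd phase distr" where
  "wigner_distr u v = (\<lambda>\<Phi>. distr_tensor_cnj u v
     (\<lambda>(a, b). \<integral>\<xi>. \<Phi> ((a + b) /\<^sub>R 2, \<xi>) * cis (2 * pi * (\<xi> \<bullet> (a - b))) \<partial>lborel))"

definition is_wigner_kernel :: "(real^'d) operator \<Rightarrow> ('d phase \<times> 'd phase) distr \<Rightarrow> bool" where
  "is_wigner_kernel T k \<longleftrightarrow> (\<exists>K. continuous_operator K \<and>
     (\<forall>f\<in>schwartz. \<forall>g\<in>schwartz. \<forall>\<Phi>\<in>schwartz.
        K (wigner f g) \<Phi> = wigner_distr (T f) (T g) \<Phi>) \<and>
     is_schwartz_kernel K k)"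

text \<open>The first argument is the window on \<open>\<real>\<^bsup>4d\<^esup>\<close> that defines the space of symbols.\<close>

definition FIO ::
    "('d phase \<times> 'd phase \<Rightarrow> complex) \<Rightarrow> real \<Rightarrow> real \<Rightarrow> real^('d::finite + 'd)^('d + 'd)
       \<Rightarrow> (real^'d) operator set" where
  "FIO g q s S = {T. continuous_operator T \<and> (\<exists>k h \<sigma>.
     is_wigner_kernel T k \<and>
     \<sigma> \<in> modulation_space g \<infinity> (ennreal q) (one_tensor_v s) \<and>
     is_schwartz_kernel (kohn_nirenberg \<sigma>) h \<and>
     (\<forall>\<phi>\<in>schwartz. k \<phi> = pullback_snd S h \<phi>))}"

end

theory Submission
  imports Defs "HOL-Probability.Probability"
begin

text \<open>Let \<open>K\<close> be the operator with kernel \<open>k\<close> that belongs to \<open>T\<close>. The adjoint of \<open>K\<close> belongs to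
  \<open>T*\<close>: this holds on Wigner transforms, whose span is dense. Hence the Wigner kernel of \<open>T*\<close> is
  \<open>cnj (k (w, z))\<close>, and with \<open>k (z, w) = h (z, S w)\<close> it equals \<open>h' (z, S\<^sup>-\<^sup>1 w)\<close> for
  \<open>h' (z, w) = cnj (h (S w, S z))\<close>. If \<open>h\<close> is the kernel of \<open>\<sigma>(z, D)\<close>, then \<open>h'\<close> is the kernel of a
  Kohn--Nirenberg operator whose symbol is the image of \<open>\<sigma>\<close> under complex conjugation, a linear change of
  variables and a chirp Fourier multiplier. These operations permute time-frequency shifts and act
  linearly on their frequencies, so that the claim becomes the independence of the modulation space
  of its window. For exponents \<open>q \<le> 1\<close> this follows from the reproducing formula and a Peetre-type
  maximal inequality.\<close>


section \<open>Bounded families of Schwartz functions\<close>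

text \<open>Distributions are bare functionals, so every change of variables is carried out on test
  functions, and each operation on these needs a continuity estimate. \<open>sbounded\<close>
  supplies them uniformly: for the tautological family of all Schwartz functions it expresses
  continuity of the operation. On Wigner transforms, Moyal's identity separates the two entries,
  which makes the identity for the adjoint of \<open>K\<close> easy to check there. Reaching a
  general test function requires moving distributions under an integral over phase space whose
  coefficients may grow polynomially; this is the analytic core of the density argument. For the
  symbol, the operation on test functions sends a shift with position \<open>y\<close> and frequency
  \<open>\<zeta>\<close> to one whose frequency is a linear isomorphic image of
  \<open>\<zeta>\<close> alone, while its position mixes \<open>y\<close> and
  \<open>\<zeta>\<close>. The supremum over positions absorbs the mixing, and the weight tolerates
  the isomorphism up to constants. What remains is that the window \<open>G\<close> has become
  \<open>adjoint_symbol Q G\<close>.\<close>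

definition dir_deriv :: "'a::euclidean_space \<Rightarrow> ('a \<Rightarrow> complex) \<Rightarrow> 'a \<Rightarrow> complex" where
  "dir_deriv v f = (\<lambda>x. frechet_derivative f (at x) v)"

lemma iterated_deriv_Cons_dir_deriv: "iterated_deriv (v # vs) f = dir_deriv v (iterated_deriv vs f)"
  by (simp add: dir_deriv_def)

text \<open>The recursion of \<open>iterated_deriv\<close> peels off the outermost derivative.
  Peeling off the innermost one identifies iterated derivatives of \<open>dir_deriv v f\<close> with
  those of \<open>f\<close>, which closes bounded families under differentiation.\<close>

lemma iterated_deriv_snoc: "iterated_deriv (vs @ [v]) f = iterated_deriv vs (dir_deriv v f)"
  by (induction vs) (simp_all add: dir_deriv_def)

lemma dir_deriv_eq: "(f has_derivative f') (at x) \<Longrightarrow> dir_deriv v f x = f' v"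
  unfolding dir_deriv_def using frechet_derivative_at by metis

lemma weight_mono: "N \<le> M \<Longrightarrow> (1 + norm x) ^ N \<le> (1 + norm x) ^ M"
  by (rule power_increasing) simp_all

lemma norm_1_triangle: "1 + norm (x + y) \<le> (1 + norm x) * (1 + norm y)"
proof -
  have "1 + norm (x + y) \<le> 1 + norm x + norm y" using norm_triangle_ineq[of x y] by linarith
  also have "\<dots> \<le> (1 + norm x) * (1 + norm y)" by (simp add: algebra_simps)
  finally show ?thesis .
qed

text \<open>Trades the weight for powers of single coordinates, as multiplication by a coordinate
  interacts well with Fourier transforms. The largest of 1 and the coordinates, called
  \<open>m\<close>, controls the norm up to the dimension.\<close>

lemma weight_le_sum_coords:
  fixes x :: "'a::euclidean_space"
  shows "(1 + norm x) ^ N \<le> (1 + real DIM('a)) ^ N * (1 + (\<Sum>b\<in>Basis. \<bar>x \<bullet> b\<bar> ^ N))"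
proof -
  define m where "m = Max (insert 1 ((\<lambda>b. \<bar>x \<bullet> b\<bar>) ` Basis))"
  have m1: "1 \<le> m" and mb: "\<And>b. b \<in> Basis \<Longrightarrow> \<bar>x \<bullet> b\<bar> \<le> m"
    unfolding m_def by (auto intro!: Max_ge simp del: Max_insert)
  have "norm x \<le> (\<Sum>b\<in>Basis. \<bar>x \<bullet> b\<bar>)" by (rule norm_le_l1)
  also have "\<dots> \<le> (\<Sum>b\<in>(Basis::'a set). m)" by (intro sum_mono mb)
  finally have "1 + norm x \<le> (1 + real DIM('a)) * m" using m1 by (simp add: algebra_simps)
  then have "(1 + norm x) ^ N \<le> ((1 + real DIM('a)) * m) ^ N" by (intro power_mono) auto
  also have "\<dots> = (1 + real DIM('a)) ^ N * m ^ N" by (simp add: power_mult_distrib)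
  also have "m ^ N \<le> 1 + (\<Sum>b\<in>Basis. \<bar>x \<bullet> b\<bar> ^ N)"
  proof -
    have "m \<in> insert 1 ((\<lambda>b. \<bar>x \<bullet> b\<bar>) ` Basis)" unfolding m_def by (intro Max_in) auto
    then consider "m = 1" | b where "b \<in> Basis" "m = \<bar>x \<bullet> b\<bar>" by auto
    then show ?thesis
    proof cases
      case 1 then show ?thesis by (simp add: sum_nonneg)
    next
      case 2
      have "\<bar>x \<bullet> b\<bar> ^ N \<le> (\<Sum>b\<in>Basis. \<bar>x \<bullet> b\<bar> ^ N)" using 2 by (intro member_le_sum) auto
      then show ?thesis using 2 by simp
    qed
  qed
  finally show ?thesis by (simp add: mult_left_mono)
qed

lemma has_derivative_cis: "(cis has_derivative (\<lambda>h. h *\<^sub>R (\<i> * cis t))) (at t)"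
  unfolding has_vector_derivative_def[symmetric] cis_conv_exp
  by (rule has_vector_derivative_eq_rhs[OF field_vector_diff_chain_at[OF
        has_vector_derivative_mult_right[OF has_vector_derivative_of_real[OF DERIV_ident]] DERIV_exp, unfolded o_def]]) simp

text \<open>Three scales occur: a single index with weight \<open>1\<close> gives membership in the Schwartz space, the
  Schwartz space with its own norms gives continuity of operators, and a vector parameter \<open>p\<close> with
  the powers of \<open>1 + norm p\<close> gives polynomial growth of Schwartz norms.\<close>

locale seminorm_scale =
  fixes I :: "'i set" and w :: "nat \<Rightarrow> 'i \<Rightarrow> real"
  assumes w_nonneg: "i \<in> I \<Longrightarrow> 0 \<le> w M i"
    and w_mono: "i \<in> I \<Longrightarrow> M \<le> M' \<Longrightarrow> w M i \<le> w M' i"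
begin

text \<open>One norm of the scale has to dominate uniformly in \<open>x\<close>, with a constant
  independent of \<open>i\<close>. This is the shape of a continuity estimate.\<close>

definition fam_bounded :: "('i \<Rightarrow> 'x \<Rightarrow> real) \<Rightarrow> bool" where
  "fam_bounded f \<longleftrightarrow> (\<exists>M C. 0 \<le> C \<and> (\<forall>i\<in>I. \<forall>x. f i x \<le> C * w M i))"

text \<open>The multipliers that cost no more than a change of the index in the scale. For a vector
  parameter these include all functions of polynomial growth.\<close>

definition moderate :: "('i \<Rightarrow> complex) \<Rightarrow> bool" where
  "moderate c \<longleftrightarrow> (\<forall>M. \<exists>M' C. 0 \<le> C \<and> (\<forall>i\<in>I. norm (c i) * w M i \<le> C * w M' i))"

definition sbounded :: "('i \<Rightarrow> 'a::euclidean_space \<Rightarrow> complex) \<Rightarrow> bool" where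
  "sbounded F \<longleftrightarrow> (\<forall>vs\<in>lists Basis.
     (\<forall>i\<in>I. \<forall>x. iterated_deriv vs (F i) differentiable (at x)) \<and>
     (\<forall>N. fam_bounded (\<lambda>i x. (1 + norm x) ^ N * norm (iterated_deriv vs (F i) x))))"

lemma fam_boundedI: "(\<And>i x. i \<in> I \<Longrightarrow> f i x \<le> C * w M i) \<Longrightarrow> 0 \<le> C \<Longrightarrow> fam_bounded f"
  unfolding fam_bounded_def by (rule exI[of _ M], rule exI[of _ C]) simp

lemma fam_boundedE:
  assumes "fam_bounded f"
  obtains C M where "0 \<le> C" "\<forall>i\<in>I. \<forall>x. f i x \<le> C * w M i"
proof -
  from assms obtain M C where "0 \<le> C \<and> (\<forall>i\<in>I. \<forall>x. f i x \<le> C * w M i)"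
    unfolding fam_bounded_def by (elim exE)
  then show ?thesis by (intro that[of C M]) auto
qed

lemma fam_bounded_reindex:
  assumes "fam_bounded g" "\<And>i x. i \<in> I \<Longrightarrow> f i x \<le> g i (h i x)" shows "fam_bounded f"
proof -
  obtain C M where "0 \<le> C" "\<forall>i\<in>I. \<forall>x. g i x \<le> C * w M i" by (rule fam_boundedE[OF assms(1)])
  note 1 = this(1) this(2)[rule_format]
  show ?thesis by (rule fam_boundedI[OF order_trans[OF assms(2) 1(2)] 1(1)])
qed

lemma fam_bounded_mono: "fam_bounded g \<Longrightarrow> (\<And>i x. i \<in> I \<Longrightarrow> f i x \<le> g i x) \<Longrightarrow> fam_bounded f"
  by (rule fam_bounded_reindex[where h = "\<lambda>i x. x"])

lemma fam_bounded_add: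
  assumes "fam_bounded f" "fam_bounded g" shows "fam_bounded (\<lambda>i x. f i x + g i x)"
proof -
  obtain C M where "0 \<le> C" "\<forall>i\<in>I. \<forall>x. f i x \<le> C * w M i" by (rule fam_boundedE[OF assms(1)])
  note 1 = this(1) this(2)[rule_format]
  obtain C' M' where "0 \<le> C'" "\<forall>i\<in>I. \<forall>x. g i x \<le> C' * w M' i" by (rule fam_boundedE[OF assms(2)])
  note 2 = this(1) this(2)[rule_format]
  show ?thesis
  proof (rule fam_boundedI[where M = "max M M'" and C = "C + C'"])
    fix i x assume i: "i \<in> I"
    have "C * w M i \<le> C * w (max M M') i" "C' * w M' i \<le> C' * w (max M M') i"
      using 1 2 i by (auto intro!: mult_left_mono w_mono)
    then show "f i x + g i x \<le> (C + C') * w (max M M') i"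
      using 1(2)[OF i, of x] 2(2)[OF i, of x] by (simp add: distrib_right)
  qed (use 1 2 in auto)
qed

lemma fam_bounded_0: "fam_bounded (\<lambda>i x. 0)"
  by (rule fam_boundedI[where C = 0]) auto

lemma fam_bounded_sum: "(\<And>a. a \<in> A \<Longrightarrow> fam_bounded (f a)) \<Longrightarrow> fam_bounded (\<lambda>i x. \<Sum>a\<in>A. f a i x)"
proof (induction A rule: infinite_finite_induct)
  case (insert a A)
  then show ?case using fam_bounded_add[of "f a" "\<lambda>i x. \<Sum>a\<in>A. f a i x"] by simp
qed (simp_all add: fam_bounded_0)

lemma fam_bounded_cmult:
  assumes "fam_bounded f" "0 \<le> c" shows "fam_bounded (\<lambda>i x. c * f i x)"
proof -
  obtain C M where "0 \<le> C" "\<forall>i\<in>I. \<forall>x. f i x \<le> C * w M i" by (rule fam_boundedE[OF assms(1)])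
  note 1 = this(1) this(2)[rule_format]
  show ?thesis
    by (rule fam_boundedI[where M = M and C = "c * C"])
       (use 1 assms in \<open>auto simp: mult.assoc intro!: mult_left_mono\<close>)
qed

lemma fam_bounded_moderate:
  assumes "fam_bounded f" "moderate c" shows "fam_bounded (\<lambda>i x. norm (c i) * f i x)"
proof -
  obtain C M where "0 \<le> C" "\<forall>i\<in>I. \<forall>x. f i x \<le> C * w M i" by (rule fam_boundedE[OF assms(1)])
  note 1 = this(1) this(2)[rule_format]
  obtain M' C' where 2: "0 \<le> C'" "\<And>i. i \<in> I \<Longrightarrow> norm (c i) * w M i \<le> C' * w M' i"
    using assms(2) unfolding moderate_def by blast
  show ?thesis
  proof (rule fam_boundedI[where M = M' and C = "C * C'"])
    fix i x assume i: "i \<in> I"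
    have "norm (c i) * f i x \<le> norm (c i) * (C * w M i)" by (intro mult_left_mono 1 i) auto
    also have "\<dots> = C * (norm (c i) * w M i)" by simp
    also have "\<dots> \<le> C * (C' * w M' i)" by (intro mult_left_mono 1 2 i)
    finally show "norm (c i) * f i x \<le> C * C' * w M' i" by simp
  qed (use 1 2 in auto)
qed

lemma moderate_const: "moderate (\<lambda>_. c)"
  unfolding moderate_def by (rule allI, rule exI, rule exI[of _ "norm c"]) auto

text \<open>\<open>sbounded\<close> is the largest property that is closed under differentiation and implies the
  decay estimates.\<close>

lemma sbounded_coinduct:
  fixes F :: "'i \<Rightarrow> 'a::euclidean_space \<Rightarrow> complex"
  assumes "X F"
    and deriv: "\<And>F. X F \<Longrightarrow> \<exists>D. (\<forall>i\<in>I. \<forall>x. (F i has_derivative D i x) (at x)) \<and>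
          (\<forall>v\<in>Basis. \<exists>F'. X F' \<and> (\<forall>i\<in>I. \<forall>x. F' i x = D i x v))"
    and bound: "\<And>F N. X F \<Longrightarrow> fam_bounded (\<lambda>i x. (1 + norm x) ^ N * norm (F i x))"
  shows "sbounded F"
proof -
  \<comment> \<open>Derivatives are identified with members of \<open>X\<close> for indices in
    \<open>I\<close> only, as nothing is known about the functions at other indices.\<close>
  have *: "\<exists>F'. X F' \<and> (\<forall>i\<in>I. iterated_deriv vs (F i) = F' i)" if "vs \<in> lists Basis" for vs
    using that
  proof (induction vs)
    case Nil then show ?case using assms(1) by auto
  next
    case (Cons v vs)
    then obtain F' where F': "X F'" "\<And>i. i \<in> I \<Longrightarrow> iterated_deriv vs (F i) = F' i" by auto
    obtain D where D: "\<And>i x. i \<in> I \<Longrightarrow> (F' i has_derivative D i x) (at x)"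
      "\<And>v. v \<in> Basis \<Longrightarrow> \<exists>F''. X F'' \<and> (\<forall>i\<in>I. \<forall>x. F'' i x = D i x v)" using deriv[OF F'(1)] by blast
    obtain F'' where "X F''" "\<And>i x. i \<in> I \<Longrightarrow> F'' i x = D i x v" using D(2)[of v] Cons by auto
    then show ?case using F' dir_deriv_eq[OF D(1)]
      by (intro exI[of _ F'']) (auto simp: iterated_deriv_Cons_dir_deriv simp del: iterated_deriv.simps)
  qed
  show ?thesis unfolding sbounded_def
  proof (intro ballI conjI allI)
    fix vs :: "'a list" assume "vs \<in> lists Basis"
    from *[OF this] obtain F' where F': "X F'" "\<And>i. i \<in> I \<Longrightarrow> iterated_deriv vs (F i) = F' i" by auto
    show "iterated_deriv vs (F i) differentiable at x" if "i \<in> I" for i x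
      using deriv[OF F'(1)] F'(2) that unfolding differentiable_def by metis
    show "fam_bounded (\<lambda>i x. (1 + norm x) ^ N * norm (iterated_deriv vs (F i) x))" for N
      by (rule fam_bounded_mono[OF bound[OF F'(1), of N]]) (simp add: F'(2))
  qed
qed

text \<open>In a class that is stable under multiplication by coordinates, a bound without weight
  already gives bounds with all weights. The scalar \<open>c\<close> makes room for the factor
  \<open>1 / (2 * pi * \<i>)\<close> of the Fourier transform.\<close>

lemma fam_bounded_weight_coords:
  assumes "X F"
    and mult: "\<And>F b. X F \<Longrightarrow> b \<in> Basis \<Longrightarrow>
        \<exists>F' (c::complex). X F' \<and> (\<forall>i\<in>I. \<forall>x. of_real (x \<bullet> b) * F i x = c * F' i x)"
    and bound: "\<And>F. X F \<Longrightarrow> fam_bounded (\<lambda>i x. norm (F i x))"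
  shows "fam_bounded (\<lambda>i (x::'a::euclidean_space). (1 + norm x) ^ N * norm (F i x))"
proof -
  have *: "\<exists>F' (c::complex). X F' \<and> (\<forall>i\<in>I. \<forall>x. of_real (x \<bullet> b) ^ N * F i x = c * F' i x)"
    if b: "b \<in> Basis" for b N
  proof (induction N)
    case 0 show ?case using assms(1) by (intro exI[of _ F] exI[of _ 1]) auto
  next
    case (Suc N)
    then obtain F' c where 1: "X F'" "\<And>i x. i \<in> I \<Longrightarrow> of_real (x \<bullet> b) ^ N * F i x = c * F' i x" by blast
    obtain F'' c' where 2: "X F''" "\<And>i x. i \<in> I \<Longrightarrow> of_real (x \<bullet> b) * F' i x = c' * F'' i x"
      using mult[OF 1(1) b] by blast
    have "of_real (x \<bullet> b) ^ Suc N * F i x = (c * c') * F'' i x" if "i \<in> I" for i x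
    proof -
      have "of_real (x \<bullet> b) ^ Suc N * F i x = of_real (x \<bullet> b) * (of_real (x \<bullet> b) ^ N * F i x)" by simp
      also have "\<dots> = c * (of_real (x \<bullet> b) * F' i x)" by (simp add: 1(2)[OF that])
      finally show ?thesis by (simp add: 2(2)[OF that])
    qed
    then show ?case using 2(1) by blast
  qed
  have **: "fam_bounded (\<lambda>i x. \<bar>x \<bullet> b\<bar> ^ N * norm (F i x))" if b: "b \<in> Basis" for b
  proof -
    obtain F' c where 1: "X F'" "\<And>i x. i \<in> I \<Longrightarrow> of_real (x \<bullet> b) ^ N * F i x = c * F' i x"
      using *[OF b, of N] by blast
    show ?thesis
    proof (rule fam_bounded_mono[OF fam_bounded_cmult[OF bound[OF 1(1)], of "norm c"]])
      fix i x assume "i \<in> I"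
      from 1(2)[OF this, of x] have "norm (of_real (x \<bullet> b) ^ N * F i x) = norm (c * F' i x)" by simp
      then show "\<bar>x \<bullet> b\<bar> ^ N * norm (F i x) \<le> norm c * norm (F' i x)"
        by (simp add: norm_mult norm_power)
    qed auto
  qed
  have "fam_bounded (\<lambda>i x. (1 + real DIM('a)) ^ N * (norm (F i x) + (\<Sum>b\<in>Basis. \<bar>x \<bullet> b\<bar> ^ N * norm (F i x))))"
    by (intro fam_bounded_cmult fam_bounded_add fam_bounded_sum ** bound assms(1)) auto
  then show ?thesis
  proof (rule fam_bounded_mono)
    fix i x
    have "(1 + norm x) ^ N * norm (F i x)
        \<le> ((1 + real DIM('a)) ^ N * (1 + (\<Sum>b\<in>Basis. \<bar>x \<bullet> b\<bar> ^ N))) * norm (F i x)"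
      by (intro mult_right_mono weight_le_sum_coords) auto
    then show "(1 + norm x) ^ N * norm (F i x)
       \<le> (1 + real DIM('a)) ^ N * (norm (F i x) + (\<Sum>b\<in>Basis. \<bar>x \<bullet> b\<bar> ^ N * norm (F i x)))"
      by (simp add: algebra_simps sum_distrib_left sum_distrib_right)
  qed
qed

lemma sbounded_has_derivative:
  assumes "sbounded F" "i \<in> I" shows "(F i has_derivative (\<lambda>h. dir_deriv h (F i) x)) (at x)"
proof -
  have "F i differentiable (at x)" using assms(1)[unfolded sbounded_def, THEN bspec, OF lists.Nil] assms(2) by simp
  then show ?thesis unfolding dir_deriv_def by (simp add: frechet_derivative_works[symmetric])
qed

lemma sbounded_fam_bounded: "sbounded F \<Longrightarrow> fam_bounded (\<lambda>i x. (1 + norm x) ^ N * norm (F i x))"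
  unfolding sbounded_def by (drule bspec[OF _ lists.Nil]) simp

lemma sbounded_dir_deriv_Basis:
  assumes "sbounded F" "v \<in> Basis" shows "sbounded (\<lambda>i. dir_deriv v (F i))"
  unfolding sbounded_def iterated_deriv_snoc[symmetric]
  using assms by (auto simp: sbounded_def simp del: iterated_deriv.simps)

lemma sbounded_cong:
  fixes F :: "'i \<Rightarrow> 'a::euclidean_space \<Rightarrow> complex"
  assumes "sbounded F" "\<And>i. i \<in> I \<Longrightarrow> F i = G i" shows "sbounded G"
proof (rule sbounded_coinduct[of "\<lambda>G. \<exists>F. sbounded F \<and> (\<forall>i\<in>I. F i = G i)"])
  show "\<exists>F. sbounded F \<and> (\<forall>i\<in>I. F i = G i)" using assms by auto
next
  fix G :: "'i \<Rightarrow> 'a \<Rightarrow> complex" assume "\<exists>F. sbounded F \<and> (\<forall>i\<in>I. F i = G i)"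
  then obtain F where F: "sbounded F" "\<And>i. i \<in> I \<Longrightarrow> F i = G i" by auto
  show "\<exists>D. (\<forall>i\<in>I. \<forall>x. (G i has_derivative D i x) (at x)) \<and>
          (\<forall>v\<in>Basis. \<exists>F'. (\<exists>F. sbounded F \<and> (\<forall>i\<in>I. F i = F' i)) \<and> (\<forall>i\<in>I. \<forall>x. F' i x = D i x v))"
    using sbounded_has_derivative[OF F(1)] sbounded_dir_deriv_Basis[OF F(1)] F(2)
    by (intro exI[of _ "\<lambda>i x h. dir_deriv h (F i) x"]) (auto intro!: exI[of _ "\<lambda>i. dir_deriv _ (F i)"])
  show "fam_bounded (\<lambda>i x. (1 + norm x) ^ N * norm (G i x))" for N
    by (rule fam_bounded_mono[OF sbounded_fam_bounded[OF F(1), of N]]) (simp add: F(2))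
qed

lemma sbounded_0: "sbounded (\<lambda>i x. 0)"
  by (rule sbounded_coinduct[of "\<lambda>F. F = (\<lambda>i x. 0)"])
     (auto intro!: exI[of _ "\<lambda>_ _ _. 0"] simp: fam_bounded_0)

lemma sbounded_add:
  fixes F :: "'i \<Rightarrow> 'a::euclidean_space \<Rightarrow> complex"
  assumes "sbounded F" "sbounded G" shows "sbounded (\<lambda>i x. F i x + G i x)"
proof (rule sbounded_coinduct[of "\<lambda>H. \<exists>F G. sbounded F \<and> sbounded G \<and> H = (\<lambda>i x. F i x + G i x)"])
  fix H :: "'i \<Rightarrow> 'a \<Rightarrow> complex" assume "\<exists>F G. sbounded F \<and> sbounded G \<and> H = (\<lambda>i x. F i x + G i x)"
  then obtain F G where F: "sbounded F" "sbounded G" and H: "H = (\<lambda>i x. F i x + G i x)" by auto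
  have "\<forall>i\<in>I. \<forall>x. (H i has_derivative (\<lambda>h. dir_deriv h (F i) x + dir_deriv h (G i) x)) (at x)"
    unfolding H by (auto intro!: has_derivative_add sbounded_has_derivative F)
  moreover have "\<exists>H'. (\<exists>F G. sbounded F \<and> sbounded G \<and> H' = (\<lambda>i x. F i x + G i x)) \<and>
       (\<forall>i\<in>I. \<forall>x. H' i x = dir_deriv v (F i) x + dir_deriv v (G i) x)" if "v \<in> Basis" for v
    using sbounded_dir_deriv_Basis[OF F(1) that] sbounded_dir_deriv_Basis[OF F(2) that] by fastforce
  ultimately show "\<exists>D. (\<forall>i\<in>I. \<forall>x. (H i has_derivative D i x) (at x)) \<and>
       (\<forall>v\<in>Basis. \<exists>H'. (\<exists>F G. sbounded F \<and> sbounded G \<and> H' = (\<lambda>i x. F i x + G i x)) \<and>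
       (\<forall>i\<in>I. \<forall>x. H' i x = D i x v))"
    by (intro exI[of _ "\<lambda>i x h. dir_deriv h (F i) x + dir_deriv h (G i) x"]) auto
  show "fam_bounded (\<lambda>i x. (1 + norm x) ^ N * norm (H i x))" for N
  proof (rule fam_bounded_mono[OF fam_bounded_add[OF F[THEN sbounded_fam_bounded, of N]]])
    show "(1 + norm x) ^ N * norm (H i x) \<le> (1 + norm x) ^ N * norm (F i x) + (1 + norm x) ^ N * norm (G i x)" for i x
      unfolding H by (simp flip: distrib_left add: mult_left_mono norm_triangle_ineq)
  qed
qed (use assms in auto)

lemma sbounded_scale:
  fixes F :: "'i \<Rightarrow> 'a::euclidean_space \<Rightarrow> complex"
  assumes "sbounded F" "moderate c" shows "sbounded (\<lambda>i x. c i * F i x)"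
proof (rule sbounded_coinduct[of "\<lambda>H. \<exists>F. sbounded F \<and> H = (\<lambda>i x. c i * F i x)"])
  fix H :: "'i \<Rightarrow> 'a \<Rightarrow> complex" assume "\<exists>F. sbounded F \<and> H = (\<lambda>i x. c i * F i x)"
  then obtain F where F: "sbounded F" and H: "H = (\<lambda>i x. c i * F i x)" by auto
  have "\<forall>i\<in>I. \<forall>x. (H i has_derivative (\<lambda>h. c i * dir_deriv h (F i) x)) (at x)"
    unfolding H by (auto intro!: has_derivative_mult_right sbounded_has_derivative F)
  moreover have "\<exists>H'. (\<exists>F. sbounded F \<and> H' = (\<lambda>i x. c i * F i x)) \<and>
       (\<forall>i\<in>I. \<forall>x. H' i x = c i * dir_deriv v (F i) x)" if "v \<in> Basis" for v
    using sbounded_dir_deriv_Basis[OF F(1) that] by fastforce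
  ultimately show "\<exists>D. (\<forall>i\<in>I. \<forall>x. (H i has_derivative D i x) (at x)) \<and>
       (\<forall>v\<in>Basis. \<exists>H'. (\<exists>F. sbounded F \<and> H' = (\<lambda>i x. c i * F i x)) \<and>
       (\<forall>i\<in>I. \<forall>x. H' i x = D i x v))"
    by (intro exI[of _ "\<lambda>i x h. c i * dir_deriv h (F i) x"]) auto
  show "fam_bounded (\<lambda>i x. (1 + norm x) ^ N * norm (H i x))" for N
    by (rule fam_bounded_mono[OF fam_bounded_moderate[OF sbounded_fam_bounded[OF F, of N] assms(2)]]) (simp add: H norm_mult)
qed (use assms in auto)

lemma sbounded_cmult: "sbounded F \<Longrightarrow> sbounded (\<lambda>i x. c * F i x)"
  using sbounded_scale[OF _ moderate_const] .

lemma sbounded_sum: "(\<And>a. a \<in> A \<Longrightarrow> sbounded (F a)) \<Longrightarrow> sbounded (\<lambda>i x. \<Sum>a\<in>A. F a i x)"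
proof (induction A rule: infinite_finite_induct)
  case (insert a A)
  then show ?case using sbounded_add[of "F a" "\<lambda>i x. \<Sum>a\<in>A. F a i x"] by simp
qed (simp_all add: sbounded_0)

lemma dir_deriv_Basis_expand:
  assumes "sbounded F" "i \<in> I"
  shows "dir_deriv v (F i) x = (\<Sum>b\<in>Basis. of_real (v \<bullet> b) * dir_deriv b (F i) x)"
proof -
  interpret bounded_linear "\<lambda>h. dir_deriv h (F i) x"
    using sbounded_has_derivative[OF assms] by (rule has_derivative_bounded_linear)
  have "dir_deriv (\<Sum>b\<in>Basis. (v \<bullet> b) *\<^sub>R b) (F i) x = (\<Sum>b\<in>Basis. of_real (v \<bullet> b) * dir_deriv b (F i) x)"
    by (simp add: sum scale scaleR_conv_of_real)
  then show ?thesis by (simp add: euclidean_representation)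
qed

lemma sbounded_dir_deriv:
  assumes "sbounded F" shows "sbounded (\<lambda>i. dir_deriv v (F i))"
proof (rule sbounded_cong)
  show "sbounded (\<lambda>i x. \<Sum>b\<in>Basis. of_real (v \<bullet> b) * dir_deriv b (F i) x)"
    by (intro sbounded_sum sbounded_cmult sbounded_dir_deriv_Basis assms)
qed (auto simp: dir_deriv_Basis_expand[OF assms])

lemma sbounded_linear_mult:
  fixes F :: "'i \<Rightarrow> 'a::euclidean_space \<Rightarrow> complex"
  assumes "sbounded F" and l: "bounded_linear l"
  shows "sbounded (\<lambda>i x. of_real (l x) * F i x)"
proof -
  \<comment> \<open>The product rule leaves the term \<open>l v * F\<close>, in which the linear
    function has become a constant. The summand \<open>G\<close> collects such terms and closes the
    class under differentiation.\<close>
  let ?X = "\<lambda>H. \<exists>F G. sbounded F \<and> sbounded G \<and> H = (\<lambda>i x. of_real (l x) * F i x + G i x)"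
  obtain K where K: "\<And>x. \<bar>l x\<bar> \<le> norm x * K" "0 \<le> K"
    using bounded_linear.nonneg_bounded[OF l] by auto
  show ?thesis
  proof (rule sbounded_coinduct[of ?X])
    show "?X (\<lambda>i x. of_real (l x) * F i x)" using assms(1) sbounded_0 by force
  next
    fix H :: "'i \<Rightarrow> 'a \<Rightarrow> complex" assume "?X H"
    then obtain F G where F: "sbounded F" "sbounded G" and H: "H = (\<lambda>i x. of_real (l x) * F i x + G i x)" by auto
    let ?D = "\<lambda>i x h. (of_real (l x) * dir_deriv h (F i) x + of_real (l h) * F i x) + dir_deriv h (G i) x"
    have "\<forall>i\<in>I. \<forall>x. (H i has_derivative ?D i x) (at x)"
      unfolding H
      by (auto intro!: has_derivative_add has_derivative_mult sbounded_has_derivative F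
          bounded_linear_imp_has_derivative bounded_linear_compose[OF bounded_linear_of_real l])
    moreover have "\<exists>H'. ?X H' \<and> (\<forall>i\<in>I. \<forall>x. H' i x = ?D i x v)" if "v \<in> Basis" for v
    proof (rule exI, rule conjI)
      show "?X (\<lambda>i x. of_real (l x) * dir_deriv v (F i) x + (of_real (l v) * F i x + dir_deriv v (G i) x))"
        by (rule exI[of _ "\<lambda>i. dir_deriv v (F i)"], rule exI, intro conjI, rule sbounded_dir_deriv[OF F(1)],
            rule sbounded_add[OF sbounded_cmult[OF F(1)] sbounded_dir_deriv[OF F(2)]], rule refl)
    qed (simp add: algebra_simps)
    ultimately show "\<exists>D. (\<forall>i\<in>I. \<forall>x. (H i has_derivative D i x) (at x)) \<and>
       (\<forall>v\<in>Basis. \<exists>H'. ?X H' \<and> (\<forall>i\<in>I. \<forall>x. H' i x = D i x v))"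
      by (intro exI[of _ ?D]) auto
    show "fam_bounded (\<lambda>i x. (1 + norm x) ^ N * norm (H i x))" for N
    proof (rule fam_bounded_mono[OF fam_bounded_add[OF fam_bounded_cmult[OF sbounded_fam_bounded[OF F(1), of "Suc N"] K(2)] sbounded_fam_bounded[OF F(2), of N]]])
      fix i x
      have "norm (H i x) \<le> \<bar>l x\<bar> * norm (F i x) + norm (G i x)"
        unfolding H by (rule order_trans[OF norm_triangle_ineq]) (simp add: norm_mult)
      also have "\<dots> \<le> ((1 + norm x) * K) * norm (F i x) + norm (G i x)"
        using K by (intro add_mono mult_right_mono order_trans[OF K(1)]) auto
      finally have "(1 + norm x) ^ N * norm (H i x) \<le> (1 + norm x) ^ N * (((1 + norm x) * K) * norm (F i x) + norm (G i x))"
        by (intro mult_left_mono) auto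
      then show "(1 + norm x) ^ N * norm (H i x)
          \<le> K * ((1 + norm x) ^ Suc N * norm (F i x)) + (1 + norm x) ^ N * norm (G i x)"
        by (simp add: algebra_simps)
    qed
  qed
qed

text \<open>Differentiating the exponential brings down the gradient of the phase, so stability
  under multiplication by its components suffices. This is a hypothesis because the components may
  be linear in \<open>x\<close>, as for chirps, or grow with the index, as for time-frequency
  shifts.\<close>

lemma sbounded_cis:
  fixes F :: "'i \<Rightarrow> 'a::euclidean_space \<Rightarrow> complex"
  assumes "sbounded F"
    and Q: "\<And>i x. i \<in> I \<Longrightarrow> (Q i has_derivative Q' i x) (at x)"
    and mult: "\<And>b F. b \<in> Basis \<Longrightarrow> sbounded F \<Longrightarrow> sbounded (\<lambda>i x. of_real (Q' i x b) * F i x)"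
  shows "sbounded (\<lambda>i x. cis (Q i x) * F i x)"
proof -
  let ?X = "\<lambda>H. \<exists>F. sbounded F \<and> H = (\<lambda>i x. cis (Q i x) * F i x)"
  show ?thesis
  proof (rule sbounded_coinduct[of ?X])
    fix H :: "'i \<Rightarrow> 'a \<Rightarrow> complex" assume "?X H"
    then obtain F where F: "sbounded F" and H: "H = (\<lambda>i x. cis (Q i x) * F i x)" by auto
    let ?D = "\<lambda>i x h. cis (Q i x) * dir_deriv h (F i) x + (Q' i x h *\<^sub>R (\<i> * cis (Q i x))) * F i x"
    have "\<forall>i\<in>I. \<forall>x. (H i has_derivative ?D i x) (at x)"
    proof (intro ballI allI)
      fix i x assume i: "i \<in> I"
      have "((\<lambda>x. cis (Q i x)) has_derivative (\<lambda>h. Q' i x h *\<^sub>R (\<i> * cis (Q i x)))) (at x)"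
        using has_derivative_compose[OF Q[OF i] has_derivative_cis] by simp
      then show "(H i has_derivative ?D i x) (at x)"
        unfolding H by (intro has_derivative_mult sbounded_has_derivative F i)
    qed
    moreover have "\<exists>H'. ?X H' \<and> (\<forall>i\<in>I. \<forall>x. H' i x = ?D i x v)" if "v \<in> Basis" for v
    proof (rule exI, rule conjI)
      show "?X (\<lambda>i x. cis (Q i x) * (dir_deriv v (F i) x + \<i> * (of_real (Q' i x v) * F i x)))"
        by (rule exI, rule conjI[OF _ refl]) (intro sbounded_add sbounded_cmult sbounded_dir_deriv F mult that)
    qed (simp add: algebra_simps scaleR_conv_of_real)
    ultimately show "\<exists>D. (\<forall>i\<in>I. \<forall>x. (H i has_derivative D i x) (at x)) \<and>
       (\<forall>v\<in>Basis. \<exists>H'. ?X H' \<and> (\<forall>i\<in>I. \<forall>x. H' i x = D i x v))"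
      by (intro exI[of _ ?D]) auto
    show "fam_bounded (\<lambda>i x. (1 + norm x) ^ N * norm (H i x))" for N
      by (rule fam_bounded_mono[OF sbounded_fam_bounded[OF F, of N]]) (simp add: H norm_mult)
  qed (use assms(1) in auto)
qed

lemma sbounded_cnj:
  fixes F :: "'i \<Rightarrow> 'a::euclidean_space \<Rightarrow> complex"
  assumes "sbounded F" shows "sbounded (\<lambda>i x. cnj (F i x))"
proof -
  let ?X = "\<lambda>H. \<exists>F. sbounded F \<and> H = (\<lambda>i x. cnj (F i x))"
  show ?thesis
  proof (rule sbounded_coinduct[of ?X])
    fix H :: "'i \<Rightarrow> 'a \<Rightarrow> complex" assume "?X H"
    then obtain F where F: "sbounded F" and H: "H = (\<lambda>i x. cnj (F i x))" by auto
    have "\<forall>i\<in>I. \<forall>x. (H i has_derivative (\<lambda>h. cnj (dir_deriv h (F i) x))) (at x)"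
      unfolding H
      by (auto intro!: bounded_linear.has_derivative[OF bounded_linear_cnj] sbounded_has_derivative F)
    then show "\<exists>D. (\<forall>i\<in>I. \<forall>x. (H i has_derivative D i x) (at x)) \<and>
       (\<forall>v\<in>Basis. \<exists>H'. ?X H' \<and> (\<forall>i\<in>I. \<forall>x. H' i x = D i x v))"
      using sbounded_dir_deriv[OF F] by (intro exI[of _ "\<lambda>i x h. cnj (dir_deriv h (F i) x)"]) fastforce
    show "fam_bounded (\<lambda>i x. (1 + norm x) ^ N * norm (H i x))" for N
      by (rule fam_bounded_mono[OF sbounded_fam_bounded[OF F, of N]]) (simp add: H norm_mult)
  qed (use assms in auto)
qed

text \<open>Injectivity of \<open>L\<close> turns decay in \<open>L x\<close> into decay in
  \<open>x\<close>. The translation costs a power of \<open>1 + norm (a i)\<close>, which has to be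
  a moderate multiplier.\<close>

lemma sbounded_compose_affine:
  fixes L :: "'b::euclidean_space \<Rightarrow> 'a::euclidean_space"
  assumes "sbounded F" and L: "bounded_linear L" and inj: "\<And>x. norm x \<le> \<kappa> * norm (L x)"
    and a: "\<And>k. moderate (\<lambda>i. of_real ((1 + norm (a i)) ^ k))"
  shows "sbounded (\<lambda>i x. F i (L x + a i))"
proof -
  let ?X = "\<lambda>H. \<exists>F. sbounded F \<and> H = (\<lambda>i x. F i (L x + a i))"
  show ?thesis
  proof (rule sbounded_coinduct[of ?X])
    fix H :: "'i \<Rightarrow> 'b \<Rightarrow> complex" assume "?X H"
    then obtain F where F: "sbounded F" and H: "H = (\<lambda>i x. F i (L x + a i))" by auto
    have "\<forall>i\<in>I. \<forall>x. (H i has_derivative (\<lambda>h. dir_deriv (L h) (F i) (L x + a i))) (at x)"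
    proof (intro ballI allI)
      fix i x assume i: "i \<in> I"
      have "((\<lambda>x. L x + a i) has_derivative L) (at x)"
        using has_derivative_add[OF bounded_linear_imp_has_derivative[OF L] has_derivative_const] by simp
      from has_derivative_compose[OF this sbounded_has_derivative[OF F i]]
      show "(H i has_derivative (\<lambda>h. dir_deriv (L h) (F i) (L x + a i))) (at x)" unfolding H by simp
    qed
    then show "\<exists>D. (\<forall>i\<in>I. \<forall>x. (H i has_derivative D i x) (at x)) \<and>
       (\<forall>v\<in>Basis. \<exists>H'. ?X H' \<and> (\<forall>i\<in>I. \<forall>x. H' i x = D i x v))"
      using sbounded_dir_deriv[OF F] by (intro exI[of _ "\<lambda>i x h. dir_deriv (L h) (F i) (L x + a i)"]) fastforce
    show "fam_bounded (\<lambda>i x. (1 + norm x) ^ N * norm (H i x))" for N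
    proof -
      have "fam_bounded (\<lambda>i x. (1 + \<bar>\<kappa>\<bar>) ^ N * (norm (of_real ((1 + norm (a i)) ^ N) :: complex) * ((1 + norm x) ^ N * norm (F i x))))"
        by (intro fam_bounded_cmult fam_bounded_moderate sbounded_fam_bounded F a) auto
      then show ?thesis
      proof (rule fam_bounded_reindex)
        fix i x
        have "1 + norm x \<le> 1 + \<bar>\<kappa>\<bar> * norm (L x)"
          using inj[of x] mult_right_mono[OF abs_ge_self norm_ge_zero, of \<kappa> "L x"] by linarith
        also have "\<dots> \<le> (1 + \<bar>\<kappa>\<bar>) * (1 + norm (L x))" by (simp add: algebra_simps)
        also have "\<dots> \<le> (1 + \<bar>\<kappa>\<bar>) * ((1 + norm (L x + a i)) * (1 + norm (a i)))"
          using norm_1_triangle[of "L x + a i" "- a i"] by (intro mult_left_mono) simp_all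
        finally have "1 + norm x \<le> (1 + \<bar>\<kappa>\<bar>) * ((1 + norm (L x + a i)) * (1 + norm (a i)))" .
        then have "1 + norm x \<le> (1 + \<bar>\<kappa>\<bar>) * ((1 + norm (a i)) * (1 + norm (L x + a i)))"
          by (simp only: mult_ac)
        then have "(1 + norm x) ^ N \<le> ((1 + \<bar>\<kappa>\<bar>) * ((1 + norm (a i)) * (1 + norm (L x + a i)))) ^ N"
          by (intro power_mono) auto
        then have "(1 + norm x) ^ N * norm (H i x) \<le> ((1 + \<bar>\<kappa>\<bar>) * ((1 + norm (a i)) * (1 + norm (L x + a i)))) ^ N * norm (H i x)"
          by (intro mult_right_mono) auto
        also have "norm (of_real ((1 + norm (a i)) ^ N) :: complex) = (1 + norm (a i)) ^ N"
          by (simp only: norm_of_real) simp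
        ultimately show "(1 + norm x) ^ N * norm (H i x)
          \<le> (1 + \<bar>\<kappa>\<bar>) ^ N * (norm (of_real ((1 + norm (a i)) ^ N) :: complex) * ((1 + norm (L x + a i)) ^ N * norm (F i (L x + a i))))"
          by (simp add: power_mult_distrib H mult.assoc)
      qed
    qed
  qed (use assms in auto)
qed

end

section \<open>Schwartz functions\<close>

lemma schwartz_bounded:
  assumes "f \<in> schwartz" "vs \<in> lists Basis"
  shows "\<exists>C. \<forall>x. (1 + norm x) ^ N * norm (iterated_deriv vs f x) \<le> C"
proof -
  have "\<forall>vs\<in>lists Basis. \<forall>N. \<exists>C. \<forall>x. (1 + norm x) ^ N * norm (iterated_deriv vs f x) \<le> C"
    using assms(1) unfolding schwartz_def by simp
  then show ?thesis using assms(2) by simp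
qed

lemma finite_basis_lists: "finite {vs \<in> lists (Basis::'a::euclidean_space set). length vs \<le> N}"
proof -
  have "finite {vs. set vs \<subseteq> (Basis::'a set) \<and> length vs \<le> N}"
    by (rule finite_lists_length_le) simp
  then show ?thesis by (rule rev_finite_subset) auto
qed

lemma schwartz_norm_bdd_above:
  fixes f :: "'a::euclidean_space \<Rightarrow> complex"
  assumes f: "f \<in> schwartz"
  shows "bdd_above ((\<lambda>(vs, x). (1 + norm x) ^ N * norm (iterated_deriv vs f x)) `
           ({vs \<in> lists Basis. length vs \<le> N} \<times> UNIV))"
proof -
  note fin = finite_basis_lists[where 'a = 'a, of N]
  have "\<forall>vs\<in>lists Basis. \<exists>C. \<forall>x. (1 + norm x) ^ N * norm (iterated_deriv vs f x) \<le> C"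
    by (intro ballI schwartz_bounded f)
  from bchoice[OF this] obtain C where
    "\<forall>vs\<in>lists Basis. \<forall>x. (1 + norm x) ^ N * norm (iterated_deriv vs f x) \<le> C vs" by (elim exE)
  note C = this[rule_format]
  show ?thesis
  proof (rule bdd_aboveI2)
    fix p :: "'a list \<times> 'a" assume p: "p \<in> {vs \<in> lists Basis. length vs \<le> N} \<times> UNIV"
    obtain vs x where vx: "p = (vs, x)" by (cases p)
    have "(1 + norm x) ^ N * norm (iterated_deriv vs f x) \<le> C vs" using p vx by (intro C) auto
    also have "\<dots> \<le> Max (C ` {vs \<in> lists Basis. length vs \<le> N})"
      using p vx by (intro Max_ge finite_imageI fin) auto
    finally show "(case p of (vs, x) \<Rightarrow> (1 + norm x) ^ N * norm (iterated_deriv vs f x))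
       \<le> Max (C ` {vs \<in> lists Basis. length vs \<le> N})" by (simp add: vx)
  qed
qed

lemma schwartz_norm_ge:
  assumes "f \<in> schwartz" "vs \<in> lists Basis" "length vs \<le> N"
  shows "(1 + norm x) ^ N * norm (iterated_deriv vs f x) \<le> schwartz_norm N f"
proof -
  have "(case (vs, x) of (vs, x) \<Rightarrow> (1 + norm x) ^ N * norm (iterated_deriv vs f x)) \<le> schwartz_norm N f"
    unfolding schwartz_norm_def
    by (rule cSUP_upper[OF _ schwartz_norm_bdd_above[OF assms(1)]]) (use assms in auto)
  then show ?thesis by simp
qed

lemma schwartz_norm_le:
  assumes "\<And>vs x. vs \<in> lists Basis \<Longrightarrow> length vs \<le> N \<Longrightarrow> (1 + norm x) ^ N * norm (iterated_deriv vs f x) \<le> C"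
  shows "schwartz_norm N f \<le> C"
  unfolding schwartz_norm_def by (rule cSUP_least) (use assms in \<open>auto intro!: exI[of _ "[]"]\<close>)

lemma schwartz_norm_nonneg: "f \<in> schwartz \<Longrightarrow> 0 \<le> schwartz_norm N f"
  by (rule order_trans[OF _ schwartz_norm_ge[of f "[]" N 0]]) auto

lemma schwartz_norm_mono:
  assumes "f \<in> schwartz" "M \<le> N" shows "schwartz_norm M f \<le> schwartz_norm N f"
proof (rule schwartz_norm_le)
  fix vs :: "'a list" and x assume vs: "vs \<in> lists Basis" "length vs \<le> M"
  have "(1 + norm x) ^ M * norm (iterated_deriv vs f x) \<le> (1 + norm x) ^ N * norm (iterated_deriv vs f x)"
    by (intro mult_right_mono weight_mono assms) auto
  also have "\<dots> \<le> schwartz_norm N f" using vs assms by (intro schwartz_norm_ge) auto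
  finally show "(1 + norm x) ^ M * norm (iterated_deriv vs f x) \<le> schwartz_norm N f" .
qed

interpretation single: seminorm_scale "UNIV :: unit set" "\<lambda>_ _. 1"
  by unfold_locales auto

interpretation op: seminorm_scale "schwartz :: ('a::euclidean_space \<Rightarrow> complex) set" schwartz_norm
  by unfold_locales (auto intro: schwartz_norm_nonneg schwartz_norm_mono)

interpretation poly: seminorm_scale "UNIV :: 'a::real_normed_vector set" "\<lambda>M p. (1 + norm p) ^ M"
  by unfold_locales (auto intro: weight_mono)

lemma single_fam_bounded: "single.fam_bounded f \<longleftrightarrow> (\<exists>C. \<forall>x. f () x \<le> C)"
proof
  assume "\<exists>C. \<forall>x. f () x \<le> C"
  then obtain C where C: "\<And>x. f () x \<le> C" by auto
  show "single.fam_bounded f"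
    by (rule single.fam_boundedI[where C = "max C 0"]) (use C in \<open>auto simp: max.coboundedI1\<close>)
qed (auto simp: single.fam_bounded_def)

lemma schwartz_iff_sbounded: "f \<in> schwartz \<longleftrightarrow> single.sbounded (\<lambda>_. f)"
  unfolding single.sbounded_def schwartz_def single_fam_bounded by auto

text \<open>The tautological family, indexed by the functions themselves. A construction that
  preserves \<open>sbounded\<close>, applied to it, yields a bound of Schwartz norms by Schwartz
  norms.\<close>

lemma op_sbounded_id: "op.sbounded (\<lambda>f. f)"
  unfolding op.sbounded_def
proof (intro ballI conjI allI)
  fix vs :: "'a list" assume vs: "vs \<in> lists Basis"
  show "iterated_deriv vs f differentiable (at x)" if "f \<in> schwartz" for f x
    using that vs unfolding schwartz_def by auto
  show "op.fam_bounded (\<lambda>f x. (1 + norm x) ^ N * norm (iterated_deriv vs f x))" for N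
  \<comment> \<open>A single index of \<open>schwartz_norm\<close> limits both the power of the
    weight and the order of the derivatives, so it has to dominate both.\<close>
  proof (rule op.fam_boundedI[where M = "max N (length vs)" and C = 1])
    fix f x assume f: "(f :: 'a \<Rightarrow> complex) \<in> schwartz"
    have "(1 + norm x) ^ N * norm (iterated_deriv vs f x) \<le> (1 + norm x) ^ max N (length vs) * norm (iterated_deriv vs f x)"
      by (intro mult_right_mono weight_mono) auto
    also have "\<dots> \<le> schwartz_norm (max N (length vs)) f" by (intro schwartz_norm_ge f vs) auto
    finally show "(1 + norm x) ^ N * norm (iterated_deriv vs f x) \<le> 1 * schwartz_norm (max N (length vs)) f" by simp
  qed auto
qed

context seminorm_scale begin

lemma sbounded_schwartz:
  fixes F :: "'i \<Rightarrow> 'a::euclidean_space \<Rightarrow> complex"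
  assumes "sbounded F" "i \<in> I" shows "F i \<in> schwartz"
  unfolding schwartz_def
proof (intro CollectI ballI conjI allI)
  fix vs :: "'a list" assume "vs \<in> lists Basis"
  note F = assms(1)[unfolded sbounded_def, rule_format, OF this]
  show "iterated_deriv vs (F i) differentiable (at x)" for x using F assms(2) by auto
  show "\<exists>C. \<forall>x. (1 + norm x) ^ N * norm (iterated_deriv vs (F i) x) \<le> C" for N
  proof -
    have "fam_bounded (\<lambda>i x. (1 + norm x) ^ N * norm (iterated_deriv vs (F i) x))" using F by simp
    then obtain C M where "0 \<le> C" "\<forall>i\<in>I. \<forall>x. (1 + norm x) ^ N * norm (iterated_deriv vs (F i) x) \<le> C * w M i"
      by (rule fam_boundedE)
    then show ?thesis using assms(2) by (intro exI[of _ "C * w M i"]) simp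
  qed
qed

text \<open>\<open>sbounded\<close> treats every derivative separately. Only finitely many lists of
  directions enter a Schwartz norm, so summing over them gives one uniform bound.\<close>

lemma sbounded_norm_le:
  fixes F :: "'i \<Rightarrow> 'a::euclidean_space \<Rightarrow> complex"
  assumes "sbounded F"
  shows "\<exists>M C. 0 \<le> C \<and> (\<forall>i\<in>I. schwartz_norm N (F i) \<le> C * w M i)"
proof -
  note fin = finite_basis_lists[where 'a = 'a, of N]
  have "fam_bounded (\<lambda>i x. \<Sum>vs\<in>{vs \<in> lists (Basis::'a set). length vs \<le> N}. (1 + norm x) ^ N * norm (iterated_deriv vs (F i) x))"
    using assms unfolding sbounded_def by (intro fam_bounded_sum) auto
  then obtain C M where C: "0 \<le> C" "\<forall>i\<in>I. \<forall>x. (\<Sum>vs\<in>{vs \<in> lists (Basis::'a set). length vs \<le> N}.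
     (1 + norm x) ^ N * norm (iterated_deriv vs (F i) x)) \<le> C * w M i" by (rule fam_boundedE)
  have "schwartz_norm N (F i) \<le> C * w M i" if i: "i \<in> I" for i
  proof (rule schwartz_norm_le)
    fix vs :: "'a list" and x assume vs: "vs \<in> lists Basis" "length vs \<le> N"
    have "(1 + norm x) ^ N * norm (iterated_deriv vs (F i) x) \<le> (\<Sum>vs\<in>{vs \<in> lists (Basis::'a set). length vs \<le> N}.
     (1 + norm x) ^ N * norm (iterated_deriv vs (F i) x))"
      using vs by (intro member_le_sum[of vs] fin) auto
    also have "\<dots> \<le> C * w M i" using C(2) i by blast
    finally show "(1 + norm x) ^ N * norm (iterated_deriv vs (F i) x) \<le> C * w M i" .
  qed
  then show ?thesis using C(1) by blast
qed

end

lemma schwartz_dir_deriv: "f \<in> schwartz \<Longrightarrow> dir_deriv v f \<in> schwartz"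
  unfolding schwartz_iff_sbounded by (rule single.sbounded_dir_deriv)

lemma schwartz_has_derivative: "f \<in> schwartz \<Longrightarrow> (f has_derivative (\<lambda>h. dir_deriv h f x)) (at x)"
  using single.sbounded_has_derivative[of "\<lambda>_. f"] unfolding schwartz_iff_sbounded by simp

lemma schwartz_decay:
  assumes "f \<in> schwartz" obtains C where "0 \<le> C" "\<And>x. (1 + norm x) ^ N * norm (f x) \<le> C"
proof -
  obtain C where C: "\<And>x. (1 + norm x) ^ N * norm (f x) \<le> C"
    using schwartz_bounded[OF assms, of "[]" N] by auto
  have "0 \<le> (1 + norm (0::'a)) ^ N * norm (f 0)" by simp
  then have "0 \<le> C" using C[of 0] by linarith
  then show ?thesis using C that by blast
qed

lemma schwartz_continuous: "f \<in> schwartz \<Longrightarrow> continuous_on A f"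
  by (intro continuous_at_imp_continuous_on ballI has_derivative_continuous[OF schwartz_has_derivative])

lemma schwartz_measurable [measurable_dest]: "f \<in> schwartz \<Longrightarrow> f \<in> borel_measurable borel"
  by (rule borel_measurable_continuous_onI) (rule schwartz_continuous)

lemma schwartz_lincomb:
  "f \<in> schwartz \<Longrightarrow> g \<in> schwartz \<Longrightarrow> (\<lambda>x. a * f x + b * g x) \<in> schwartz"
  unfolding schwartz_iff_sbounded by (intro single.sbounded_add single.sbounded_cmult)

lemma schwartz_cmult: "f \<in> schwartz \<Longrightarrow> (\<lambda>x. a * f x) \<in> schwartz"
  unfolding schwartz_iff_sbounded by (intro single.sbounded_cmult)

lemma schwartz_0: "(\<lambda>x. 0) \<in> schwartz"
  unfolding schwartz_iff_sbounded by (rule single.sbounded_0)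

lemma schwartz_cnj: "f \<in> schwartz \<Longrightarrow> (\<lambda>x. cnj (f x)) \<in> schwartz"
  unfolding schwartz_iff_sbounded by (intro single.sbounded_cnj)

lemma schwartz_affine:
  assumes "f \<in> schwartz" "bounded_linear L" "\<And>x. norm x \<le> \<kappa> * norm (L x)"
  shows "(\<lambda>x. f (L x + a)) \<in> schwartz"
  using assms unfolding schwartz_iff_sbounded
  by (intro single.sbounded_compose_affine[where a = "\<lambda>_. a" and \<kappa> = \<kappa>] single.moderate_const) auto

text \<open>The directional derivatives of the phase are affine functions of \<open>x\<close>, so
  that quadratic phases are covered.\<close>

lemma schwartz_cis:
  fixes f :: "'a::euclidean_space \<Rightarrow> complex"
  assumes "f \<in> schwartz" and Q: "\<And>x. (Q has_derivative (\<lambda>h. l h x + c h)) (at x)"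
    and l: "\<And>b. b \<in> Basis \<Longrightarrow> bounded_linear (l b)"
  shows "(\<lambda>x. cis (Q x) * f x) \<in> schwartz"
  using assms unfolding schwartz_iff_sbounded
  by (intro single.sbounded_cis[where Q' = "\<lambda>i x h. l h x + c h"])
     (auto simp: distrib_right intro!: single.sbounded_add single.sbounded_linear_mult single.sbounded_cmult)

text \<open>A basis vector of the product differentiates one factor only, so pure tensors are closed
  under these derivatives. The weight splits because \<open>1 + norm\<close> of a pair is at most
  the product of the weights of its entries.\<close>

lemma schwartz_tensor:
  fixes f :: "'a::euclidean_space \<Rightarrow> complex" and g :: "'b::euclidean_space \<Rightarrow> complex"
  assumes "f \<in> schwartz" "g \<in> schwartz"
  shows "(\<lambda>(x, y). f x * g y) \<in> schwartz"
proof -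
  let ?X = "\<lambda>H :: unit \<Rightarrow> 'a \<times> 'b \<Rightarrow> complex. \<exists>f g. f \<in> schwartz \<and> g \<in> schwartz \<and> H = (\<lambda>_ (x, y). f x * g y)"
  show ?thesis unfolding schwartz_iff_sbounded
  proof (rule single.sbounded_coinduct[of ?X])
    show "?X (\<lambda>_ (x, y). f x * g y)" using assms by auto
  next
    fix H :: "unit \<Rightarrow> 'a \<times> 'b \<Rightarrow> complex" assume "?X H"
    then obtain f g where f: "f \<in> schwartz" "g \<in> schwartz" and H: "H = (\<lambda>_ (x, y). f x * g y)" by auto
    let ?D = "\<lambda>z h. f (fst z) * dir_deriv (snd h) g (snd z) + dir_deriv (fst h) f (fst z) * g (snd z)"
    have "(H i has_derivative ?D z) (at z)" for i z
    proof -
      have "((\<lambda>z. f (fst z) * g (snd z)) has_derivative ?D z) (at z)"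
        by (intro has_derivative_mult has_derivative_compose[OF has_derivative_fst[OF has_derivative_ident] schwartz_has_derivative[OF f(1)]]
            has_derivative_compose[OF has_derivative_snd[OF has_derivative_ident] schwartz_has_derivative[OF f(2)]])
      then show ?thesis unfolding H by (simp add: case_prod_unfold)
    qed
    moreover have "\<exists>H'. ?X H' \<and> (\<forall>i z. H' i z = ?D z v)" if "v \<in> Basis" for v
    proof -
      have dir_deriv0: "dir_deriv 0 k x = 0" if "k \<in> schwartz" for k :: "'c::euclidean_space \<Rightarrow> complex" and x
        using has_derivative_bounded_linear[OF schwartz_has_derivative[OF that]] by (rule linear_simps)
      from that consider b where "v = (b, 0)" "b \<in> Basis" | b where "v = (0, b)" "b \<in> Basis"
        by (auto simp: Basis_prod_def)
      then show ?thesis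
      proof cases
        case 1
        then show ?thesis using f dir_deriv0 by (intro exI[of _ "\<lambda>_ (x, y). dir_deriv b f x * g y"]) (auto intro: schwartz_dir_deriv)
      next
        case 2
        then show ?thesis using f dir_deriv0 by (intro exI[of _ "\<lambda>_ (x, y). f x * dir_deriv b g y"]) (auto intro: schwartz_dir_deriv)
      qed
    qed
    ultimately show "\<exists>D. (\<forall>i\<in>UNIV. \<forall>x. (H i has_derivative D i x) (at x)) \<and>
       (\<forall>v\<in>Basis. \<exists>F'. ?X F' \<and> (\<forall>i\<in>UNIV. \<forall>x. F' i x = D i x v))"
      by (intro exI[of _ "\<lambda>_. ?D"]) auto
    show "single.fam_bounded (\<lambda>i x. (1 + norm x) ^ N * norm (H i x))" for N
    proof -
      obtain C1 where C1: "0 \<le> C1" "\<And>x. (1 + norm x) ^ N * norm (f x) \<le> C1" using schwartz_decay[OF f(1)] by blast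
      obtain C2 where C2: "0 \<le> C2" "\<And>x. (1 + norm x) ^ N * norm (g x) \<le> C2" using schwartz_decay[OF f(2)] by blast
      have "(1 + norm z) ^ N * norm (H () z) \<le> C1 * C2" for z
      proof -
        have "norm z \<le> norm (fst z) + norm (snd z)" using norm_Pair_le[of "fst z" "snd z"] by simp
        then have "1 + norm z \<le> (1 + norm (fst z)) * (1 + norm (snd z))"
            using norm_1_triangle[of "norm (fst z)" "norm (snd z)"] by simp
        then have "(1 + norm z) ^ N \<le> ((1 + norm (fst z)) * (1 + norm (snd z))) ^ N" by (intro power_mono) auto
        then have "(1 + norm z) ^ N * norm (H () z) \<le> ((1 + norm (fst z)) * (1 + norm (snd z))) ^ N * norm (H () z)"
          by (intro mult_right_mono) auto
        also have "\<dots> = ((1 + norm (fst z)) ^ N * norm (f (fst z))) * ((1 + norm (snd z)) ^ N * norm (g (snd z)))"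
          by (simp add: H case_prod_unfold norm_mult power_mult_distrib)
        also have "\<dots> \<le> C1 * C2" by (intro mult_mono C1 C2) auto
        finally show ?thesis .
      qed
      then show ?thesis unfolding single_fam_bounded by auto
    qed
  qed
qed

section \<open>Integrability from polynomial decay\<close>

lemma integrable_prod_Basis:
  fixes f :: "'a::euclidean_space \<Rightarrow> real \<Rightarrow> 'c::{real_normed_field,banach,second_countable_topology}"
  assumes "\<And>b. b \<in> Basis \<Longrightarrow> integrable lborel (f b)"
  shows "integrable lborel (\<lambda>x. \<Prod>b\<in>Basis. f b (x \<bullet> b))"
    and "(\<integral>x. (\<Prod>b\<in>Basis. f b (x \<bullet> b)) \<partial>lborel) = (\<Prod>b\<in>Basis. \<integral>t. f b t \<partial>lborel)"
proof -
  interpret product_sigma_finite "\<lambda>_::'a. lborel :: real measure"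
    by (rule product_sigma_finite.intro) (rule sigma_finite_lborel)
  let ?g = "\<lambda>x. \<Sum>b\<in>Basis. x b *\<^sub>R (b::'a)"
  have [measurable]: "\<And>b. b \<in> Basis \<Longrightarrow> f b \<in> borel_measurable borel" using assms by auto
  have m: "(\<lambda>x::'a. \<Prod>b\<in>Basis. f b (x \<bullet> b)) \<in> borel_measurable borel" by measurable
  have g: "?g \<in> (\<Pi>\<^sub>M b\<in>Basis. lborel) \<rightarrow>\<^sub>M borel" by measurable
  have eq: "(\<Prod>b\<in>Basis. f b (?g x \<bullet> b)) = (\<Prod>b\<in>Basis. f b (x b))" for x
    by (intro prod.cong refl) simp
  have "integrable (\<Pi>\<^sub>M b\<in>Basis. lborel) (\<lambda>x. \<Prod>b\<in>Basis. f b (x b))"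
    using assms by (intro product_integrable_prod) auto
  then show "integrable lborel (\<lambda>x. \<Prod>b\<in>Basis. f b (x \<bullet> b))"
    by (subst lborel_eq) (simp add: integrable_distr_eq[OF g m] eq del: inner_sum_left)
  have "(\<integral>x. (\<Prod>b\<in>Basis. f b (x \<bullet> b)) \<partial>lborel) = (\<integral>x. (\<Prod>b\<in>Basis. f b (x b)) \<partial>(\<Pi>\<^sub>M b\<in>Basis. lborel))"
    by (subst lborel_eq) (simp add: integral_distr[OF g m] eq del: inner_sum_left)
  also have "\<dots> = (\<Prod>b\<in>Basis. \<integral>t. f b t \<partial>lborel)"
    using assms by (intro product_integral_prod) auto
  finally show "(\<integral>x. (\<Prod>b\<in>Basis. f b (x \<bullet> b)) \<partial>lborel) = (\<Prod>b\<in>Basis. \<integral>t. f b t \<partial>lborel)" .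
qed

text \<open>The exponent comes from the integrable product of \<open>1 / (1 + t\<^sup>2)\<close>
  over the coordinates: each factor \<open>1 + (x \<bullet> b)\<^sup>2\<close> is at most
  \<open>(1 + norm x)\<^sup>2\<close>.\<close>

lemma integrable_weight:
  assumes "2 * DIM('a) \<le> k"
  shows "integrable lborel (\<lambda>x::'a::euclidean_space. 1 / (1 + norm x) ^ k)"
proof -
  have 1: "integrable lborel (\<lambda>t::real. inverse (1 + t\<^sup>2))"
    using integrable_inverse_1_plus_square by (simp add: set_integrable_def)
  have "integrable lborel (\<lambda>x::'a. \<Prod>b\<in>Basis. inverse (1 + (x \<bullet> b)\<^sup>2))"
    by (rule integrable_prod_Basis(1)) (rule 1)
  then show ?thesis
  proof (rule Bochner_Integration.integrable_bound)
    show "AE x in lborel. norm (1 / (1 + norm x) ^ k) \<le> norm (\<Prod>b\<in>Basis. inverse (1 + ((x::'a) \<bullet> b)\<^sup>2))"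
    proof (rule AE_I2)
      fix x :: 'a
      have "(\<Prod>b\<in>Basis. 1 + (x \<bullet> b)\<^sup>2) \<le> (\<Prod>b\<in>(Basis::'a set). (1 + norm x)\<^sup>2)"
      proof (intro prod_mono conjI)
        fix b :: 'a assume "b \<in> Basis"
        then have "\<bar>x \<bullet> b\<bar> \<le> norm x" by (rule Basis_le_norm)
        then have "(x \<bullet> b)\<^sup>2 \<le> (norm x)\<^sup>2" by (metis abs_norm_cancel power2_abs power2_le_iff_abs_le norm_ge_zero)
        then show "1 + (x \<bullet> b)\<^sup>2 \<le> (1 + norm x)\<^sup>2" by (simp add: power2_eq_square algebra_simps) (use norm_ge_zero[of x] in linarith)
      qed simp
      also have "\<dots> = (1 + norm x) ^ (2 * DIM('a))" by (simp add: power_mult)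
      also have "\<dots> \<le> (1 + norm x) ^ k" by (rule weight_mono) (rule assms)
      finally have *: "(\<Prod>b\<in>Basis. 1 + (x \<bullet> b)\<^sup>2) \<le> (1 + norm x) ^ k" .
      have pos: "0 < (\<Prod>b\<in>Basis. 1 + (x \<bullet> b)\<^sup>2)" by (intro prod_pos) (simp add: add_pos_nonneg)
      have "1 / (1 + norm x) ^ k \<le> 1 / (\<Prod>b\<in>Basis. 1 + (x \<bullet> b)\<^sup>2)" using * pos by (intro divide_left_mono) auto
      also have "\<dots> = (\<Prod>b\<in>Basis. inverse (1 + (x \<bullet> b)\<^sup>2))" by (simp add: prod_inversef[symmetric] o_def divide_inverse)
      finally show "norm (1 / (1 + norm x) ^ k) \<le> norm (\<Prod>b\<in>Basis. inverse (1 + (x \<bullet> b)\<^sup>2))"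
        using pos by (simp add: abs_of_nonneg prod_nonneg)
    qed
  qed measurable
qed

lemma integrable_decay:
  fixes f :: "'a::euclidean_space \<Rightarrow> 'c::{banach,second_countable_topology}"
  assumes "f \<in> borel_measurable lborel" "\<And>x. (1 + norm x) ^ (2 * DIM('a)) * norm (f x) \<le> C"
  shows "integrable lborel f"
proof (rule Bochner_Integration.integrable_bound)
  show "integrable lborel (\<lambda>x::'a. C * (1 / (1 + norm x) ^ (2 * DIM('a))))"
    by (intro integrable_mult_right integrable_weight) auto
  show "AE x in lborel. norm (f x) \<le> norm (C * (1 / (1 + norm x) ^ (2 * DIM('a))))"
  proof (rule AE_I2)
    fix x :: 'a
    have p: "0 < (1 + norm x) ^ (2 * DIM('a))" by (simp add: add_pos_nonneg)
    have "0 \<le> C" using assms(2)[of x] p by (smt (verit) norm_ge_zero mult_nonneg_nonneg)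
    then show "norm (f x) \<le> norm (C * (1 / (1 + norm x) ^ (2 * DIM('a))))"
      using assms(2)[of x] p by (simp add: field_simps)
  qed
qed (rule assms(1))

lemma schwartz_integrable:
  fixes f :: "'a::euclidean_space \<Rightarrow> complex"
  assumes "f \<in> schwartz" shows "integrable lborel f"
proof -
  obtain C where "\<And>x. (1 + norm x) ^ (2 * DIM('a)) * norm (f x) \<le> C" using schwartz_decay[OF assms] by blast
  then show ?thesis using schwartz_measurable[OF assms] by (intro integrable_decay) auto
qed

section \<open>Partial Fourier transforms and integrals over a parameter\<close>

text \<open>The derivative bound on the unit ball makes each \<open>f t\<close> Lipschitz there with
  constant \<open>g t\<close>, so the remainders divided by the increment are dominated by
  \<open>2 * g\<close>. Dominated convergence applies along every sequence of increments tending to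
  zero.\<close>

lemma has_derivative_integral:
  fixes f :: "'t \<Rightarrow> 'a::euclidean_space \<Rightarrow> 'c::{banach,second_countable_topology}"
  assumes der: "\<And>t x. x \<in> ball x0 1 \<Longrightarrow> (f t has_derivative f' t x) (at x)"
    and bound: "\<And>t x h. x \<in> ball x0 1 \<Longrightarrow> norm (f' t x h) \<le> g t * norm h"
    and g: "integrable M g" and int: "\<And>x. integrable M (\<lambda>t. f t x)"
    and meas: "\<And>h. (\<lambda>t. f' t x0 h) \<in> borel_measurable M"
  shows "((\<lambda>x. \<integral>t. f t x \<partial>M) has_derivative (\<lambda>h. \<integral>t. f' t x0 h \<partial>M)) (at x0)"
proof -
  have x0: "x0 \<in> ball x0 1" by simp
  have g0: "0 \<le> g t" for t
    using bound[OF x0, of t "SOME b. b \<in> Basis"] norm_some_Basis[where 'a = 'a]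
    by (metis mult.right_neutral norm_ge_zero order_trans)
  have int': "integrable M (\<lambda>t. f' t x0 h)" for h
    by (rule Bochner_Integration.integrable_bound[OF integrable_mult_left[OF g, of "norm h"]])
       (use bound[OF x0] g0 in \<open>auto intro!: meas AE_I2 simp: abs_of_nonneg mult_nonneg_nonneg\<close>)
  interpret f': bounded_linear "f' t x0" for t
    using der[OF x0] by (rule has_derivative_bounded_linear)
  have bl: "bounded_linear (\<lambda>h. \<integral>t. f' t x0 h \<partial>M)"
  proof (rule bounded_linear_intro)
    show "(\<integral>t. f' t x0 (h + k) \<partial>M) = (\<integral>t. f' t x0 h \<partial>M) + (\<integral>t. f' t x0 k \<partial>M)" for h k
      by (simp add: f'.add int')
    show "(\<integral>t. f' t x0 (r *\<^sub>R h) \<partial>M) = r *\<^sub>R (\<integral>t. f' t x0 h \<partial>M)" for r h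
      by (simp add: f'.scaleR)
    show "norm (\<integral>t. f' t x0 h \<partial>M) \<le> norm h * (\<integral>t. g t \<partial>M)" for h
    proof -
      have "norm (\<integral>t. f' t x0 h \<partial>M) \<le> (\<integral>t. norm (f' t x0 h) \<partial>M)" by (rule integral_norm_bound)
      also have "\<dots> \<le> (\<integral>t. g t * norm h \<partial>M)"
        by (rule integral_mono) (use int' g bound[OF x0] in auto)
      finally show ?thesis by (simp add: mult.commute)
    qed
  qed
  let ?R = "\<lambda>h t. (1 / norm h) *\<^sub>R (f t (x0 + h) - f t x0 - f' t x0 h)"
  have "((\<lambda>h. norm (\<integral>t. ?R h t \<partial>M)) \<longlongrightarrow> 0) (at 0)"
  proof (rule tendsto_norm_zero, subst tendsto_at_iff_sequentially, intro allI impI)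
    fix X :: "nat \<Rightarrow> 'a" assume X0: "\<forall>i. X i \<in> UNIV - {0}" and X: "X \<longlonglongrightarrow> 0"
    have "\<forall>\<^sub>F n in sequentially. dist (X n) 0 < 1" using X by (rule tendstoD) simp
    then obtain N where N: "\<And>n. n \<ge> N \<Longrightarrow> norm (X n) < 1" by (auto simp: eventually_sequentially)
    \<comment> \<open>The first \<open>N\<close> terms are skipped because the bound is available
      only for increments of norm below 1.\<close>
    have "(\<lambda>n. \<integral>t. ?R (X (n + N)) t \<partial>M) \<longlonglongrightarrow> (\<integral>t. 0 \<partial>M)"
    proof (rule integral_dominated_convergence[where w = "\<lambda>t. 2 * g t"])
      show "(\<lambda>t. ?R (X (n + N)) t) \<in> borel_measurable M" for n
        using int[THEN borel_measurable_integrable] int'[THEN borel_measurable_integrable] by measurable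
      show "integrable M (\<lambda>t. 2 * g t)" using g by simp
      show "AE t in M. (\<lambda>n. ?R (X (n + N)) t) \<longlonglongrightarrow> 0"
      proof (rule AE_I2)
        fix t
        have "((\<lambda>h. norm (f t (x0 + h) - f t x0 - f' t x0 h) / norm h) \<longlongrightarrow> 0) (at 0)"
          using der[OF x0, of t] by (simp add: has_derivative_at)
        then have "((\<lambda>h. norm (?R h t)) \<longlongrightarrow> 0) (at 0)" by simp
        then have "((\<lambda>h. ?R h t) \<longlongrightarrow> 0) (at 0)" by (rule tendsto_norm_zero_cancel)
        then have "((\<lambda>h. ?R h t) \<circ> X) \<longlonglongrightarrow> 0"
          using X0 X unfolding tendsto_at_iff_sequentially by blast
        then show "(\<lambda>n. ?R (X (n + N)) t) \<longlonglongrightarrow> 0"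
          using LIMSEQ_ignore_initial_segment[of "(\<lambda>h. ?R h t) \<circ> X" 0 N] by (simp add: o_def)
      qed
      show "AE t in M. norm (?R (X (n + N)) t) \<le> 2 * g t" for n
      proof (rule AE_I2)
        fix t
        let ?h = "X (n + N)"
        have h1: "norm ?h < 1" "?h \<noteq> 0" using N[of "n + N"] X0 by auto
        have "norm (f t (x0 + ?h) - f t x0) \<le> g t * norm (x0 + ?h - x0)"
        proof (rule differentiable_bound[where S = "ball x0 1"])
          show "(f t has_derivative f' t x) (at x within ball x0 1)" if "x \<in> ball x0 1" for x
            using der[OF that] by (rule has_derivative_at_withinI)
          show "onorm (f' t x) \<le> g t" if "x \<in> ball x0 1" for x
            by (rule onorm_bound[OF g0]) (rule bound[OF that])
        qed (use h1 in \<open>auto simp: dist_norm\<close>)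
        then have "norm (f t (x0 + ?h) - f t x0 - f' t x0 ?h) \<le> g t * norm ?h + g t * norm ?h"
          using bound[OF x0, of t ?h] norm_triangle_ineq4[of "f t (x0 + ?h) - f t x0" "f' t x0 ?h"] by simp
        then have "norm (f t (x0 + ?h) - f t x0 - f' t x0 ?h) / norm ?h \<le> 2 * g t"
          using h1 by (simp add: pos_divide_le_eq)
        moreover have "norm (?R ?h t) = norm (f t (x0 + ?h) - f t x0 - f' t x0 ?h) / norm ?h"
          unfolding norm_scaleR by simp
        ultimately show "norm (?R ?h t) \<le> 2 * g t" by simp
      qed
    qed simp
    then have "(\<lambda>n. (\<lambda>n. \<integral>t. ?R (X n) t \<partial>M) (n + N)) \<longlonglongrightarrow> 0" by simp
    then show "((\<lambda>h. \<integral>t. ?R h t \<partial>M) \<circ> X) \<longlonglongrightarrow> 0" unfolding o_def by (rule LIMSEQ_offset)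
  qed
  moreover have "norm (\<integral>t. ?R h t \<partial>M) =
      norm ((\<integral>t. f t (x0 + h) \<partial>M) - (\<integral>t. f t x0 \<partial>M) - (\<integral>t. f' t x0 h \<partial>M)) / norm h" for h
  proof -
    have "(\<integral>t. ?R h t \<partial>M) = (1 / norm h) *\<^sub>R (\<integral>t. (f t (x0 + h) - f t x0 - f' t x0 h) \<partial>M)"
      by (rule integral_scaleR_right)
    also have "(\<integral>t. (f t (x0 + h) - f t x0 - f' t x0 h) \<partial>M) =
       (\<integral>t. f t (x0 + h) \<partial>M) - (\<integral>t. f t x0 \<partial>M) - (\<integral>t. f' t x0 h \<partial>M)"
      by (simp add: int int')
    finally have eq: "(\<integral>t. ?R h t \<partial>M) = (1 / norm h) *\<^sub>R ((\<integral>t. f t (x0 + h) \<partial>M) - (\<integral>t. f t x0 \<partial>M) - (\<integral>t. f' t x0 h \<partial>M))" .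
    show ?thesis unfolding eq norm_scaleR by simp
  qed
  ultimately have "((\<lambda>h. norm ((\<integral>t. f t (x0 + h) \<partial>M) - (\<integral>t. f t x0 \<partial>M) - (\<integral>t. f' t x0 h \<partial>M)) / norm h) \<longlongrightarrow> 0) (at 0)"
    by (simp only:)
  with bl show ?thesis unfolding has_derivative_at by (rule conjI)
qed

lemma integral_translate:
  fixes f :: "'a::euclidean_space \<Rightarrow> 'c::{banach,second_countable_topology}"
  assumes [measurable]: "f \<in> borel_measurable borel"
  shows "(\<integral>x. f (x + a) \<partial>lborel) = (\<integral>x. f x \<partial>lborel)"
proof -
  have "(\<integral>x. f x \<partial>lborel) = (\<integral>x. f x \<partial>(distr lborel borel ((+) a)))" by (simp add: lborel_distr_plus)
  also have "\<dots> = (\<integral>x. f (a + x) \<partial>lborel)" by (subst integral_distr) auto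
  finally show ?thesis by (simp add: add.commute)
qed

lemma nn_integral_translate:
  fixes f :: "'a::euclidean_space \<Rightarrow> ennreal"
  assumes [measurable]: "f \<in> borel_measurable borel"
  shows "(\<integral>\<^sup>+x. f (x + a) \<partial>lborel) = (\<integral>\<^sup>+x. f x \<partial>lborel)"
proof -
  have "(\<integral>\<^sup>+x. f x \<partial>lborel) = (\<integral>\<^sup>+x. f x \<partial>(distr lborel borel ((+) a)))" by (simp add: lborel_distr_plus)
  also have "\<dots> = (\<integral>\<^sup>+x. f (a + x) \<partial>lborel)" by (subst nn_integral_distr) auto
  finally show ?thesis by (simp add: add.commute)
qed

lemma schwartz_dir_deriv_linear: "f \<in> schwartz \<Longrightarrow> bounded_linear (\<lambda>h. dir_deriv h f x)"
  using schwartz_has_derivative by (rule has_derivative_bounded_linear)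

lemma schwartz_dir_deriv_0: "f \<in> schwartz \<Longrightarrow> dir_deriv 0 f x = 0"
  using schwartz_dir_deriv_linear by (rule linear_simps)

lemma schwartz_dir_deriv_decay:
  fixes f :: "'a::euclidean_space \<Rightarrow> complex"
  assumes f: "f \<in> schwartz"
  obtains C where "0 \<le> C" "\<And>x v. (1 + norm x) ^ N * norm (dir_deriv v f x) \<le> C * norm v"
proof -
  have "\<exists>C. \<forall>x. (1 + norm x) ^ N * norm (dir_deriv b f x) \<le> C" for b
    using schwartz_decay[OF schwartz_dir_deriv[OF f, of b], of N] by metis
  then obtain C where C: "\<And>b x. (1 + norm x) ^ N * norm (dir_deriv b f x) \<le> C b" by metis
  have C0: "0 \<le> C b" for b using C[of 0 b] by (smt (verit) norm_ge_zero mult_nonneg_nonneg zero_le_power)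
  have "(1 + norm x) ^ N * norm (dir_deriv v f x) \<le> (\<Sum>b\<in>Basis. C b) * norm v" for x v
  proof -
    interpret bounded_linear "\<lambda>h. dir_deriv h f x" by (rule schwartz_dir_deriv_linear[OF f])
    have "dir_deriv v f x = dir_deriv (\<Sum>b\<in>Basis. (v \<bullet> b) *\<^sub>R b) f x" by (simp add: euclidean_representation)
    also have "\<dots> = (\<Sum>b\<in>Basis. (v \<bullet> b) *\<^sub>R dir_deriv b f x)" by (simp add: sum scaleR)
    also have "norm \<dots> \<le> (\<Sum>b\<in>Basis. norm v * norm (dir_deriv b f x))"
      by (intro sum_norm_le) (auto intro!: mult_right_mono simp: Basis_le_norm)
    finally have "(1 + norm x) ^ N * norm (dir_deriv v f x) \<le> (1 + norm x) ^ N * (\<Sum>b\<in>Basis. norm v * norm (dir_deriv b f x))"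
      by (intro mult_left_mono) auto
    also have "\<dots> = (\<Sum>b\<in>Basis. norm v * ((1 + norm x) ^ N * norm (dir_deriv b f x)))"
      by (simp add: sum_distrib_left mult_ac)
    also have "\<dots> \<le> (\<Sum>b\<in>Basis. norm v * C b)" by (intro sum_mono mult_left_mono C) auto
    finally show ?thesis by (simp add: sum_distrib_left mult_ac)
  qed
  then show ?thesis using that[of "\<Sum>b\<in>Basis. C b"] C0 by (simp add: sum_nonneg)
qed

lemma schwartz_linear_mult: "f \<in> schwartz \<Longrightarrow> bounded_linear l \<Longrightarrow> (\<lambda>x. of_real (l x) * f x) \<in> schwartz"
  unfolding schwartz_iff_sbounded by (rule single.sbounded_linear_mult)

lemma schwartz_modulate:
  assumes "f \<in> schwartz" shows "(\<lambda>x. cis (c * (\<xi> \<bullet> x)) * f x) \<in> schwartz"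
  using assms
  by (rule schwartz_cis[where l = "\<lambda>_ _. 0" and c = "\<lambda>h. c * (\<xi> \<bullet> h)"])
     (auto intro!: derivative_eq_intros bounded_linear_zero)

lemma schwartz_slice: "F \<in> schwartz \<Longrightarrow> (\<lambda>t. F (x, t)) \<in> schwartz"
  using schwartz_affine[where L = "\<lambda>t. (0, t)" and \<kappa> = 1 and a = "(x, 0)" and f = F]
  by (simp add: bounded_linear_Pair norm_Pair bounded_linear_zero bounded_linear_ident)

lemma schwartz_slice': "F \<in> schwartz \<Longrightarrow> (\<lambda>x. F (x, t)) \<in> schwartz"
  using schwartz_affine[where L = "\<lambda>x. (x, 0)" and \<kappa> = 1 and a = "(0, t)" and f = F]
  by (simp add: bounded_linear_Pair norm_Pair bounded_linear_zero bounded_linear_ident)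

lemma dir_deriv_slice: "F \<in> schwartz \<Longrightarrow> dir_deriv v (\<lambda>t. F (x, t)) t = dir_deriv (0, v) F (x, t)"
proof -
  assume F: "F \<in> schwartz"
  have "((\<lambda>t. (x, t)) has_derivative (\<lambda>h. (0, h))) (at t)" by (auto intro!: derivative_eq_intros)
  from has_derivative_compose[OF this schwartz_has_derivative[OF F]] show ?thesis by (rule dir_deriv_eq)
qed

text \<open>By translation invariance the integral of \<open>f (t + h)\<close> over \<open>t\<close>
  is constant in \<open>h\<close>, and its derivative at 0 may be taken under the integral. This
  serves as integration by parts.\<close>

lemma integral_dir_deriv_zero:
  fixes f :: "'a::euclidean_space \<Rightarrow> complex"
  assumes f: "f \<in> schwartz" shows "(\<integral>x. dir_deriv v f x \<partial>lborel) = 0"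
proof -
  obtain C where C: "0 \<le> C" "\<And>x v. (1 + norm x) ^ (2 * DIM('a)) * norm (dir_deriv v f x) \<le> C * norm v"
    using schwartz_dir_deriv_decay[OF f] by blast
  have "((\<lambda>h. \<integral>t. f (t + h) \<partial>lborel) has_derivative (\<lambda>h. \<integral>t. dir_deriv h f (t + 0) \<partial>lborel)) (at 0)"
  \<comment> \<open>For \<open>x\<close> in the unit ball \<open>1 + norm t\<close> is at most twice
    \<open>1 + norm (t + x)\<close>, whence the power of 2.\<close>
  proof (rule has_derivative_integral[where g = "\<lambda>t. (C * 2 ^ (2 * DIM('a))) * (1 / (1 + norm t) ^ (2 * DIM('a)))"])
    fix t x :: 'a and h :: 'a assume x: "x \<in> ball 0 1"
    have "((\<lambda>x. t + x) has_derivative (\<lambda>h. h)) (at x)" by (auto intro!: derivative_eq_intros)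
    from has_derivative_compose[OF this schwartz_has_derivative[OF f]]
    show "((\<lambda>x. f (t + x)) has_derivative (\<lambda>h. dir_deriv h f (t + x))) (at x)" .
    have "1 + norm t \<le> (1 + norm (t + x)) * (1 + norm x)" using norm_1_triangle[of "t + x" "- x"] by simp
    also have "\<dots> \<le> (1 + norm (t + x)) * 2" using x by (intro mult_left_mono) auto
    finally have "(1 + norm t) ^ (2 * DIM('a)) \<le> ((1 + norm (t + x)) * 2) ^ (2 * DIM('a))" by (intro power_mono) auto
    then have "(1 + norm t) ^ (2 * DIM('a)) * norm (dir_deriv h f (t + x)) \<le> ((1 + norm (t + x)) * 2) ^ (2 * DIM('a)) * norm (dir_deriv h f (t + x))"
      by (intro mult_right_mono) auto
    also have "\<dots> = 2 ^ (2 * DIM('a)) * ((1 + norm (t + x)) ^ (2 * DIM('a)) * norm (dir_deriv h f (t + x)))"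
      unfolding power_mult_distrib by (simp only: mult_ac)
    also have "\<dots> \<le> 2 ^ (2 * DIM('a)) * (C * norm h)" by (intro mult_left_mono C) auto
    finally have *: "norm (dir_deriv h f (t + x)) * (1 + norm t) ^ (2 * DIM('a)) \<le> C * 2 ^ (2 * DIM('a)) * norm h" by (simp add: mult_ac)
    have "0 < (1 + norm t) ^ (2 * DIM('a))" by (simp add: add_pos_nonneg)
    with * show "norm (dir_deriv h f (t + x)) \<le> C * 2 ^ (2 * DIM('a)) * (1 / (1 + norm t) ^ (2 * DIM('a))) * norm h"
      by (simp add: pos_le_divide_eq)
  next
    show "integrable lborel (\<lambda>t. C * 2 ^ (2 * DIM('a)) * (1 / (1 + norm (t::'a)) ^ (2 * DIM('a))))"
      by (intro integrable_mult_right integrable_weight) simp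
    show "integrable lborel (\<lambda>t. f (t + x))" for x
      by (intro schwartz_integrable schwartz_affine[where \<kappa> = 1] f) (auto intro: bounded_linear_ident)
    show "(\<lambda>t. dir_deriv h f (t + 0)) \<in> borel_measurable lborel" for h
      using schwartz_measurable[OF schwartz_dir_deriv[OF f, of h]] by simp
  qed
  moreover have "((\<lambda>h. \<integral>t. f (t + h) \<partial>lborel) has_derivative (\<lambda>h. 0)) (at 0)"
    by (simp add: integral_translate schwartz_measurable[OF f])
  ultimately have "(\<lambda>h. \<integral>t. dir_deriv h f (t + 0) \<partial>lborel) = (\<lambda>h. 0)" by (rule has_derivative_unique)
  from fun_cong[OF this, of v] show ?thesis by simp
qed

text \<open>The Fourier transform in the second variable, with a coefficient \<open>b\<close>. For
  \<open>b = 1\<close> it yields the short-time Fourier transform, the Wigner transform and the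
  passage between kernels and Kohn--Nirenberg symbols, so one mapping theorem serves them
  all.\<close>

definition partial_fourier ::
  "('b::euclidean_space \<Rightarrow> complex) \<Rightarrow> ('a::euclidean_space \<times> 'b \<Rightarrow> complex) \<Rightarrow> 'a \<times> 'b \<Rightarrow> complex" where
  "partial_fourier b F = (\<lambda>(x, \<xi>). \<integral>t. b t * (F (x, t) * cis (- 2 * pi * (\<xi> \<bullet> t))) \<partial>lborel)"

lemma mult_integrable_decay:
  fixes b :: "'b::euclidean_space \<Rightarrow> complex" and f :: "'b \<Rightarrow> complex"
  assumes b: "b \<in> borel_measurable borel" "\<And>t. norm (b t) \<le> K * (1 + norm t) ^ m"
    and f: "f \<in> borel_measurable borel" "\<And>t. (1 + norm t) ^ (m + 2 * DIM('b)) * norm (f t) \<le> C"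
  shows "integrable lborel (\<lambda>t. b t * f t)"
    "\<And>t. norm (b t * f t) \<le> K * C * (1 / (1 + norm t) ^ (2 * DIM('b)))"
proof -
  have K: "0 \<le> K" using order_trans[OF norm_ge_zero b(2)[of 0]] by simp
  have *: "(1 + norm t) ^ (2 * DIM('b)) * norm (b t * f t) \<le> K * C" for t
  proof -
    have "(1 + norm t) ^ (2 * DIM('b)) * norm (b t * f t)
       \<le> (1 + norm t) ^ (2 * DIM('b)) * ((K * (1 + norm t) ^ m) * norm (f t))"
      unfolding norm_mult by (intro mult_left_mono mult_right_mono b) auto
    also have "\<dots> = K * ((1 + norm t) ^ (m + 2 * DIM('b)) * norm (f t))" by (simp add: power_add)
    also have "\<dots> \<le> K * C" by (intro mult_left_mono f K)
    finally show ?thesis .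
  qed
  show "integrable lborel (\<lambda>t. b t * f t)" by (rule integrable_decay[OF _ *]) (use b f in simp)
  show "norm (b t * f t) \<le> K * C * (1 / (1 + norm t) ^ (2 * DIM('b)))" for t
    using *[of t] by (simp add: field_simps add_pos_nonneg)
qed

lemma norm_integral_le:
  fixes f :: "'t \<Rightarrow> 'c::{banach,second_countable_topology}"
  assumes "integrable M f" "integrable M g" "\<And>t. norm (f t) \<le> g t"
  shows "norm (\<integral>t. f t \<partial>M) \<le> (\<integral>t. g t \<partial>M)"
  by (rule order_trans[OF integral_norm_bound integral_mono[OF integrable_norm[OF assms(1)] assms(2,3)]])

lemma norm_snd_weight: "(1 + norm t) ^ k \<le> (1 + norm (x, t)) ^ k"
  using norm_snd_le[of t x] by (intro power_mono) auto

lemma norm_fst_weight: "(1 + norm x) ^ k \<le> (1 + norm (x, t)) ^ k"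
  using norm_fst_le[of x t] by (intro power_mono) auto

lemma partial_fourier_integrable:
  fixes F :: "'a::euclidean_space \<times> 'b::euclidean_space \<Rightarrow> complex"
  assumes F: "F \<in> schwartz"
    and b: "b \<in> borel_measurable borel" "\<And>t. norm (b t) \<le> K * (1 + norm t) ^ m"
  shows "integrable lborel (\<lambda>t. b t * (F (x, t) * cis (- 2 * pi * (\<xi> \<bullet> t))))"
proof -
  have S: "(\<lambda>t. F (x, t) * cis (- 2 * pi * (\<xi> \<bullet> t))) \<in> schwartz"
    using schwartz_modulate[OF schwartz_slice[OF F], of "- 2 * pi" \<xi> x] by (simp add: mult.commute)
  obtain C where "\<And>t. (1 + norm t) ^ (m + 2 * DIM('b)) * norm (F (x, t) * cis (- 2 * pi * (\<xi> \<bullet> t))) \<le> C"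
    using schwartz_decay[OF S] by blast
  with schwartz_measurable[OF S] show ?thesis by (intro mult_integrable_decay(1)[OF b])
qed

text \<open>The first variable is differentiated inside \<open>F\<close>, while a derivative in the
  frequency multiplies the integrand by \<open>- 2 * pi * \<i>\<close> and a component of
  \<open>t\<close>.\<close>

lemma partial_fourier_has_derivative:
  fixes F :: "'a::euclidean_space \<times> 'b::euclidean_space \<Rightarrow> complex"
  assumes F: "F \<in> schwartz"
    and b: "b \<in> borel_measurable borel" "\<And>t. norm (b t) \<le> K * (1 + norm t) ^ m"
  shows "(partial_fourier b F has_derivative
    (\<lambda>h. partial_fourier b (dir_deriv (fst h, 0) F) z + partial_fourier b (\<lambda>z. of_real (snd h \<bullet> snd z) * (- 2 * pi * \<i> * F z)) z)) (at z)"
proof -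
  let ?e = "\<lambda>z t. cis (- 2 * pi * (snd z \<bullet> t))"
  let ?f = "\<lambda>t z. b t * (F (fst z, t) * ?e z t)"
  let ?f' = "\<lambda>t z h. b t * (dir_deriv (fst h, 0) F (fst z, t) * ?e z t)
      + b t * ((of_real (snd h \<bullet> t) * (- 2 * pi * \<i> * F (fst z, t))) * ?e z t)"
  obtain C1 where C1: "0 \<le> C1" "\<And>z v. (1 + norm z) ^ (m + 2 * DIM('b)) * norm (dir_deriv v F z) \<le> C1 * norm v"
    using schwartz_dir_deriv_decay[OF F] by blast
  \<comment> \<open>One power more than for \<open>C1\<close>, to absorb the factor \<open>t\<close>
    that the frequency derivative brings down.\<close>
  obtain C2 where C2: "0 \<le> C2" "\<And>z. (1 + norm z) ^ (Suc (m + 2 * DIM('b))) * norm (F z) \<le> C2"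
    using schwartz_decay[OF F] by blast
  have S1: "(\<lambda>z. of_real (k \<bullet> snd z) * (- 2 * pi * \<i> * F z)) \<in> schwartz" for k
    by (intro schwartz_linear_mult schwartz_cmult F bounded_linear_intros)
  have S2: "dir_deriv (k, 0) F \<in> schwartz" for k by (rule schwartz_dir_deriv[OF F])
  note int1 = partial_fourier_integrable[OF S1 b, simplified] and int2 = partial_fourier_integrable[OF S2 b]
  have "((\<lambda>z. \<integral>t. ?f t z \<partial>lborel) has_derivative (\<lambda>h. \<integral>t. ?f' t z h \<partial>lborel)) (at z)"
  proof (rule has_derivative_integral[where g = "\<lambda>t. K * (C1 + 2 * pi * C2) * (1 / (1 + norm t) ^ (2 * DIM('b)))"])
    fix t :: 'b and z :: "'a \<times> 'b"
    have "((\<lambda>z. (fst z, t)) has_derivative (\<lambda>h. (fst h, 0))) (at z)" by (auto intro!: derivative_eq_intros)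
    from has_derivative_compose[OF this schwartz_has_derivative[OF F]]
    have d1: "((\<lambda>z. F (fst z, t)) has_derivative (\<lambda>h. dir_deriv (fst h, 0) F (fst z, t))) (at z)" .
    have "((\<lambda>z. - 2 * pi * (snd z \<bullet> t)) has_derivative (\<lambda>h. - 2 * pi * (snd h \<bullet> t))) (at z)"
      by (auto intro!: derivative_eq_intros)
    from has_derivative_compose[OF this has_derivative_cis]
    have d2: "((\<lambda>z. ?e z t) has_derivative (\<lambda>h. (- 2 * pi * (snd h \<bullet> t)) *\<^sub>R (\<i> * ?e z t))) (at z)" .
    show "((\<lambda>z. ?f t z) has_derivative (\<lambda>h. ?f' t z h)) (at z)"
      by (rule has_derivative_eq_rhs[OF has_derivative_mult_right[OF has_derivative_mult[OF d1 d2]]])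
         (simp add: fun_eq_iff scaleR_conv_of_real algebra_simps)
  next
    fix t :: 'b and z h :: "'a \<times> 'b"
    have K: "0 \<le> K" using order_trans[OF norm_ge_zero b(2)[of 0]] by simp
    let ?q = "dir_deriv (fst h, 0) F (fst z, t) * ?e z t + (of_real (snd h \<bullet> t) * (- 2 * pi * \<i> * F (fst z, t))) * ?e z t"
    have "norm ?q \<le> norm (dir_deriv (fst h, 0) F (fst z, t)) + \<bar>snd h \<bullet> t\<bar> * (2 * pi * norm (F (fst z, t)))"
      by (rule order_trans[OF norm_triangle_ineq]) (simp add: norm_mult)
    also have "\<dots> \<le> norm (dir_deriv (fst h, 0) F (fst z, t)) + (norm h * (1 + norm t)) * (2 * pi * norm (F (fst z, t)))"
    proof -
      have "\<bar>snd h \<bullet> t\<bar> \<le> norm (snd h) * norm t" by (rule Cauchy_Schwarz_ineq2)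
      also have "\<dots> \<le> norm h * (1 + norm t)" by (intro mult_mono) (auto simp: norm_snd_le[of "snd h" "fst h", simplified])
      finally show ?thesis by (intro add_mono mult_right_mono) auto
    qed
    finally have "(1 + norm t) ^ (m + 2 * DIM('b)) * norm ?q \<le> (1 + norm t) ^ (m + 2 * DIM('b)) * norm (dir_deriv (fst h, 0) F (fst z, t))
       + norm h * (2 * pi) * ((1 + norm t) ^ Suc (m + 2 * DIM('b)) * norm (F (fst z, t)))"
      by (rule order_trans[OF mult_left_mono]) (simp_all add: algebra_simps)
    also have "\<dots> \<le> (1 + norm (fst z, t)) ^ (m + 2 * DIM('b)) * norm (dir_deriv (fst h, 0) F (fst z, t))
       + norm h * (2 * pi) * ((1 + norm (fst z, t)) ^ Suc (m + 2 * DIM('b)) * norm (F (fst z, t)))"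
      by (intro add_mono mult_left_mono mult_right_mono norm_snd_weight) auto
    also have "\<dots> \<le> C1 * norm (fst h, 0::'b) + norm h * (2 * pi) * C2"
      by (intro add_mono mult_left_mono C1 C2) auto
    also have "\<dots> \<le> C1 * norm h + norm h * (2 * pi) * C2"
      using norm_fst_le[of "fst h" "snd h"] by (intro add_right_mono mult_left_mono C1) (simp add: norm_Pair)
    finally have *: "(1 + norm t) ^ (m + 2 * DIM('b)) * norm ?q \<le> (C1 + 2 * pi * C2) * norm h"
      by (simp add: algebra_simps)
    have "norm (?f' t z h) = norm (b t) * norm ?q" by (simp only: norm_mult[symmetric] distrib_left)
    also have "\<dots> \<le> (K * (1 + norm t) ^ m) * norm ?q" by (intro mult_right_mono b) auto
    finally have "norm (?f' t z h) * (1 + norm t) ^ (2 * DIM('b)) \<le> (K * (1 + norm t) ^ m) * norm ?q * (1 + norm t) ^ (2 * DIM('b))"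
      by (intro mult_right_mono) auto
    also have "\<dots> = K * ((1 + norm t) ^ (m + 2 * DIM('b)) * norm ?q)" by (simp add: power_add)
    also have "\<dots> \<le> K * ((C1 + 2 * pi * C2) * norm h)" by (intro mult_left_mono * K)
    finally show "norm (?f' t z h) \<le> K * (C1 + 2 * pi * C2) * (1 / (1 + norm t) ^ (2 * DIM('b))) * norm h"
      by (simp add: pos_le_divide_eq add_pos_nonneg mult_ac)
  next
    show "integrable lborel (\<lambda>t. K * (C1 + 2 * pi * C2) * (1 / (1 + norm (t::'b)) ^ (2 * DIM('b))))"
      by (intro integrable_mult_right integrable_weight) simp
    show "integrable lborel (\<lambda>t. ?f t z)" for z by (rule partial_fourier_integrable[OF F b])
    show "(\<lambda>t. ?f' t z h) \<in> borel_measurable lborel" for h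
      using int1 int2 by (intro borel_measurable_add borel_measurable_integrable) (simp_all add: mult.assoc)
  qed
  moreover have "(\<integral>t. ?f' t z h \<partial>lborel) = partial_fourier b (dir_deriv (fst h, 0) F) z + partial_fourier b (\<lambda>z. of_real (snd h \<bullet> snd z) * (- 2 * pi * \<i> * F z)) z" for h
    using partial_fourier_integrable[OF S1 b, of "snd h" "fst z" "snd z"] partial_fourier_integrable[OF S2 b, of "fst h" "fst z" "snd z"]
    unfolding partial_fourier_def case_prod_unfold by (simp add: mult.assoc)
  ultimately show ?thesis by (simp add: partial_fourier_def[abs_def] case_prod_unfold)
qed

lemma partial_fourier_0: "partial_fourier b (\<lambda>z. 0) z = 0"
  by (simp add: partial_fourier_def case_prod_unfold)

text \<open>Integration by parts in \<open>t\<close>: the integral of the derivative of the whole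
  integrand vanishes.\<close>

lemma partial_fourier_mult_freq:
  fixes F :: "'a::euclidean_space \<times> 'b::euclidean_space \<Rightarrow> complex"
  assumes F: "F \<in> schwartz"
  shows "of_real (\<xi> \<bullet> e) * partial_fourier (\<lambda>_. 1) F (x, \<xi>) = (1 / (2 * pi * \<i>)) * partial_fourier (\<lambda>_. 1) (dir_deriv (0, e) F) (x, \<xi>)"
proof -
  let ?f = "\<lambda>t. F (x, t) * cis (- 2 * pi * (\<xi> \<bullet> t))"
  have S: "?f \<in> schwartz"
    using schwartz_modulate[OF schwartz_slice[OF F], of "- 2 * pi" \<xi> x] by (simp add: mult.commute)
  have d: "dir_deriv e ?f t = dir_deriv (0, e) F (x, t) * cis (- 2 * pi * (\<xi> \<bullet> t))
      + (- (2 * pi * \<i> * (\<xi> \<bullet> e))) * (F (x, t) * cis (- 2 * pi * (\<xi> \<bullet> t)))" for t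
  proof -
    have "((\<lambda>t. - 2 * pi * (\<xi> \<bullet> t)) has_derivative (\<lambda>h. - 2 * pi * (\<xi> \<bullet> h))) (at t)"
      by (auto intro!: derivative_eq_intros)
    note d2 = has_derivative_compose[OF this has_derivative_cis]
    from has_derivative_mult[OF schwartz_has_derivative[OF schwartz_slice[OF F, of x], of t] d2]
    show ?thesis by (subst dir_deriv_eq, assumption) (simp add: dir_deriv_slice[OF F] scaleR_conv_of_real algebra_simps)
  qed
  have i1: "integrable lborel (\<lambda>t. dir_deriv (0, e) F (x, t) * cis (- 2 * pi * (\<xi> \<bullet> t)))"
    using partial_fourier_integrable[OF schwartz_dir_deriv[OF F], of "\<lambda>_. 1" 1 0 "(0, e)" x \<xi>] by simp
  have "0 = (\<integral>t. dir_deriv e ?f t \<partial>lborel)" by (rule integral_dir_deriv_zero[OF S, symmetric])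
  also have "\<dots> = partial_fourier (\<lambda>_. 1) (dir_deriv (0, e) F) (x, \<xi>) + (- (2 * pi * \<i> * (\<xi> \<bullet> e))) * partial_fourier (\<lambda>_. 1) F (x, \<xi>)"
    unfolding d using i1 schwartz_integrable[OF S] by (simp add: partial_fourier_def mult.assoc)
  finally show ?thesis by (simp add: field_simps)
qed

context seminorm_scale begin

lemma fam_bounded_partial_fourier:
  fixes F :: "'i \<Rightarrow> 'a::euclidean_space \<times> 'b::euclidean_space \<Rightarrow> complex"
  assumes F: "sbounded F"
  shows "fam_bounded (\<lambda>i z. norm (partial_fourier (\<lambda>_. 1) (F i) z))"
proof -
  obtain C M where C: "0 \<le> C" "\<forall>i\<in>I. \<forall>x. (1 + norm x) ^ (2 * DIM('b)) * norm (F i x) \<le> C * w M i"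
    using sbounded_fam_bounded[OF F, of "2 * DIM('b)"] by (rule fam_boundedE)
  let ?J = "\<integral>t. 1 / (1 + norm (t::'b)) ^ (2 * DIM('b)) \<partial>lborel"
  show ?thesis
  proof (rule fam_boundedI[where M = M and C = "C * ?J"])
    fix i and z :: "'a \<times> 'b" assume i: "i \<in> I"
    let ?f = "\<lambda>t. F i (fst z, t) * cis (- 2 * pi * (snd z \<bullet> t))"
    have e: "norm (?f t) \<le> C * w M i * (1 / (1 + norm t) ^ (2 * DIM('b)))" for t
    proof -
      have "(1 + norm t) ^ (2 * DIM('b)) * norm (?f t) \<le> (1 + norm (fst z, t)) ^ (2 * DIM('b)) * norm (F i (fst z, t))"
        unfolding norm_mult norm_cis mult_1_right by (intro mult_right_mono norm_snd_weight norm_ge_zero)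
      also have "\<dots> \<le> C * w M i" using C(2) i by blast
      finally show ?thesis by (simp add: pos_le_divide_eq add_pos_nonneg mult_ac)
    qed
    have "norm (\<integral>t. ?f t \<partial>lborel) \<le> (\<integral>t. C * w M i * (1 / (1 + norm (t::'b)) ^ (2 * DIM('b))) \<partial>lborel)"
    proof (rule norm_integral_le)
      show "norm (?f t) \<le> C * w M i * (1 / (1 + norm t) ^ (2 * DIM('b)))" for t by (rule e)
      show "integrable lborel (\<lambda>t. C * w M i * (1 / (1 + norm (t::'b)) ^ (2 * DIM('b))))"
        by (intro integrable_mult_right integrable_weight) simp
      show "integrable lborel ?f"
        using partial_fourier_integrable[OF sbounded_schwartz[OF F i], of "\<lambda>_. 1" 1 0] by simp
    qed
    then have "norm (\<integral>t. ?f t \<partial>lborel) \<le> C * w M i * ?J" by (simp only: integral_mult_right_zero)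
    then show "norm (partial_fourier (\<lambda>_. 1) (F i) z) \<le> C * ?J * w M i"
      by (simp add: partial_fourier_def case_prod_unfold mult_ac)
  qed (use C in \<open>simp add: integral_nonneg_AE\<close>)
qed

text \<open>Partial transforms of bounded families are closed under differentiation and under
  multiplication by coordinates: a position passes through the integral, and a frequency becomes a
  derivative of \<open>F\<close>. So the bound without weight already gives all decay
  estimates.\<close>

lemma sbounded_partial_fourier:
  fixes F :: "'i \<Rightarrow> 'a::euclidean_space \<times> 'b::euclidean_space \<Rightarrow> complex"
  assumes "sbounded F"
  shows "sbounded (\<lambda>i. partial_fourier (\<lambda>_. 1) (F i))"
proof -
  let ?X = "\<lambda>H. \<exists>F :: 'i \<Rightarrow> 'a \<times> 'b \<Rightarrow> complex. sbounded F \<and> H = (\<lambda>i. partial_fourier (\<lambda>_. 1) (F i))"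
  show ?thesis
  proof (rule sbounded_coinduct[of ?X])
    fix H :: "'i \<Rightarrow> 'a \<times> 'b \<Rightarrow> complex" assume "?X H"
    then obtain F :: "'i \<Rightarrow> 'a \<times> 'b \<Rightarrow> complex" where F: "sbounded F" and H: "H = (\<lambda>i. partial_fourier (\<lambda>_. 1) (F i))" by blast
    let ?G = "\<lambda>k i z. of_real (k \<bullet> snd z) * (- 2 * pi * \<i> * F i z)"
    let ?D = "\<lambda>i z h. partial_fourier (\<lambda>_. 1) (dir_deriv (fst h, 0) (F i)) z + partial_fourier (\<lambda>_. 1) (?G (snd h) i) z"
    note FS = sbounded_schwartz[OF F]
    have "\<forall>i\<in>I. \<forall>x. (H i has_derivative ?D i x) (at x)"
      unfolding H by (intro ballI allI partial_fourier_has_derivative[OF FS, where K = 1 and m = 0]) auto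
    moreover have "\<exists>H'. ?X H' \<and> (\<forall>i\<in>I. \<forall>x. H' i x = ?D i x v)" if "v \<in> Basis" for v
    proof -
      from that consider b where "v = (b, 0)" "b \<in> Basis" | b where "v = (0, b)" "b \<in> Basis"
        by (auto simp: Basis_prod_def)
      then show ?thesis
      proof cases
        case 1
        show ?thesis
          by (rule exI[of _ "\<lambda>i. partial_fourier (\<lambda>_. 1) (dir_deriv (b, 0) (F i))"], intro conjI exI[of _ "\<lambda>i. dir_deriv (b, 0) (F i)"] sbounded_dir_deriv F refl)
             (simp add: 1 partial_fourier_0)
      next
        case 2
        have "dir_deriv (0, 0) (F i) = (\<lambda>_. 0)" if "i \<in> I" for i
          using schwartz_dir_deriv_0[OF FS[OF that]] by (simp add: fun_eq_iff zero_prod_def)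
        then show ?thesis
          by (intro exI[of _ "\<lambda>i. partial_fourier (\<lambda>_. 1) (?G b i)"] conjI exI[of _ "?G b"] sbounded_linear_mult sbounded_cmult F refl bounded_linear_intros)
             (simp add: 2 partial_fourier_0)
      qed
    qed
    ultimately show "\<exists>D. (\<forall>i\<in>I. \<forall>x. (H i has_derivative D i x) (at x)) \<and>
       (\<forall>v\<in>Basis. \<exists>F'. ?X F' \<and> (\<forall>i\<in>I. \<forall>x. F' i x = D i x v))"
      by (intro exI[of _ ?D]) auto
  next
    fix H :: "'i \<Rightarrow> 'a \<times> 'b \<Rightarrow> complex" and N assume XH: "?X H"
    show "fam_bounded (\<lambda>i x. (1 + norm x) ^ N * norm (H i x))"
    proof (rule fam_bounded_weight_coords[where X = ?X])
      show "?X H" by (rule XH)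
    next
      fix H :: "'i \<Rightarrow> 'a \<times> 'b \<Rightarrow> complex" assume "?X H"
      then obtain F :: "'i \<Rightarrow> 'a \<times> 'b \<Rightarrow> complex" where F: "sbounded F" and H: "H = (\<lambda>i. partial_fourier (\<lambda>_. 1) (F i))" by blast
      show "fam_bounded (\<lambda>i x. norm (H i x))" unfolding H by (rule fam_bounded_partial_fourier[OF F])
      fix v :: "'a \<times> 'b" assume "v \<in> Basis"
      then consider b where "v = (b, 0)" "b \<in> Basis" | b where "v = (0, b)" "b \<in> Basis"
        by (auto simp: Basis_prod_def)
      then show "\<exists>F' c. ?X F' \<and> (\<forall>i\<in>I. \<forall>x. complex_of_real (x \<bullet> v) * H i x = c * F' i x)"
      proof cases
        case 1
        have "of_real (z \<bullet> v) * H i z = 1 * partial_fourier (\<lambda>_. 1) (\<lambda>z. of_real (z \<bullet> v) * F i z) z" for i z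
          unfolding H partial_fourier_def case_prod_unfold integral_mult_right_zero[symmetric]
          by (simp add: 1 mult_ac inner_prod_def)
        then show ?thesis
          by (intro exI[of _ "\<lambda>i. partial_fourier (\<lambda>_. 1) (\<lambda>z. of_real (z \<bullet> v) * F i z)"] exI[of _ 1] conjI
                exI[of _ "\<lambda>i z. of_real (z \<bullet> v) * F i z"] sbounded_linear_mult F refl bounded_linear_intros) simp
      next
        case 2
        have "of_real (z \<bullet> v) * H i z = (1 / (2 * pi * \<i>)) * partial_fourier (\<lambda>_. 1) (dir_deriv v (F i)) z" if "i \<in> I" for i z
          using partial_fourier_mult_freq[OF sbounded_schwartz[OF F that], of "snd z" b "fst z"] by (simp add: H 2 inner_prod_def)
        then show ?thesis
          by (intro exI[of _ "\<lambda>i. partial_fourier (\<lambda>_. 1) (dir_deriv v (F i))"] exI[of _ "1 / (2 * pi * \<i>)"] conjI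
                exI[of _ "\<lambda>i. dir_deriv v (F i)"] sbounded_dir_deriv F refl) auto
      qed
    qed
  qed (use assms in blast)
qed

end

lemma schwartz_partial_fourier: "F \<in> schwartz \<Longrightarrow> partial_fourier (\<lambda>_. 1) F \<in> schwartz"
  unfolding schwartz_iff_sbounded by (rule single.sbounded_partial_fourier)

section \<open>Integrals of Schwartz functions over a parameter\<close>

lemma schwartz_iterated_deriv: "f \<in> schwartz \<Longrightarrow> iterated_deriv vs f \<in> schwartz"
  by (induction vs) (simp_all add: schwartz_dir_deriv iterated_deriv_Cons_dir_deriv del: iterated_deriv.simps(2))

lemma iterated_deriv_slice:
  assumes "H \<in> schwartz"
  shows "iterated_deriv vs (\<lambda>x. H (p, x)) = (\<lambda>x. iterated_deriv (map (Pair 0) vs) H (p, x))"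
proof (induction vs)
  case (Cons v vs)
  have "iterated_deriv (v # vs) (\<lambda>x. H (p, x)) = dir_deriv v (\<lambda>x. iterated_deriv (map (Pair 0) vs) H (p, x))"
    by (simp only: iterated_deriv_Cons_dir_deriv Cons.IH)
  then show ?case
    by (simp add: iterated_deriv_Cons_dir_deriv dir_deriv_slice[OF schwartz_iterated_deriv[OF assms]] fun_eq_iff del: iterated_deriv.simps(2))
qed simp

text \<open>A superposition of the slices of \<open>H\<close>. The coefficient \<open>b\<close> is
  allowed polynomial growth, as it will be the value of a tempered distribution on a time-frequency
  shift.\<close>

definition param_integral :: "('p::euclidean_space \<Rightarrow> complex) \<Rightarrow> ('p \<times> 'a::euclidean_space \<Rightarrow> complex) \<Rightarrow> 'a \<Rightarrow> complex" where
  "param_integral b H = (\<lambda>x. \<integral>p. b p * H (p, x) \<partial>lborel)"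

lemma param_integral_integrable:
  fixes H :: "'b::euclidean_space \<times> 'a::euclidean_space \<Rightarrow> complex"
  assumes H: "H \<in> schwartz"
    and b: "b \<in> borel_measurable borel" "\<And>t. norm (b t) \<le> K * (1 + norm t) ^ m"
  shows "integrable lborel (\<lambda>p. b p * H (p, x))"
proof -
  note S = schwartz_slice'[OF H, of x]
  obtain C where "\<And>p. (1 + norm p) ^ (m + 2 * DIM('b)) * norm (H (p, x)) \<le> C"
    using schwartz_decay[OF S] by blast
  with schwartz_measurable[OF S] show ?thesis by (intro mult_integrable_decay(1)[OF b])
qed

lemma param_integral_has_derivative:
  fixes H :: "'p::euclidean_space \<times> 'a::euclidean_space \<Rightarrow> complex"
  assumes H: "H \<in> schwartz"
    and b: "b \<in> borel_measurable borel" "\<And>t. norm (b t) \<le> K * (1 + norm t) ^ m"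
  shows "(param_integral b H has_derivative (\<lambda>h. param_integral b (dir_deriv (0, h) H) x)) (at x)"
proof -
  obtain C1 where C1: "0 \<le> C1" "\<And>z v. (1 + norm z) ^ (m + 2 * DIM('p)) * norm (dir_deriv v H z) \<le> C1 * norm v"
    using schwartz_dir_deriv_decay[OF H] by blast
  show ?thesis unfolding param_integral_def
  proof (rule has_derivative_integral)
    show "integrable lborel (\<lambda>p. K * C1 * (1 / (1 + norm (p::'p)) ^ (2 * DIM('p))))"
      by (intro integrable_mult_right integrable_weight) simp
    fix p x h
    show "((\<lambda>x. b p * H (p, x)) has_derivative (\<lambda>h. b p * dir_deriv (0, h) H (p, x))) (at x)"
    proof (rule has_derivative_mult_right)
      have "((\<lambda>x. (p, x)) has_derivative (\<lambda>h. (0, h))) (at x)" by (auto intro!: derivative_eq_intros)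
      from has_derivative_compose[OF this schwartz_has_derivative[OF H]]
      show "((\<lambda>x. H (p, x)) has_derivative (\<lambda>h. dir_deriv (0, h) H (p, x))) (at x)" .
    qed
    have "(1 + norm p) ^ (m + 2 * DIM('p)) * norm (dir_deriv (0, h) H (p, x)) \<le> C1 * norm h" for p
    proof -
      have "(1 + norm p) ^ (m + 2 * DIM('p)) * norm (dir_deriv (0, h) H (p, x)) \<le> (1 + norm (p, x)) ^ (m + 2 * DIM('p)) * norm (dir_deriv (0, h) H (p, x))"
        by (intro mult_right_mono norm_fst_weight) auto
      also have "\<dots> \<le> C1 * norm (0::'p, h)" by (rule C1)
      finally show ?thesis by (simp add: norm_Pair)
    qed
    from mult_integrable_decay(2)[OF b schwartz_measurable[OF schwartz_slice'[OF schwartz_dir_deriv[OF H]]] this]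
    show "norm (b p * dir_deriv (0, h) H (p, x)) \<le> K * C1 * (1 / (1 + norm p) ^ (2 * DIM('p))) * norm h"
      by (simp add: mult_ac)
  next
    show "integrable lborel (\<lambda>p. b p * H (p, x))" for x by (rule param_integral_integrable[OF H b])
    show "(\<lambda>p. b p * dir_deriv (0, h) H (p, x)) \<in> borel_measurable lborel" for h
      by (rule borel_measurable_integrable, rule param_integral_integrable[OF schwartz_dir_deriv[OF H] b])
  qed
qed

lemma iterated_deriv_param_integral:
  assumes H: "H \<in> schwartz"
    and b: "b \<in> borel_measurable borel" "\<And>t. norm (b t) \<le> K * (1 + norm t) ^ m"
  shows "iterated_deriv vs (param_integral b H) = param_integral b (iterated_deriv (map (Pair 0) vs) H)"
proof (induction vs)
  case (Cons v vs)
  have "iterated_deriv (v # vs) (param_integral b H) = dir_deriv v (param_integral b (iterated_deriv (map (Pair 0) vs) H))"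
    by (simp only: iterated_deriv_Cons_dir_deriv Cons.IH)
  then show ?case
    by (simp add: iterated_deriv_Cons_dir_deriv dir_deriv_eq[OF param_integral_has_derivative[OF schwartz_iterated_deriv[OF H] b]] fun_eq_iff del: iterated_deriv.simps(2))
qed simp

lemma schwartz_param_integral:
  fixes H :: "'p::euclidean_space \<times> 'a::euclidean_space \<Rightarrow> complex"
  assumes H: "H \<in> schwartz"
    and b: "b \<in> borel_measurable borel" "\<And>t. norm (b t) \<le> K * (1 + norm t) ^ m"
  shows "param_integral b H \<in> schwartz"
  unfolding schwartz_def
proof (intro CollectI ballI conjI allI)
  fix vs :: "'a list"
  let ?G = "iterated_deriv (map (Pair 0) vs) H"
  note G = schwartz_iterated_deriv[OF H, of "map (Pair 0) vs"]
  show "iterated_deriv vs (param_integral b H) differentiable (at x)" for x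
    unfolding iterated_deriv_param_integral[OF H b] differentiable_def using param_integral_has_derivative[OF G b] by blast
  fix N
  \<comment> \<open>The order of decay pays for three things: \<open>m\<close> powers for the growth
    of \<open>b\<close>, \<open>2 * DIM('p)\<close> for integrability, and \<open>N\<close> for the
    weight in \<open>x\<close>.\<close>
  obtain C where C: "0 \<le> C" "\<And>z. (1 + norm z) ^ ((m + 2 * DIM('p)) + N) * norm (?G z) \<le> C"
    using schwartz_decay[OF G] by blast
  have "(1 + norm x) ^ N * norm (param_integral b ?G x) \<le> (\<integral>p. K * C * (1 / (1 + norm (p::'p)) ^ (2 * DIM('p))) \<partial>lborel)" for x
  proof -
    let ?g = "\<lambda>p. of_real ((1 + norm x) ^ N) * ?G (p, x)"
    have *: "(1 + norm p) ^ (m + 2 * DIM('p)) * norm (?g p) \<le> C" for p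
    proof -
      have "(1 + norm p) ^ (m + 2 * DIM('p)) * norm (?g p) = ((1 + norm p) ^ (m + 2 * DIM('p)) * (1 + norm x) ^ N) * norm (?G (p, x))"
        by (simp only: norm_mult norm_of_real) simp
      also have "\<dots> \<le> ((1 + norm (p, x)) ^ (m + 2 * DIM('p)) * (1 + norm (p, x)) ^ N) * norm (?G (p, x))"
        by (intro mult_mono mult_right_mono norm_fst_weight norm_snd_weight) auto
      also have "\<dots> = (1 + norm (p, x)) ^ ((m + 2 * DIM('p)) + N) * norm (?G (p, x))" by (simp only: power_add)
      also have "\<dots> \<le> C" by (rule C)
      finally show ?thesis .
    qed
    have "?g \<in> borel_measurable borel" using schwartz_measurable[OF schwartz_slice'[OF G, of x]] by simp
    note d = mult_integrable_decay[OF b this *]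
    have "(1 + norm x) ^ N * norm (param_integral b ?G x) = norm (of_real ((1 + norm x) ^ N) * param_integral b ?G x)"
      by (simp only: norm_mult norm_of_real) simp
    also have "of_real ((1 + norm x) ^ N) * param_integral b ?G x = (\<integral>p. b p * ?g p \<partial>lborel)"
      unfolding param_integral_def integral_mult_right_zero[symmetric] by (simp add: mult_ac)
    also have "norm \<dots> \<le> (\<integral>p. K * C * (1 / (1 + norm (p::'p)) ^ (2 * DIM('p))) \<partial>lborel)"
      by (rule norm_integral_le[OF d(1) _ d(2)])
         (intro integrable_mult_right integrable_weight, simp)
    finally show ?thesis .
  qed
  then show "\<exists>C. \<forall>x. (1 + norm x) ^ N * norm (iterated_deriv vs (param_integral b H) x) \<le> C"
    unfolding iterated_deriv_param_integral[OF H b] by blast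
qed

section \<open>Fourier inversion\<close>

lemma integrable_tensor:
  fixes f :: "'a::euclidean_space \<Rightarrow> complex" and g :: "'b::euclidean_space \<Rightarrow> complex"
  assumes "integrable lborel f" "integrable lborel g"
  shows "integrable (lborel \<Otimes>\<^sub>M lborel) (\<lambda>(x, y). f x * g y)"
proof (rule lborel_pair.Fubini_integrable)
  have [measurable]: "f \<in> borel_measurable borel" "g \<in> borel_measurable borel" using assms by auto
  show "(\<lambda>(x, y). f x * g y) \<in> borel_measurable (lborel \<Otimes>\<^sub>M lborel)" by measurable
  show "integrable lborel (\<lambda>x. \<integral>y. norm (case (x, y) of (x, y) \<Rightarrow> f x * g y) \<partial>lborel)"
    using assms by (simp add: norm_mult)
  show "AE x in lborel. integrable lborel (\<lambda>y. case (x, y) of (x, y) \<Rightarrow> f x * g y)" using assms by simp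
qed

lemma integral_scale:
  fixes h :: "'a::euclidean_space \<Rightarrow> complex"
  assumes [measurable]: "h \<in> borel_measurable borel" and c: "c \<noteq> 0"
  shows "(\<integral>y. h y \<partial>lborel) = (\<integral>v. of_real (\<bar>c\<bar> ^ DIM('a)) * h (t + c *\<^sub>R v) \<partial>lborel)"
proof -
  have "(\<integral>y. h y \<partial>lborel) = (\<integral>y. h y \<partial>density (distr lborel borel (\<lambda>x. t + c *\<^sub>R x)) (\<lambda>_. ennreal (\<bar>c\<bar> ^ DIM('a))))"
    using lborel_affine[OF c, of t] by simp
  also have "\<dots> = (\<integral>y. (\<bar>c\<bar> ^ DIM('a)) *\<^sub>R h y \<partial>distr lborel borel (\<lambda>x. t + c *\<^sub>R x))"
    by (subst integral_density) auto
  also have "\<dots> = (\<integral>v. (\<bar>c\<bar> ^ DIM('a)) *\<^sub>R h (t + c *\<^sub>R v) \<partial>lborel)"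
    by (subst integral_distr) auto
  finally show ?thesis by (simp add: scaleR_conv_of_real)
qed

section \<open>Gaussian integrals and the inversion theorem\<close>

lemma gauss_integrable:
  assumes "(c::real) > 0"
  shows "integrable lborel (\<lambda>t::real. exp (- (c * t)\<^sup>2 / 2))"
proof -
  have "integrable lborel (\<lambda>t. sqrt (2 * pi) * std_normal_density (0 + c * t))"
    by (intro integrable_mult_right lborel_integrable_real_affine integrable_normal_density) (use assms in auto)
  then show ?thesis by (simp add: std_normal_density_def)
qed

lemma gauss_integral:
  assumes "(c::real) > 0"
  shows "(\<integral>t. exp (- (c * t)\<^sup>2 / 2) \<partial>lborel) = sqrt (2 * pi) / c"
proof -
  have "1 = (\<integral>t. std_normal_density t \<partial>lborel)" by simp
  also have "\<dots> = \<bar>c\<bar> *\<^sub>R (\<integral>t. std_normal_density (0 + c * t) \<partial>lborel)"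
    by (rule lborel_integral_real_affine) (use assms in auto)
  also have "\<dots> = c / sqrt (2 * pi) * (\<integral>t. exp (- (c * t)\<^sup>2 / 2) \<partial>lborel)"
    using assms by (simp add: std_normal_density_def)
  finally show ?thesis using assms by (simp add: field_simps)
qed

text \<open>The Fourier transform of a Gaussian is read off from the characteristic function of the
  standard normal distribution by scaling.\<close>

lemma gauss_char:
  assumes c: "(c::real) > 0"
  shows "(\<integral>t. of_real (exp (- (c * t)\<^sup>2 / 2)) * cis (2 * pi * (t * z)) \<partial>lborel)
       = of_real (sqrt (2 * pi) / c * exp (- (2 * pi * z / c)\<^sup>2 / 2))"
proof -
  let ?u = "2 * pi * z / c"
  have "complex_of_real (exp (- ?u\<^sup>2 / 2)) = char std_normal_distribution ?u"
    by (simp add: char_std_normal_distribution)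
  also have "\<dots> = (\<integral>x. std_normal_density x *\<^sub>R cis (?u * x) \<partial>lborel)"
    unfolding char_def by (subst integral_density) (auto simp: cis_conv_exp)
  also have "\<dots> = \<bar>c\<bar> *\<^sub>R (\<integral>t. std_normal_density (0 + c * t) *\<^sub>R cis (?u * (0 + c * t)) \<partial>lborel)"
    by (rule lborel_integral_real_affine) (use c in auto)
  also have "\<dots> = of_real c * (\<integral>t. of_real (1 / sqrt (2 * pi)) * (of_real (exp (- (c * t)\<^sup>2 / 2)) * cis (2 * pi * (t * z))) \<partial>lborel)"
    using c by (simp add: std_normal_density_def scaleR_conv_of_real mult_ac)
  also have "\<dots> = of_real (c / sqrt (2 * pi)) * (\<integral>t. of_real (exp (- (c * t)\<^sup>2 / 2)) * cis (2 * pi * (t * z)) \<partial>lborel)"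
    unfolding integral_mult_right_zero by simp
  finally show ?thesis using c by (simp add: field_simps)
qed

text \<open>A Gaussian cutoff of width \<open>1 / c\<close> in frequency makes Fubini applicable and
  turns the inversion integral into an average of \<open>f\<close> around \<open>x\<close> at scale
  \<open>c\<close>. As \<open>c\<close> tends to 0, the left side converges by integrability of
  \<open>fourier f\<close> and the right side by continuity and boundedness of
  \<open>f\<close>.\<close>

theorem fourier_inversion:
  fixes f :: "'a::euclidean_space \<Rightarrow> complex"
  assumes cont: "continuous_on UNIV f" and B: "\<And>x. norm (f x) \<le> B"
    and f: "integrable lborel f" and ff: "integrable lborel (fourier f)"
  shows "(\<integral>\<xi>. fourier f \<xi> * cis (2 * pi * (\<xi> \<bullet> x)) \<partial>lborel) = f x"
proof -
  let ?G = "\<lambda>c (\<xi>::'a). \<Prod>b\<in>Basis. exp (- (c * (\<xi> \<bullet> b))\<^sup>2 / 2)"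
  \<comment> \<open>The Fourier transform of the cutoff, rescaled so that it no longer depends on
    \<open>c\<close>. It has total mass 1.\<close>
  let ?P = "\<lambda>v::'a. \<Prod>b\<in>Basis. sqrt (2 * pi) * exp (- (2 * pi * (v \<bullet> b))\<^sup>2 / 2)"
  have fm [measurable]: "f \<in> borel_measurable borel" using f by auto
  have ffm [measurable]: "fourier f \<in> borel_measurable borel" using ff by auto
  have G1: "\<bar>?G c \<xi>\<bar> \<le> 1" for c \<xi> by (auto simp: abs_prod intro!: prod_le_1)
  have Gint: "integrable lborel (\<lambda>\<xi>. complex_of_real (?G c \<xi>))" if "c > 0" for c
    by (intro integrable_of_real integrable_prod_Basis(1)[where f = "\<lambda>_ t. exp (- (c * t)\<^sup>2 / 2)"] gauss_integrable that)
  have Pint: "integrable lborel ?P"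
    by (intro integrable_prod_Basis(1)[where f = "\<lambda>_ t. sqrt (2 * pi) * exp (- (2 * pi * t)\<^sup>2 / 2)"]
        integrable_mult_right gauss_integrable) auto
  have P1: "(\<integral>v. ?P v \<partial>lborel) = 1"
  proof -
    have "(\<integral>v. ?P v \<partial>lborel) = (\<Prod>b\<in>(Basis::'a set). \<integral>t. sqrt (2 * pi) * exp (- (2 * pi * t)\<^sup>2 / 2) \<partial>lborel)"
      by (rule integrable_prod_Basis(2)[where f = "\<lambda>_ t. sqrt (2 * pi) * exp (- (2 * pi * t)\<^sup>2 / 2)"])
         (intro integrable_mult_right gauss_integrable, auto)
    also have "(\<integral>t. sqrt (2 * pi) * exp (- (2 * pi * t)\<^sup>2 / 2) \<partial>lborel) = 1"
      unfolding integral_mult_right_zero using gauss_integral[of "2 * pi"] by simp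
    finally show ?thesis by simp
  qed
  have P0: "0 \<le> ?P v" for v by (intro prod_nonneg) auto
  have main: "(\<integral>\<xi>. fourier f \<xi> * cis (2 * pi * (\<xi> \<bullet> x)) * of_real (?G c \<xi>) \<partial>lborel)
      = (\<integral>v. f (x + c *\<^sub>R v) * of_real (?P v) \<partial>lborel)" if c: "c > 0" for c
  proof -
    let ?h = "\<lambda>\<xi> y. f y * of_real (?G c \<xi>) * cis (2 * pi * (\<xi> \<bullet> (x - y)))"
    have int: "integrable (lborel \<Otimes>\<^sub>M lborel) (\<lambda>(\<xi>, y). ?h \<xi> y)"
    proof (rule Bochner_Integration.integrable_bound[OF integrable_tensor[OF Gint[OF c] f]])
      show "(\<lambda>(\<xi>, y). ?h \<xi> y) \<in> borel_measurable (lborel \<Otimes>\<^sub>M lborel)"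
      proof -
        have [measurable]: "cis \<in> borel_measurable borel"
          by (intro borel_measurable_continuous_onI continuous_on_cis continuous_on_id)
        show ?thesis by measurable
      qed
    qed (auto simp: norm_mult mult_ac)
    have e: "cis (2 * pi * (\<xi> \<bullet> (x - y))) = cis (2 * pi * (\<xi> \<bullet> x)) * cis (- 2 * pi * (\<xi> \<bullet> y))" for \<xi> y
      by (simp add: cis_mult inner_diff_right algebra_simps)
    have "(\<integral>\<xi>. fourier f \<xi> * cis (2 * pi * (\<xi> \<bullet> x)) * of_real (?G c \<xi>) \<partial>lborel)
       = (\<integral>\<xi>. (\<integral>y. ?h \<xi> y \<partial>lborel) \<partial>lborel)"
      unfolding fourier_def integral_mult_left_zero[symmetric]
      unfolding e by (simp only: mult_ac)
    also have "\<dots> = (\<integral>y. (\<integral>\<xi>. ?h \<xi> y \<partial>lborel) \<partial>lborel)"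
      using int by (rule lborel_pair.Fubini_integral[symmetric])
    also have "\<dots> = (\<integral>y. f y * of_real (\<Prod>b\<in>Basis. sqrt (2 * pi) / c * exp (- (2 * pi * ((x - y) \<bullet> b) / c)\<^sup>2 / 2)) \<partial>lborel)"
    proof (rule Bochner_Integration.integral_cong[OF refl])
      fix y
      let ?k = "\<lambda>b t. of_real (exp (- (c * t)\<^sup>2 / 2)) * cis (2 * pi * (t * ((x - y) \<bullet> b)))"
      have e: "of_real (?G c \<xi>) * cis (2 * pi * (\<xi> \<bullet> (x - y))) = (\<Prod>b\<in>Basis. ?k b (\<xi> \<bullet> b))" for \<xi>
      proof -
        have "\<xi> \<bullet> (x - y) = (\<Sum>b\<in>Basis. (\<xi> \<bullet> b) * ((x - y) \<bullet> b))" by (rule euclidean_inner)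
        then have "cis (2 * pi * (\<xi> \<bullet> (x - y))) = (\<Prod>b\<in>Basis. cis (2 * pi * ((\<xi> \<bullet> b) * ((x - y) \<bullet> b))))"
          by (simp add: sum_distrib_left cis_conv_exp exp_sum flip: of_real_sum)
             (simp add: sum_distrib_left cis_conv_exp exp_sum)
        then show ?thesis by (simp add: prod.distrib)
      qed
      have "(\<integral>\<xi>. ?h \<xi> y \<partial>lborel) = f y * (\<integral>\<xi>. of_real (?G c \<xi>) * cis (2 * pi * (\<xi> \<bullet> (x - y))) \<partial>lborel)"
        unfolding integral_mult_right_zero[symmetric] by (simp add: mult.assoc)
      also have "(\<integral>\<xi>. of_real (?G c \<xi>) * cis (2 * pi * (\<xi> \<bullet> (x - y))) \<partial>lborel)
        = (\<Prod>b\<in>Basis. \<integral>t. ?k b t \<partial>lborel)"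
        unfolding e
      proof (rule integrable_prod_Basis(2))
        fix b :: 'a
        have "integrable lborel (\<lambda>t. complex_of_real (exp (- (c * t)\<^sup>2 / 2)))"
          by (intro integrable_of_real gauss_integrable c)
        then show "integrable lborel (?k b)"
        proof (rule Bochner_Integration.integrable_bound)
          have [measurable]: "cis \<in> borel_measurable borel"
            by (intro borel_measurable_continuous_onI continuous_on_cis continuous_on_id)
          show "?k b \<in> borel_measurable lborel" by measurable
        qed (auto simp: norm_mult)
      qed
      also have "\<dots> = of_real (\<Prod>b\<in>Basis. sqrt (2 * pi) / c * exp (- (2 * pi * ((x - y) \<bullet> b) / c)\<^sup>2 / 2))"
        by (simp only: gauss_char[OF c] of_real_prod)
      finally show "(\<integral>\<xi>. ?h \<xi> y \<partial>lborel) = f y * of_real (\<Prod>b\<in>Basis. sqrt (2 * pi) / c * exp (- (2 * pi * ((x - y) \<bullet> b) / c)\<^sup>2 / 2))" .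
    qed
    \<comment> \<open>The substitution \<open>y = x + c *\<^sub>R v\<close> moves the dependence on
      \<open>c\<close> from the kernel to the argument of \<open>f\<close>; the Jacobian cancels one
      \<open>1 / c\<close> per coordinate.\<close>
    also have "\<dots> = (\<integral>v. of_real (\<bar>c\<bar> ^ DIM('a)) * (f (x + c *\<^sub>R v) * of_real (\<Prod>b\<in>Basis. sqrt (2 * pi) / c * exp (- (2 * pi * ((x - (x + c *\<^sub>R v)) \<bullet> b) / c)\<^sup>2 / 2))) \<partial>lborel)"
      by (rule integral_scale) (use c in auto)
    also have "\<dots> = (\<integral>v. f (x + c *\<^sub>R v) * of_real (?P v) \<partial>lborel)"
    proof (rule Bochner_Integration.integral_cong[OF refl])
      fix v :: 'a
      have "\<bar>c\<bar> ^ DIM('a) * (\<Prod>b\<in>Basis. sqrt (2 * pi) / c * exp (- (2 * pi * ((x - (x + c *\<^sub>R v)) \<bullet> b) / c)\<^sup>2 / 2))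
         = (\<Prod>b\<in>(Basis::'a set). c * (sqrt (2 * pi) / c * exp (- (2 * pi * ((x - (x + c *\<^sub>R v)) \<bullet> b) / c)\<^sup>2 / 2)))"
        using c by (subst prod.distrib[of "\<lambda>_. c"]) simp
      also have "\<dots> = ?P v" using c by (intro prod.cong refl) (simp add: power_mult_distrib)
      finally show "of_real (\<bar>c\<bar> ^ DIM('a)) * (f (x + c *\<^sub>R v) * of_real (\<Prod>b\<in>Basis. sqrt (2 * pi) / c * exp (- (2 * pi * ((x - (x + c *\<^sub>R v)) \<bullet> b) / c)\<^sup>2 / 2)))
         = f (x + c *\<^sub>R v) * of_real (?P v)"
        by (metis (no_types, lifting) mult.left_commute of_real_mult)
    qed
    finally show ?thesis .
  qed
  let ?c = "\<lambda>n. 1 / real (Suc n)"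
  have c0: "?c \<longlonglongrightarrow> 0" by (rule lim_1_over_n[THEN LIMSEQ_Suc])
  have cpos: "0 < ?c n" for n by simp
  have cism: "(\<lambda>\<xi>. cis (2 * pi * (\<xi> \<bullet> x))) \<in> borel_measurable borel"
    by (intro borel_measurable_continuous_onI continuous_intros)
  have "(\<lambda>n. \<integral>\<xi>. fourier f \<xi> * cis (2 * pi * (\<xi> \<bullet> x)) * of_real (?G (?c n) \<xi>) \<partial>lborel)
     \<longlonglongrightarrow> (\<integral>\<xi>. fourier f \<xi> * cis (2 * pi * (\<xi> \<bullet> x)) \<partial>lborel)"
  proof (rule integral_dominated_convergence[where w = "\<lambda>\<xi>. norm (fourier f \<xi>)"])
    show "AE \<xi> in lborel. (\<lambda>n. fourier f \<xi> * cis (2 * pi * (\<xi> \<bullet> x)) * of_real (?G (?c n) \<xi>)) \<longlonglongrightarrow> fourier f \<xi> * cis (2 * pi * (\<xi> \<bullet> x))"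
    proof (rule AE_I2)
      fix \<xi> :: 'a
      have "(\<lambda>n. ?G (?c n) \<xi>) \<longlonglongrightarrow> (\<Prod>b\<in>(Basis::'a set). exp (- (0 * (\<xi> \<bullet> b))\<^sup>2 / 2))"
        by (intro tendsto_intros c0) auto
      then have "(\<lambda>n. complex_of_real (?G (?c n) \<xi>)) \<longlonglongrightarrow> of_real 1" by (intro tendsto_of_real) simp
      from tendsto_mult_left[OF this, of "fourier f \<xi> * cis (2 * pi * (\<xi> \<bullet> x))"]
      show "(\<lambda>n. fourier f \<xi> * cis (2 * pi * (\<xi> \<bullet> x)) * of_real (?G (?c n) \<xi>)) \<longlonglongrightarrow> fourier f \<xi> * cis (2 * pi * (\<xi> \<bullet> x))" by simp
    qed
    show "AE \<xi> in lborel. norm (fourier f \<xi> * cis (2 * pi * (\<xi> \<bullet> x)) * of_real (?G (?c n) \<xi>)) \<le> norm (fourier f \<xi>)" for n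
      using G1 by (intro AE_I2) (simp only: norm_mult norm_cis norm_of_real mult_1_right mult_left_le norm_ge_zero)
    show "(\<lambda>\<xi>. fourier f \<xi> * cis (2 * pi * (\<xi> \<bullet> x))) \<in> borel_measurable lborel" using cism by measurable
    show "(\<lambda>\<xi>. fourier f \<xi> * cis (2 * pi * (\<xi> \<bullet> x)) * of_real (?G (?c n) \<xi>)) \<in> borel_measurable lborel" for n using cism by measurable
  qed (use ff in auto)
  moreover have "(\<lambda>n. \<integral>v. f (x + ?c n *\<^sub>R v) * of_real (?P v) \<partial>lborel) \<longlonglongrightarrow> (\<integral>v. f x * of_real (?P v) \<partial>lborel)"
  proof (rule integral_dominated_convergence[where w = "\<lambda>v. B * ?P v"])
    show "AE v in lborel. (\<lambda>n. f (x + ?c n *\<^sub>R v) * of_real (?P v)) \<longlonglongrightarrow> f x * of_real (?P v)"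
    proof (rule AE_I2)
      fix v
      have "(\<lambda>n. x + ?c n *\<^sub>R v) \<longlonglongrightarrow> x + 0 *\<^sub>R v" by (intro tendsto_intros c0)
      then have "(\<lambda>n. f (x + ?c n *\<^sub>R v)) \<longlonglongrightarrow> f x"
        using cont by (intro isCont_tendsto_compose[where g = f]) (auto simp: continuous_on_eq_continuous_at)
      then show "(\<lambda>n. f (x + ?c n *\<^sub>R v) * of_real (?P v)) \<longlonglongrightarrow> f x * of_real (?P v)" by (rule tendsto_mult_right)
    qed
    show "AE v in lborel. norm (f (x + ?c n *\<^sub>R v) * of_real (?P v)) \<le> B * ?P v" for n
      using B P0 by (intro AE_I2) (simp only: norm_mult norm_of_real abs_of_nonneg mult_right_mono)
    show "integrable lborel (\<lambda>v. B * ?P v)" using Pint by (rule integrable_mult_right)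
  qed auto
  moreover have "(\<integral>v. f x * of_real (?P v) \<partial>lborel) = f x"
    unfolding integral_mult_right_zero integral_complex_of_real P1 by simp
  ultimately show ?thesis unfolding main[OF cpos] by (metis (no_types, lifting) LIMSEQ_unique)
qed

lemma partial_fourier_tensor: "partial_fourier (\<lambda>_. 1) (\<lambda>(x, t). g x * f t) (x, \<xi>) = g x * fourier f \<xi>"
  unfolding partial_fourier_def fourier_def integral_mult_right_zero[symmetric] by (simp add: mult.assoc)

text \<open>At a point with \<open>f x \<noteq> 0\<close>, the slice of the partial transform of the
  tensor square of \<open>f\<close> is a nonzero multiple of \<open>fourier f\<close>. So the
  mapping property of the partial transform covers the full one.\<close>

lemma schwartz_fourier:
  fixes f :: "'a::euclidean_space \<Rightarrow> complex"
  assumes f: "f \<in> schwartz" shows "fourier f \<in> schwartz"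
proof (cases "\<exists>x. f x \<noteq> 0")
  case True
  then obtain x where x: "f x \<noteq> 0" by auto
  have "(\<lambda>\<xi>. (1 / f x) * partial_fourier (\<lambda>_. 1) (\<lambda>(x, t). f x * f t) (x, \<xi>)) \<in> schwartz"
    by (intro schwartz_cmult schwartz_slice schwartz_partial_fourier schwartz_tensor f)
  then show ?thesis using x by (simp add: partial_fourier_tensor)
next
  case False
  then show ?thesis by (simp add: fourier_def[abs_def] schwartz_0)
qed

lemma schwartz_fourier_inversion:
  fixes f :: "'a::euclidean_space \<Rightarrow> complex"
  assumes f: "f \<in> schwartz"
  shows "(\<integral>\<xi>. fourier f \<xi> * cis (2 * pi * (\<xi> \<bullet> x)) \<partial>lborel) = f x"
proof -
  obtain B where "\<And>x. (1 + norm x) ^ 0 * norm (f x) \<le> B" using schwartz_decay[OF f] by blast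
  then show ?thesis
    by (intro fourier_inversion[where B = B] schwartz_continuous schwartz_integrable schwartz_fourier f) simp
qed

section \<open>Tempered distributions under the integral sign\<close>

lemma linear_inj_bound:
  fixes L :: "'a::euclidean_space \<Rightarrow> 'b::euclidean_space"
  assumes "linear L" "inj L" obtains \<kappa> where "\<And>x. norm x \<le> \<kappa> * norm (L x)"
proof -
  obtain B where B: "B > 0" "\<And>x. B * norm x \<le> norm (L x)"
    using linear_inj_bounded_below_pos[OF assms] by metis
  have "norm x \<le> (1 / B) * norm (L x)" for x using B(1) B(2)[of x] by (simp add: field_simps)
  then show ?thesis using that by blast
qed

lemma schwartz_affine_inj:
  fixes L :: "'a::euclidean_space \<Rightarrow> 'b::euclidean_space"
  assumes "f \<in> schwartz" "linear L" "inj L"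
  shows "(\<lambda>x. f (L x + a)) \<in> schwartz"
proof -
  obtain \<kappa> where "\<And>x. norm x \<le> \<kappa> * norm (L x)" by (rule linear_inj_bound[OF assms(2,3)]) blast
  then show ?thesis using assms by (intro schwartz_affine[where \<kappa> = \<kappa>]) (auto simp: linear_conv_bounded_linear)
qed

lemma schwartz_linear_inj:
  fixes L :: "'a::euclidean_space \<Rightarrow> 'b::euclidean_space"
  assumes "f \<in> schwartz" "linear L" "inj L"
  shows "(\<lambda>x. f (L x)) \<in> schwartz"
  using schwartz_affine_inj[OF assms, of 0] by simp

lemma tempered_lincomb:
  "u \<in> tempered \<Longrightarrow> f \<in> schwartz \<Longrightarrow> g \<in> schwartz \<Longrightarrow> u (\<lambda>x. a * f x + b * g x) = cnj a * u f + cnj b * u g"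
  unfolding tempered_def by blast

lemma tempered_cmult: "u \<in> tempered \<Longrightarrow> f \<in> schwartz \<Longrightarrow> u (\<lambda>x. a * f x) = cnj a * u f"
  using tempered_lincomb[of u f f a 0] by simp

lemma tempered_zero: "u \<in> tempered \<Longrightarrow> u (\<lambda>x. 0) = 0"
  using tempered_cmult[of u "\<lambda>x. 0" 0] schwartz_0 by simp

lemma tempered_diff: "u \<in> tempered \<Longrightarrow> f \<in> schwartz \<Longrightarrow> g \<in> schwartz \<Longrightarrow> u (\<lambda>x. f x - g x) = u f - u g"
  using tempered_lincomb[of u f g 1 "-1"] by simp

lemma schwartz_sum: "(\<And>y. y \<in> Y \<Longrightarrow> F y \<in> schwartz) \<Longrightarrow> (\<lambda>x. \<Sum>y\<in>Y. c y * F y x) \<in> schwartz"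
  unfolding schwartz_iff_sbounded by (intro single.sbounded_sum single.sbounded_cmult)

lemma tempered_sum:
  assumes "finite Y" "u \<in> tempered" "\<And>y. y \<in> Y \<Longrightarrow> F y \<in> schwartz"
  shows "u (\<lambda>x. \<Sum>y\<in>Y. c y * F y x) = (\<Sum>y\<in>Y. cnj (c y) * u (F y))"
  using assms(1,3)
proof (induction Y rule: finite_induct)
  case empty then show ?case using tempered_zero[OF assms(2)] by simp
next
  case (insert y Y)
  have "(\<lambda>x. \<Sum>y\<in>Y. c y * F y x) \<in> schwartz" using insert by (intro schwartz_sum) auto
  from tempered_lincomb[OF assms(2) insert.prems[of y] this, of "c y" 1] insert
  show ?case by simp
qed

lemma tempered_bound:
  assumes "u \<in> tempered"
  obtains N C where "0 \<le> C" "\<And>f. f \<in> schwartz \<Longrightarrow> norm (u f) \<le> C * schwartz_norm N f"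
proof -
  obtain N C where C: "\<forall>f\<in>schwartz. norm (u f) \<le> C * schwartz_norm N f"
    using assms unfolding tempered_def by auto
  have "norm (u f) \<le> max C 0 * schwartz_norm N f" if "f \<in> schwartz" for f
  proof -
    have "C * schwartz_norm N f \<le> max C 0 * schwartz_norm N f"
      by (intro mult_right_mono schwartz_norm_nonneg that) auto
    then show ?thesis using C that by fastforce
  qed
  then show ?thesis using that[of "max C 0" N] by auto
qed

lemma iterated_deriv_lincomb:
  fixes f g :: "'a::euclidean_space \<Rightarrow> complex"
  assumes "f \<in> schwartz" "g \<in> schwartz"
  shows "iterated_deriv vs (\<lambda>x. a * f x + b * g x) = (\<lambda>x. a * iterated_deriv vs f x + b * iterated_deriv vs g x)"
proof (induction vs)
  case (Cons v vs)
  let ?f = "iterated_deriv vs f" and ?g = "iterated_deriv vs g"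
  have "((\<lambda>x. a * ?f x + b * ?g x) has_derivative (\<lambda>h. a * dir_deriv h ?f x + b * dir_deriv h ?g x)) (at x)" for x
    by (intro has_derivative_add has_derivative_mult_right schwartz_has_derivative schwartz_iterated_deriv assms)
  then have "dir_deriv v (\<lambda>x. a * ?f x + b * ?g x) = (\<lambda>x. a * dir_deriv v ?f x + b * dir_deriv v ?g x)"
    by (intro ext dir_deriv_eq)
  then show ?case by (simp only: iterated_deriv_Cons_dir_deriv Cons.IH)
qed simp

lemma iterated_deriv_sum:
  fixes F :: "'y \<Rightarrow> 'a::euclidean_space \<Rightarrow> complex"
  assumes "finite Y" "\<And>y. F y \<in> schwartz"
  shows "iterated_deriv vs (\<lambda>x. \<Sum>y\<in>Y. c y * F y x) = (\<lambda>x. \<Sum>y\<in>Y. c y * iterated_deriv vs (F y) x)"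
  using assms(1)
proof (induction Y rule: finite_induct)
  case empty
  \<comment> \<open>The empty sum is treated as a combination with both coefficients zero; the index
    of the functions is arbitrary.\<close>
  show ?case using iterated_deriv_lincomb[OF assms(2) assms(2), of vs 0 undefined 0 undefined] by simp
next
  case (insert y Y)
  have "(\<lambda>x. \<Sum>y\<in>Y. c y * F y x) \<in> schwartz" by (intro schwartz_sum assms)
  from iterated_deriv_lincomb[OF assms(2)[of y] this, of vs "c y" 1] insert
  show ?case by simp
qed

lemma schwartz_norm_triangle:
  assumes "f \<in> schwartz" "g \<in> schwartz"
  shows "schwartz_norm N (\<lambda>x. f x - g x) \<le> schwartz_norm N f + schwartz_norm N g"
proof (rule schwartz_norm_le)
  fix vs :: "'a list" and x assume vs: "vs \<in> lists Basis" "length vs \<le> N"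
  have "iterated_deriv vs (\<lambda>x. f x - g x) x = iterated_deriv vs f x - iterated_deriv vs g x"
    using fun_cong[OF iterated_deriv_lincomb[OF assms, of vs 1 "-1"], of x] by simp
  then have "(1 + norm x) ^ N * norm (iterated_deriv vs (\<lambda>x. f x - g x) x)
     \<le> (1 + norm x) ^ N * (norm (iterated_deriv vs f x) + norm (iterated_deriv vs g x))"
    by (intro mult_left_mono) (auto intro: norm_triangle_ineq4)
  also have "\<dots> \<le> schwartz_norm N f + schwartz_norm N g"
    unfolding distrib_left by (intro add_mono schwartz_norm_ge assms vs)
  finally show "(1 + norm x) ^ N * norm (iterated_deriv vs (\<lambda>x. f x - g x) x) \<le> schwartz_norm N f + schwartz_norm N g" .
qed

text \<open>The scale is instantiated with a weight in \<open>p\<close> that ignores the index.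
  Joint decay of order \<open>n + k\<close> splits into order \<open>n\<close> in \<open>x\<close>
  and order \<open>k\<close> in \<open>p\<close>.\<close>

lemma slice_norm_decay:
  fixes H :: "'p::euclidean_space \<times> 'a::euclidean_space \<Rightarrow> complex"
  assumes H: "H \<in> schwartz"
  obtains C where "0 \<le> C" "\<And>p. schwartz_norm N (\<lambda>x. H (p, x)) \<le> C * (1 / (1 + norm p) ^ k)"
proof -
  interpret s: seminorm_scale "UNIV :: 'p set" "\<lambda>_ p. 1 / (1 + norm p) ^ k"
    by unfold_locales auto
  have "s.sbounded (\<lambda>p x. H (p, x))"
    unfolding s.sbounded_def
  proof (intro ballI conjI allI)
    fix vs :: "'a list" assume "vs \<in> lists Basis"
    let ?G = "iterated_deriv (map (Pair 0) vs) H"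
    have G: "?G \<in> schwartz" by (rule schwartz_iterated_deriv[OF H])
    show "iterated_deriv vs (\<lambda>x. H (p, x)) differentiable at x" for p x
      using schwartz_has_derivative[OF schwartz_iterated_deriv[OF schwartz_slice[OF H]]]
      by (rule differentiableI)
    show "s.fam_bounded (\<lambda>p x. (1 + norm x) ^ n * norm (iterated_deriv vs (\<lambda>x. H (p, x)) x))" for n
    proof -
      obtain C where C: "0 \<le> C" "\<And>z. (1 + norm z) ^ (n + k) * norm (?G z) \<le> C" using schwartz_decay[OF G] by blast
      show ?thesis
      proof (rule s.fam_boundedI[OF _ C(1)])
        fix p x
        have "((1 + norm x) ^ n * norm (?G (p, x))) * (1 + norm p) ^ k
          = ((1 + norm x) ^ n * (1 + norm p) ^ k) * norm (?G (p, x))" by simp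
        also have "\<dots> \<le> ((1 + norm (p, x)) ^ n * (1 + norm (p, x)) ^ k) * norm (?G (p, x))"
          by (intro mult_right_mono mult_mono norm_fst_weight norm_snd_weight) auto
        also have "\<dots> \<le> C" using C(2)[of "(p, x)"] by (simp add: power_add)
        finally show "(1 + norm x) ^ n * norm (iterated_deriv vs (\<lambda>x. H (p, x)) x) \<le> C * (1 / (1 + norm p) ^ k)"
          by (simp add: iterated_deriv_slice[OF H] pos_le_divide_eq add_pos_nonneg)
      qed
    qed
  qed
  from s.sbounded_norm_le[OF this, of N] show ?thesis using that by blast
qed

text \<open>The parameter is now a pair of points and the weight is their distance. The mean value
  inequality in \<open>p\<close> bounds the difference of two slices by derivatives of
  \<open>H\<close> in the first variable.\<close>

lemma slice_norm_lipschitz: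
  fixes H :: "'p::euclidean_space \<times> 'a::euclidean_space \<Rightarrow> complex"
  assumes H: "H \<in> schwartz"
  obtains C where "0 \<le> C" "\<And>p p'. schwartz_norm N (\<lambda>x. H (p, x) - H (p', x)) \<le> C * norm (p - p')"
proof -
  interpret s: seminorm_scale "UNIV :: ('p \<times> 'p) set" "\<lambda>_ q. norm (fst q - snd q)"
    by unfold_locales auto
  have "s.sbounded (\<lambda>q x. H (fst q, x) - H (snd q, x))"
    unfolding s.sbounded_def
  proof (intro ballI conjI allI)
    fix vs :: "'a list" assume "vs \<in> lists Basis"
    let ?G = "iterated_deriv (map (Pair 0) vs) H"
    have G: "?G \<in> schwartz" by (rule schwartz_iterated_deriv[OF H])
    have S: "(\<lambda>x. H (p, x) - H (p', x)) \<in> schwartz" for p p'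
      using schwartz_lincomb[OF schwartz_slice[OF H, of p] schwartz_slice[OF H, of p'], of 1 "-1"] by simp
    show "iterated_deriv vs (\<lambda>x. H (fst q, x) - H (snd q, x)) differentiable at x" for q x
      using schwartz_has_derivative[OF schwartz_iterated_deriv[OF S]] by (rule differentiableI)
    have e: "iterated_deriv vs (\<lambda>x. H (p, x) - H (p', x)) x = ?G (p, x) - ?G (p', x)" for p p' x
      using fun_cong[OF iterated_deriv_lincomb[OF schwartz_slice[OF H, of p] schwartz_slice[OF H, of p'], of vs 1 "-1"], of x]
      by (simp add: iterated_deriv_slice[OF H])
    show "s.fam_bounded (\<lambda>q x. (1 + norm x) ^ n * norm (iterated_deriv vs (\<lambda>x. H (fst q, x) - H (snd q, x)) x))" for n
    proof -
      obtain C where C: "0 \<le> C" "\<And>z v. (1 + norm z) ^ n * norm (dir_deriv v ?G z) \<le> C * norm v" using schwartz_dir_deriv_decay[OF G] by blast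
      show ?thesis
      proof (rule s.fam_boundedI[OF _ C(1)])
        fix q :: "'p \<times> 'p" and x :: 'a
        have pos: "0 < (1 + norm x) ^ n" by (simp add: add_pos_nonneg)
        have "norm (?G (fst q, x) - ?G (snd q, x)) \<le> C / (1 + norm x) ^ n * norm (fst q - snd q)"
        proof (rule differentiable_bound[where S = UNIV])
          fix p :: 'p
          have "((\<lambda>p. (p, x)) has_derivative (\<lambda>h. (h, 0))) (at p)" by (auto intro!: derivative_eq_intros)
          from has_derivative_compose[OF this schwartz_has_derivative[OF G, of "(p, x)"]]
          show "((\<lambda>p. ?G (p, x)) has_derivative (\<lambda>h. dir_deriv (h, 0) ?G (p, x))) (at p within UNIV)" by simp
          show "onorm (\<lambda>h. dir_deriv (h, 0) ?G (p, x)) \<le> C / (1 + norm x) ^ n"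
          proof (rule onorm_bound)
            fix h
            have "(1 + norm x) ^ n * norm (dir_deriv (h, 0) ?G (p, x)) \<le> (1 + norm (p, x)) ^ n * norm (dir_deriv (h, 0) ?G (p, x))"
              by (intro mult_right_mono norm_snd_weight) auto
            also have "\<dots> \<le> C * norm (h, 0::'a)" by (rule C)
            finally show "norm (dir_deriv (h, 0) ?G (p, x)) \<le> C / (1 + norm x) ^ n * norm h"
              using pos by (simp add: norm_Pair pos_le_divide_eq mult_ac)
          qed (use C pos in simp)
        qed auto
        then show "(1 + norm x) ^ n * norm (iterated_deriv vs (\<lambda>x. H (fst q, x) - H (snd q, x)) x) \<le> C * norm (fst q - snd q)"
          using pos by (simp add: e pos_le_divide_eq mult_ac)
      qed
    qed
  qed
  from s.sbounded_norm_le[OF this, of N] obtain C where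
    "0 \<le> C" "\<forall>q\<in>UNIV. schwartz_norm N (\<lambda>x. H (fst q, x) - H (snd q, x)) \<le> C * norm (fst q - snd q)" by blast
  then show ?thesis using that[of C] by (metis UNIV_I fst_conv snd_conv)
qed

lemma tempered_slice_continuous:
  assumes u: "u \<in> tempered" and H: "H \<in> schwartz"
  shows "continuous_on UNIV (\<lambda>p. u (\<lambda>x. H (p, x)))"
proof -
  obtain N C where C: "0 \<le> C" "\<And>f. f \<in> schwartz \<Longrightarrow> norm (u f) \<le> C * schwartz_norm N f"
    using tempered_bound[OF u] by metis
  obtain C' where C': "0 \<le> C'" "\<And>p p'. schwartz_norm N (\<lambda>x. H (p, x) - H (p', x)) \<le> C' * norm (p - p')"
    by (rule slice_norm_lipschitz[OF H]) blast
  have "(C * C')-lipschitz_on UNIV (\<lambda>p. u (\<lambda>x. H (p, x)))"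
  proof (rule lipschitz_onI)
    fix p p'
    have S: "(\<lambda>x. H (p, x) - H (p', x)) \<in> schwartz"
      using schwartz_lincomb[OF schwartz_slice[OF H, of p] schwartz_slice[OF H, of p'], of 1 "-1"] by simp
    have "norm (u (\<lambda>x. H (p, x)) - u (\<lambda>x. H (p', x))) \<le> C * schwartz_norm N (\<lambda>x. H (p, x) - H (p', x))"
      using C(2)[OF S] by (simp add: tempered_diff[OF u schwartz_slice[OF H] schwartz_slice[OF H]])
    also have "\<dots> \<le> C * (C' * norm (p - p'))" by (intro mult_left_mono C C')
    finally show "dist (u (\<lambda>x. H (p, x))) (u (\<lambda>x. H (p', x))) \<le> C * C' * dist p p'" by (simp add: dist_norm)
  qed (use C C' in auto)
  then show ?thesis by (rule lipschitz_on_continuous_on)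
qed

text \<open>The integral is approximated by finite sums, in the norm that controls the distribution.\<close>

theorem tempered_param_integral:
  fixes H :: "'p::euclidean_space \<times> 'a::euclidean_space \<Rightarrow> complex"
  assumes u: "u \<in> tempered" and H: "H \<in> schwartz"
    and b: "b \<in> borel_measurable borel" "\<And>t. norm (b t) \<le> K * (1 + norm t) ^ m"
  shows "u (param_integral b H) = (\<integral>p. cnj (b p) * u (\<lambda>x. H (p, x)) \<partial>lborel)"
proof -
  \<comment> \<open>\<open>m\<close> powers compensate the growth of \<open>b\<close>, the others
    give integrability.\<close>
  define k where "k = m + 2 * DIM('p)"
  obtain N C0 where C0: "0 \<le> C0" "\<And>f. f \<in> schwartz \<Longrightarrow> norm (u f) \<le> C0 * schwartz_norm N f"
    using tempered_bound[OF u] by metis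
  obtain C1 where C1: "0 \<le> C1" "\<And>p. schwartz_norm N (\<lambda>x. H (p, x)) \<le> C1 * (1 / (1 + norm p) ^ k)"
    by (rule slice_norm_decay[OF H]) blast
  obtain C2 where C2: "0 \<le> C2" "\<And>p p'. schwartz_norm N (\<lambda>x. H (p, x) - H (p', x)) \<le> C2 * norm (p - p')"
    by (rule slice_norm_lipschitz[OF H]) blast
  \<comment> \<open>The error is at most the norm of the slice at the node plus that of the slice at
    \<open>p\<close>; the decay bound at the node exceeds the one at \<open>p\<close> by a factor of
    at most \<open>2 ^ k\<close>.\<close>
  define C3 where "C3 = C1 * 2 ^ k + C1"
  have C13: "C1 \<le> C3" and C3: "0 \<le> C3" using C1 by (auto simp: C3_def)
  note Hs = schwartz_slice[OF H]
  have Hdiff: "(\<lambda>x. H (p, x) - H (p', x)) \<in> schwartz" for p p'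
    using schwartz_lincomb[OF Hs[of p] Hs[of p'], of 1 "-1"] by simp
  have "(\<lambda>p::'p. p) \<in> borel_measurable lborel" by simp
  \<comment> \<open>Simple functions converging to the identity provide the finitely many nodes of
    each approximating sum.\<close>
  from borel_measurable_implies_sequence_metric[OF this, of 0] obtain s where
    s: "\<And>i. simple_function lborel (s i)" and sl: "\<And>x. (\<lambda>i. s i x) \<longlonglongrightarrow> (x::'p)" by auto
  have sm [measurable]: "s i \<in> borel_measurable borel" for i
    using borel_measurable_simple_function[OF s, of i] by simp
  have fin: "finite (range (s i))" for i using s[of i] by (simp add: simple_function_def)
  \<comment> \<open>On this set \<open>b\<close> is integrable and the node lies within distance 1
    of \<open>p\<close>, so that the weights at both points are comparable. Every point belongs to
    it eventually.\<close>
  define A where "A = (\<lambda>i. {p::'p. norm p \<le> real i \<and> dist (s i p) p \<le> 1})"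
  have Am [measurable]: "A i \<in> sets borel" for i unfolding A_def by measurable
  have bm [measurable]: "b \<in> borel_measurable borel" by (rule b)
  have Aint: "integrable lborel (\<lambda>p. b p * indicator B p)" if [measurable]: "B \<in> sets borel" and "B \<subseteq> A i" for B i
  proof (rule mult_integrable_decay(1)[OF b])
    show "(1 + norm p) ^ (m + 2 * DIM('p)) * norm (indicator B p :: complex) \<le> (1 + real i) ^ (m + 2 * DIM('p))" for p
      using that(2) by (auto simp: indicator_def A_def intro!: power_mono)
  qed measurable
  have evA: "\<forall>\<^sub>F i in sequentially. p \<in> A i" for p
  proof -
    have "\<forall>\<^sub>F i in sequentially. dist (s i p) p < 1" using sl by (rule tendstoD) simp
    moreover have "\<forall>\<^sub>F i in sequentially. norm p \<le> real i"
      by (meson eventually_sequentiallyI nat_ceiling_le_eq)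
    ultimately show ?thesis by eventually_elim (simp add: A_def)
  qed
  define E where "E = (\<lambda>i y. {p \<in> A i. s i p = y})"
  have Em [measurable]: "E i y \<in> sets borel" for i y unfolding E_def by measurable
  \<comment> \<open>The coefficient of a node is the integral of \<open>b\<close> over the cell that
    is mapped to it.\<close>
  define c where "c = (\<lambda>i y. \<integral>p. b p * indicator (E i y) p \<partial>lborel)"
  have simple: "(\<Sum>y\<in>range (s i). c i y * g y) = (\<integral>p. b p * (indicator (A i) p * g (s i p)) \<partial>lborel)"
    for i and g :: "'p \<Rightarrow> complex"
  proof -
    have "b p * (indicator (A i) p * g (s i p)) = (\<Sum>y\<in>range (s i). b p * indicator (E i y) p * g y)" for p
    proof -
      have "(\<Sum>y\<in>range (s i). b p * indicator (E i y) p * g y) = (\<Sum>y\<in>range (s i). if s i p = y then b p * indicator (A i) p * g y else 0)"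
        by (intro sum.cong refl) (auto simp: E_def indicator_def)
      also have "\<dots> = b p * indicator (A i) p * g (s i p)" using fin by (subst sum.delta') auto
      finally show ?thesis by (simp add: mult.assoc)
    qed
    then have "(\<integral>p. b p * (indicator (A i) p * g (s i p)) \<partial>lborel) = (\<integral>p. (\<Sum>y\<in>range (s i). b p * indicator (E i y) p * g y) \<partial>lborel)"
      by simp
    also have "\<dots> = (\<Sum>y\<in>range (s i). \<integral>p. b p * indicator (E i y) p * g y \<partial>lborel)"
      by (intro Bochner_Integration.integral_sum integrable_mult_left Aint[where i = i]) (auto simp: E_def)
    finally show ?thesis by (simp add: c_def)
  qed
  \<comment> \<open>The conjugated coefficients are those that appear once the antilinear functional
    \<open>u\<close> is applied.\<close>
  have simple': "(\<Sum>y\<in>range (s i). cnj (c i y) * g y) = (\<integral>p. cnj (b p) * (indicator (A i) p * g (s i p)) \<partial>lborel)"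
    for i and g :: "'p \<Rightarrow> complex"
  proof -
    have "cnj (\<Sum>y\<in>range (s i). c i y * cnj (g y)) = cnj (\<integral>p. b p * (indicator (A i) p * cnj (g (s i p))) \<partial>lborel)"
      using simple[of i "\<lambda>y. cnj (g y)"] by simp
    also have "\<dots> = (\<integral>p. cnj (b p * (indicator (A i) p * cnj (g (s i p)))) \<partial>lborel)" by (rule Bochner_Integration.integral_cnj[symmetric])
    also have "\<dots> = (\<integral>p. cnj (b p) * (indicator (A i) p * g (s i p)) \<partial>lborel)"
      by (intro Bochner_Integration.integral_cong refl) (simp add: indicator_def)
    finally show ?thesis by simp
  qed
  define R where "R = (\<lambda>i x. \<Sum>y\<in>range (s i). c i y * H (y, x))"
  have RS: "R i \<in> schwartz" for i unfolding R_def by (intro schwartz_sum Hs)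
  have PS: "param_integral b H \<in> schwartz" by (rule schwartz_param_integral[OF H b])
  have uR: "u (R i) = (\<integral>p. cnj (b p) * (indicator (A i) p * u (\<lambda>x. H (s i p, x))) \<partial>lborel)" for i
    unfolding R_def by (rule trans[OF tempered_sum[OF fin u Hs] simple'])
  \<comment> \<open>Majorant of the error at \<open>p\<close>. On \<open>A i\<close> the Lipschitz
    estimate gives convergence and the decay estimate a dominating function; off \<open>A i\<close>
    the node is discarded, and the error is the slice itself.\<close>
  define \<delta> where "\<delta> = (\<lambda>i p. if p \<in> A i then min (C2 * dist (s i p) p) (C3 * (1 / (1 + norm p) ^ k)) else C1 * (1 / (1 + norm p) ^ k))"
  have \<delta>m [measurable]: "\<delta> i \<in> borel_measurable borel" for i unfolding \<delta>_def by measurable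
  have \<delta>0: "0 \<le> \<delta> i p" for i p using C1 C2 C3 by (auto simp: \<delta>_def)
  have \<delta>le: "\<delta> i p \<le> C3 * (1 / (1 + norm p) ^ k)" for i p
    using C13 by (auto simp: \<delta>_def divide_right_mono)
  have near: "1 / (1 + norm (s i p)) ^ k \<le> 2 ^ k * (1 / (1 + norm p) ^ k)" if "p \<in> A i" for i p
  proof -
    have "1 + norm p \<le> (1 + norm (s i p)) * (1 + norm (p - s i p))" using norm_1_triangle[of "s i p" "p - s i p"] by simp
    also have "\<dots> \<le> (1 + norm (s i p)) * 2" using that by (intro mult_left_mono) (auto simp: A_def dist_norm norm_minus_commute)
    finally have "(1 + norm p) ^ k \<le> ((1 + norm (s i p)) * 2) ^ k" by (intro power_mono) auto
    then have "(1 + norm p) ^ k \<le> (1 + norm (s i p)) ^ k * 2 ^ k" by (simp only: power_mult_distrib)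
    then show ?thesis by (simp add: field_simps add_pos_nonneg)
  qed
  have slice_le: "norm (u (\<lambda>x. H (p, x))) \<le> C0 * (C1 * (1 / (1 + norm p) ^ k))" for p
    by (rule order_trans[OF C0(2)[OF Hs] mult_left_mono[OF C1(2) C0(1)]])
  have key: "(1 + norm x) ^ N * norm (indicator (A i) p * iterated_deriv (map (Pair 0) vs) H (s i p, x) - iterated_deriv (map (Pair 0) vs) H (p, x)) \<le> \<delta> i p"
    if vs: "vs \<in> lists Basis" "length vs \<le> N" for i p x vs
  proof (cases "p \<in> A i")
    case True
    have "iterated_deriv (map (Pair 0) vs) H (s i p, x) - iterated_deriv (map (Pair 0) vs) H (p, x)
        = iterated_deriv vs (\<lambda>x. H (s i p, x) - H (p, x)) x"
      using fun_cong[OF iterated_deriv_lincomb[OF Hs[of "s i p"] Hs[of p], of vs 1 "-1"], of x]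
      by (simp add: iterated_deriv_slice[OF H])
    then have "(1 + norm x) ^ N * norm (indicator (A i) p * iterated_deriv (map (Pair 0) vs) H (s i p, x) - iterated_deriv (map (Pair 0) vs) H (p, x))
       \<le> schwartz_norm N (\<lambda>x. H (s i p, x) - H (p, x))"
      using schwartz_norm_ge[OF Hdiff vs] True by simp
    moreover have "schwartz_norm N (\<lambda>x. H (s i p, x) - H (p, x)) \<le> C2 * dist (s i p) p"
      using C2 by (simp add: dist_norm)
    moreover have "schwartz_norm N (\<lambda>x. H (s i p, x) - H (p, x)) \<le> C3 * (1 / (1 + norm p) ^ k)"
    proof -
      have "schwartz_norm N (\<lambda>x. H (s i p, x) - H (p, x)) \<le> C1 * (1 / (1 + norm (s i p)) ^ k) + C1 * (1 / (1 + norm p) ^ k)"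
        by (rule order_trans[OF schwartz_norm_triangle[OF Hs Hs] add_mono[OF C1(2) C1(2)]])
      also have "\<dots> \<le> C1 * (2 ^ k * (1 / (1 + norm p) ^ k)) + C1 * (1 / (1 + norm p) ^ k)"
        by (intro add_right_mono mult_left_mono near True C1)
      finally show ?thesis by (simp add: C3_def algebra_simps add_divide_distrib)
    qed
    ultimately show ?thesis using True by (simp add: \<delta>_def)
  next
    case False
    have "(1 + norm x) ^ N * norm (iterated_deriv (map (Pair 0) vs) H (p, x)) \<le> schwartz_norm N (\<lambda>x. H (p, x))"
      using schwartz_norm_ge[OF Hs vs, of x p] by (simp add: iterated_deriv_slice[OF H])
    also have "\<dots> \<le> C1 * (1 / (1 + norm p) ^ k)" by (rule C1)
    finally show ?thesis using False by (simp add: \<delta>_def)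
  qed
  have K: "0 \<le> K" using order_trans[OF norm_ge_zero b(2)[of 0]] by simp
  have dom: "norm (b p) * (C * (1 / (1 + norm p) ^ k)) \<le> (K * C) * (1 / (1 + norm p) ^ (2 * DIM('p)))" if "0 \<le> C" for C p
  proof -
    have "norm (b p) * (C * (1 / (1 + norm p) ^ k)) \<le> (K * (1 + norm p) ^ m) * (C * (1 / (1 + norm p) ^ k))"
      by (intro mult_right_mono b) (use that in simp)
    also have "\<dots> = (K * C) * (1 / (1 + norm p) ^ (2 * DIM('p)))"
      by (simp add: k_def power_add field_simps add_pos_nonneg)
    finally show ?thesis .
  qed
  have dint: "integrable lborel (\<lambda>p::'p. (K * C) * (1 / (1 + norm p) ^ (2 * DIM('p))))" for C
    by (intro integrable_mult_right integrable_weight) simp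
  have \<delta>int: "integrable lborel (\<lambda>p. norm (b p) * \<delta> i p)" for i
  proof (rule Bochner_Integration.integrable_bound[OF dint[of C3]])
    show "AE p in lborel. norm (norm (b p) * \<delta> i p) \<le> norm ((K * C3) * (1 / (1 + norm p) ^ (2 * DIM('p))))"
    proof (rule AE_I2)
      fix p
      have "norm (b p) * \<delta> i p \<le> norm (b p) * (C3 * (1 / (1 + norm p) ^ k))" by (intro mult_left_mono \<delta>le) simp
      also have "\<dots> \<le> (K * C3) * (1 / (1 + norm p) ^ (2 * DIM('p)))" by (rule dom[OF C3])
      finally show "norm (norm (b p) * \<delta> i p) \<le> norm ((K * C3) * (1 / (1 + norm p) ^ (2 * DIM('p))))"
        using \<delta>0[of i p] K C3 by (simp add: abs_mult)
    qed
  qed measurable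
  have \<delta>lim: "(\<lambda>i. \<integral>p. norm (b p) * \<delta> i p \<partial>lborel) \<longlonglongrightarrow> 0"
  proof -
    have "(\<lambda>i. \<integral>p. norm (b p) * \<delta> i p \<partial>lborel) \<longlonglongrightarrow> (\<integral>p. 0 \<partial>(lborel :: 'p measure))"
    proof (rule integral_dominated_convergence[where w = "\<lambda>p. (K * C3) * (1 / (1 + norm p) ^ (2 * DIM('p)))"])
      show "integrable lborel (\<lambda>p::'p. (K * C3) * (1 / (1 + norm p) ^ (2 * DIM('p))))" by (rule dint)
      show "AE p in lborel. (\<lambda>i. norm (b p) * \<delta> i p) \<longlonglongrightarrow> 0"
      proof (rule AE_I2)
        fix p
        have d0: "(\<lambda>i. C2 * dist (s i p) p) \<longlonglongrightarrow> 0"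
          by (rule tendsto_mult_right_zero[OF tendsto_dist_iff[THEN iffD1, OF sl]])
        have "(\<lambda>i. \<delta> i p) \<longlonglongrightarrow> 0"
        proof (rule tendsto_sandwich[OF _ _ tendsto_const])
          show "\<forall>\<^sub>F i in sequentially. 0 \<le> \<delta> i p" using \<delta>0 by simp
          show "\<forall>\<^sub>F i in sequentially. \<delta> i p \<le> C2 * dist (s i p) p"
            using evA[of p] by eventually_elim (simp add: \<delta>_def)
          show "(\<lambda>i. C2 * dist (s i p) p) \<longlonglongrightarrow> 0" by (rule d0)
        qed
        then show "(\<lambda>i. norm (b p) * \<delta> i p) \<longlonglongrightarrow> 0" by (rule tendsto_mult_right_zero)
      qed
      show "AE p in lborel. norm (norm (b p) * \<delta> i p) \<le> (K * C3) * (1 / (1 + norm p) ^ (2 * DIM('p)))" for i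
      proof (rule AE_I2)
        fix p
        have "norm (b p) * \<delta> i p \<le> norm (b p) * (C3 * (1 / (1 + norm p) ^ k))" by (intro mult_left_mono \<delta>le) simp
        also have "\<dots> \<le> (K * C3) * (1 / (1 + norm p) ^ (2 * DIM('p)))" by (rule dom[OF C3])
        finally show "norm (norm (b p) * \<delta> i p) \<le> (K * C3) * (1 / (1 + norm p) ^ (2 * DIM('p)))"
          using \<delta>0[of i p] by (simp add: abs_mult)
      qed
    qed auto
    then show ?thesis by simp
  qed
  have RP: "schwartz_norm N (\<lambda>x. R i x - param_integral b H x) \<le> (\<integral>p. norm (b p) * \<delta> i p \<partial>lborel)" for i
  proof (rule schwartz_norm_le)
    fix vs :: "'a list" and x assume vs: "vs \<in> lists Basis" "length vs \<le> N"
    let ?G = "iterated_deriv (map (Pair 0) vs) H"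
    have G: "?G \<in> schwartz" by (rule schwartz_iterated_deriv[OF H])
    have Gm: "(\<lambda>p. ?G (p, x)) \<in> borel_measurable borel" by (rule schwartz_measurable[OF schwartz_slice'[OF G]])
    let ?d = "\<lambda>p. b p * (indicator (A i) p * ?G (s i p, x) - ?G (p, x))"
    have i1: "integrable lborel (\<lambda>p. b p * (indicator (A i) p * ?G (s i p, x)))"
    proof -
      obtain C where C: "\<And>p. (1 + norm p) ^ 0 * norm (?G (p, x)) \<le> C"
        using schwartz_decay[OF schwartz_slice'[OF G, of x], of 0] by blast
      have C': "norm (?G (p, x)) \<le> \<bar>C\<bar>" for p using C[of p] by simp
      show ?thesis
      proof (rule Bochner_Integration.integrable_bound[OF integrable_mult_left[OF Aint[of "A i" i], of "of_real C"]])
        show "(\<lambda>p. b p * (indicator (A i) p * ?G (s i p, x))) \<in> borel_measurable lborel"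
          using measurable_compose[OF sm[of i] Gm] by measurable
        show "AE p in lborel. norm (b p * (indicator (A i) p * ?G (s i p, x))) \<le> norm (b p * indicator (A i) p * complex_of_real C)"
          using C' by (intro AE_I2) (auto simp: norm_mult indicator_def intro!: mult_left_mono)
      qed auto
    qed
    have i2: "integrable lborel (\<lambda>p. b p * ?G (p, x))" by (rule param_integral_integrable[OF G b])
    have "iterated_deriv vs (\<lambda>x. R i x - param_integral b H x) x = iterated_deriv vs (R i) x - iterated_deriv vs (param_integral b H) x"
      using fun_cong[OF iterated_deriv_lincomb[OF RS[of i] PS, of vs 1 "-1"], of x] by simp
    also have "iterated_deriv vs (R i) x = (\<integral>p. b p * (indicator (A i) p * ?G (s i p, x)) \<partial>lborel)"
      unfolding R_def iterated_deriv_sum[OF fin Hs] iterated_deriv_slice[OF H] by (rule simple)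
    also have "iterated_deriv vs (param_integral b H) x = (\<integral>p. b p * ?G (p, x) \<partial>lborel)"
      unfolding iterated_deriv_param_integral[OF H b] by (simp add: param_integral_def)
    finally have "iterated_deriv vs (\<lambda>x. R i x - param_integral b H x) x = (\<integral>p. ?d p \<partial>lborel)"
      using i1 i2 by (simp add: right_diff_distrib)
    then have "(1 + norm x) ^ N * norm (iterated_deriv vs (\<lambda>x. R i x - param_integral b H x) x)
      = norm (of_real ((1 + norm x) ^ N) * (\<integral>p. ?d p \<partial>lborel))"
      by (simp only: norm_mult norm_of_real) simp
    also have "\<dots> = norm (\<integral>p. of_real ((1 + norm x) ^ N) * ?d p \<partial>lborel)" by simp
    also have "\<dots> \<le> (\<integral>p. norm (b p) * \<delta> i p \<partial>lborel)"
    proof (rule norm_integral_le[OF _ \<delta>int])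
      show "integrable lborel (\<lambda>p. of_real ((1 + norm x) ^ N) * ?d p)"
        using i1 i2 by (intro integrable_mult_right) (simp add: right_diff_distrib)
      fix p
      have "norm (of_real ((1 + norm x) ^ N) * ?d p) = norm (b p) * ((1 + norm x) ^ N * norm (indicator (A i) p * ?G (s i p, x) - ?G (p, x)))"
        by (simp only: norm_mult norm_of_real) simp
      also have "\<dots> \<le> norm (b p) * \<delta> i p" by (intro mult_left_mono key vs) simp
      finally show "norm (of_real ((1 + norm x) ^ N) * ?d p) \<le> norm (b p) * \<delta> i p" .
    qed
    finally show "(1 + norm x) ^ N * norm (iterated_deriv vs (\<lambda>x. R i x - param_integral b H x) x) \<le> (\<integral>p. norm (b p) * \<delta> i p \<partial>lborel)" .
  qed
  have lim1: "(\<lambda>i. u (R i)) \<longlonglongrightarrow> u (param_integral b H)"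
  proof (rule Lim_null[THEN iffD2], rule Lim_null_comparison)
    have "norm (u (R i) - u (param_integral b H)) \<le> C0 * (\<integral>p. norm (b p) * \<delta> i p \<partial>lborel)" for i
    proof -
      have "(\<lambda>x. R i x - param_integral b H x) \<in> schwartz" using schwartz_lincomb[OF RS[of i] PS, of 1 "-1"] by simp
      from C0(2)[OF this] have "norm (u (R i) - u (param_integral b H)) \<le> C0 * schwartz_norm N (\<lambda>x. R i x - param_integral b H x)"
        by (simp add: tempered_diff[OF u RS PS])
      also have "\<dots> \<le> C0 * (\<integral>p. norm (b p) * \<delta> i p \<partial>lborel)" by (intro mult_left_mono RP C0)
      finally show ?thesis .
    qed
    then show "\<forall>\<^sub>F i in sequentially. norm (u (R i) - u (param_integral b H)) \<le> C0 * (\<integral>p. norm (b p) * \<delta> i p \<partial>lborel)" by simp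
    show "(\<lambda>i. C0 * (\<integral>p. norm (b p) * \<delta> i p \<partial>lborel)) \<longlonglongrightarrow> 0" using \<delta>lim by (rule tendsto_mult_right_zero)
  qed
  have uc: "continuous_on UNIV (\<lambda>p. u (\<lambda>x. H (p, x)))" by (rule tempered_slice_continuous[OF u H])
  have um [measurable]: "(\<lambda>p. u (\<lambda>x. H (p, x))) \<in> borel_measurable borel" using uc by (rule borel_measurable_continuous_onI)
  \<comment> \<open>The same sums converge to the integral on the right, because \<open>u\<close> of
    a slice is continuous in \<open>p\<close> and inherits the decay of \<open>H\<close>.\<close>
  have lim2: "(\<lambda>i. u (R i)) \<longlonglongrightarrow> (\<integral>p. cnj (b p) * u (\<lambda>x. H (p, x)) \<partial>lborel)"
    unfolding uR
  proof (rule integral_dominated_convergence[where w = "\<lambda>p. (K * (C0 * (C1 * 2 ^ k))) * (1 / (1 + norm p) ^ (2 * DIM('p)))"])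
    show "integrable lborel (\<lambda>p::'p. (K * (C0 * (C1 * 2 ^ k))) * (1 / (1 + norm p) ^ (2 * DIM('p))))" by (rule dint)
    show "AE p in lborel. (\<lambda>i. cnj (b p) * (indicator (A i) p * u (\<lambda>x. H (s i p, x)))) \<longlonglongrightarrow> cnj (b p) * u (\<lambda>x. H (p, x))"
    proof (rule AE_I2)
      fix p
      have "(\<lambda>i. u (\<lambda>x. H (s i p, x))) \<longlonglongrightarrow> u (\<lambda>x. H (p, x))"
        using uc sl[of p] by (intro isCont_tendsto_compose[where g = "\<lambda>p. u (\<lambda>x. H (p, x))"]) (auto simp: continuous_on_eq_continuous_at)
      then have "(\<lambda>i. indicator (A i) p * u (\<lambda>x. H (s i p, x))) \<longlonglongrightarrow> u (\<lambda>x. H (p, x))"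
        by (rule Lim_transform_eventually) (use evA[of p] in \<open>eventually_elim, simp\<close>)
      then show "(\<lambda>i. cnj (b p) * (indicator (A i) p * u (\<lambda>x. H (s i p, x)))) \<longlonglongrightarrow> cnj (b p) * u (\<lambda>x. H (p, x))"
        by (rule tendsto_mult_left)
    qed
    show "AE p in lborel. norm (cnj (b p) * (indicator (A i) p * u (\<lambda>x. H (s i p, x)))) \<le> (K * (C0 * (C1 * 2 ^ k))) * (1 / (1 + norm p) ^ (2 * DIM('p)))" for i
    proof (rule AE_I2)
      fix p
      have "norm (indicator (A i) p * u (\<lambda>x. H (s i p, x))) \<le> C0 * (C1 * 2 ^ k) * (1 / (1 + norm p) ^ k)"
      proof (cases "p \<in> A i")
        case True
        then have "norm (indicator (A i) p * u (\<lambda>x. H (s i p, x))) \<le> C0 * (C1 * (1 / (1 + norm (s i p)) ^ k))"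
          using slice_le by simp
        also have "\<dots> \<le> C0 * (C1 * (2 ^ k * (1 / (1 + norm p) ^ k)))" by (intro mult_left_mono near True C0 C1)
        finally show ?thesis by (simp add: mult.assoc)
      qed (use C0 C1 in simp)
      then have "norm (b p) * norm (indicator (A i) p * u (\<lambda>x. H (s i p, x))) \<le> norm (b p) * (C0 * (C1 * 2 ^ k) * (1 / (1 + norm p) ^ k))"
        by (rule mult_left_mono) simp
      also have "\<dots> \<le> (K * (C0 * (C1 * 2 ^ k))) * (1 / (1 + norm p) ^ (2 * DIM('p)))" by (rule dom) (use C0 C1 in simp)
      finally show "norm (cnj (b p) * (indicator (A i) p * u (\<lambda>x. H (s i p, x)))) \<le> (K * (C0 * (C1 * 2 ^ k))) * (1 / (1 + norm p) ^ (2 * DIM('p)))"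
        by (simp add: norm_mult)
    qed
    show "(\<lambda>p. cnj (b p) * u (\<lambda>x. H (p, x))) \<in> borel_measurable lborel"
      using um b(1) by (intro borel_measurable_times measurable_compose[OF _ borel_measurable_continuous_onI[OF continuous_on_cnj[OF continuous_on_id]]]) simp_all
    show "(\<lambda>p. cnj (b p) * (indicator (A i) p * u (\<lambda>x. H (s i p, x)))) \<in> borel_measurable lborel" for i
      using measurable_compose[OF sm[of i] um] b(1)
      by (intro borel_measurable_times measurable_compose[OF _ borel_measurable_continuous_onI[OF continuous_on_cnj[OF continuous_on_id]]] borel_measurable_indicator) simp_all
  qed
  show ?thesis by (rule LIMSEQ_unique[OF lim1 lim2])
qed

section \<open>The short-time Fourier transform\<close>

definition tf_shift :: "'a::euclidean_space \<times> 'a \<Rightarrow> ('a \<Rightarrow> complex) \<Rightarrow> 'a \<Rightarrow> complex" where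
  "tf_shift z g = (\<lambda>t. cis (2 * pi * (snd z \<bullet> t)) * g (t - fst z))"

text \<open>The transform of a function, where \<open>stft\<close> is that of a distribution. As a
  partial Fourier transform it maps Schwartz functions to Schwartz functions.\<close>

definition stft_fun :: "('a::euclidean_space \<Rightarrow> complex) \<Rightarrow> ('a \<Rightarrow> complex) \<Rightarrow> 'a \<times> 'a \<Rightarrow> complex" where
  "stft_fun g \<phi> = partial_fourier (\<lambda>_. 1) (\<lambda>(x, t). \<phi> t * cnj (g (t - x)))"

lemma stft_tf_shift: "stft g u z = u (tf_shift z g)"
  by (simp add: stft_def tf_shift_def case_prod_unfold)

text \<open>Weights cost powers of the position and derivatives cost powers of the frequency, so
  Schwartz norms grow polynomially in the shift. This is the source of the polynomial growth of
  \<open>stft\<close>.\<close>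

lemma tf_shift_poly_sbounded:
  fixes g :: "'a::euclidean_space \<Rightarrow> complex"
  assumes g: "g \<in> schwartz"
  shows "poly.sbounded (\<lambda>z :: 'a \<times> 'a. tf_shift z g)"
  unfolding tf_shift_def
proof (rule poly.sbounded_cis)
  have mod: "poly.moderate c" if "\<And>z. norm (c z) \<le> K * (1 + norm z) ^ k" for c :: "'a \<times> 'a \<Rightarrow> complex" and K k
    unfolding poly.moderate_def
  proof (rule allI, rule exI, rule exI, intro conjI ballI)
    have "0 \<le> K" using order_trans[OF norm_ge_zero that[of 0]] by simp
    then show "0 \<le> K" .
    show "norm (c z) * (1 + norm z) ^ M \<le> K * (1 + norm z) ^ (k + M)" for z M
      using mult_right_mono[OF that[of z], of "(1 + norm z) ^ M"] by (simp add: power_add mult.assoc)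
  qed
  have "poly.sbounded (\<lambda>z :: 'a \<times> 'a. g)"
    unfolding poly.sbounded_def
  proof (intro ballI conjI allI)
    fix vs :: "'a list" assume vs: "vs \<in> lists Basis"
    show "iterated_deriv vs g differentiable at x" for x
      using schwartz_has_derivative[OF schwartz_iterated_deriv[OF g]] by (rule differentiableI)
    fix N
    obtain C where C: "0 \<le> C" "\<And>x. (1 + norm x) ^ N * norm (iterated_deriv vs g x) \<le> C"
      using schwartz_decay[OF schwartz_iterated_deriv[OF g]] by blast
    show "poly.fam_bounded (\<lambda>i x. (1 + norm x) ^ N * norm (iterated_deriv vs g x))"
      by (rule poly.fam_boundedI[where M = 0 and C = C]) (use C in auto)
  qed
  then have "poly.sbounded (\<lambda>(z :: 'a \<times> 'a) t. g (t + - fst z))"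
  proof (rule poly.sbounded_compose_affine[where L = "\<lambda>t. t" and \<kappa> = 1])
    show "poly.moderate (\<lambda>z :: 'a \<times> 'a. of_real ((1 + norm (- fst z)) ^ k))" for k
      by (rule mod[where K = 1 and k = k]) (auto simp: norm_power abs_of_nonneg norm_fst_le intro!: power_mono simp del: of_real_power simp: norm_of_real)
  qed (auto intro: bounded_linear_ident)
  then show "poly.sbounded (\<lambda>(z :: 'a \<times> 'a) t. g (t - fst z))" by simp
  show "((\<lambda>t. 2 * pi * (snd z \<bullet> t)) has_derivative (\<lambda>h. 2 * pi * (snd z \<bullet> h))) (at x)" for z :: "'a \<times> 'a" and x
    by (auto intro!: derivative_eq_intros)
  fix b :: 'a and F :: "'a \<times> 'a \<Rightarrow> 'a \<Rightarrow> complex" assume b: "b \<in> Basis" and F: "poly.sbounded F"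
  show "poly.sbounded (\<lambda>z x. of_real (2 * pi * (snd z \<bullet> b)) * F z x)"
  proof (rule poly.sbounded_scale[OF F], rule mod[where K = "2 * pi" and k = 1])
    fix z :: "'a \<times> 'a"
    have "\<bar>snd z \<bullet> b\<bar> \<le> norm (snd z)" using b by (simp add: Basis_le_norm)
    also have "\<dots> \<le> 1 + norm z" using norm_snd_le[of "snd z" "fst z"] by simp
    finally have "2 * pi * \<bar>snd z \<bullet> b\<bar> \<le> 2 * pi * (1 + norm z)" by (intro mult_left_mono) auto
    then show "norm (complex_of_real (2 * pi * (snd z \<bullet> b))) \<le> 2 * pi * (1 + norm z) ^ 1"
      by (simp only: norm_of_real abs_mult) simp
  qed
qed

lemma tf_shift_schwartz: "g \<in> schwartz \<Longrightarrow> tf_shift z g \<in> schwartz"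
  using poly.sbounded_schwartz[OF tf_shift_poly_sbounded] by simp

lemma stft_growth:
  fixes g :: "'a::euclidean_space \<Rightarrow> complex"
  assumes u: "u \<in> tempered" and g: "g \<in> schwartz"
  obtains N C where "0 \<le> C" "\<And>z. norm (stft g u z) \<le> C * (1 + norm z) ^ N"
proof -
  obtain N C where C: "0 \<le> C" "\<And>f. f \<in> schwartz \<Longrightarrow> norm (u f) \<le> C * schwartz_norm N f"
    using tempered_bound[OF u] by metis
  obtain M C' where C': "0 \<le> C'" "\<And>z. schwartz_norm N (tf_shift z g) \<le> C' * (1 + norm z) ^ M"
    using poly.sbounded_norm_le[OF tf_shift_poly_sbounded[OF g], of N] by auto
  have "norm (stft g u z) \<le> (C * C') * (1 + norm z) ^ M" for z
    unfolding stft_tf_shift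
    using order_trans[OF C(2)[OF tf_shift_schwartz[OF g]] mult_left_mono[OF C'(2) C(1)], of z] by (simp add: mult.assoc)
  then show ?thesis using that[of "C * C'" M] C C' by auto
qed

text \<open>The decay of \<open>c\<close> outweighs the growth of the shifts in their parameter. The
  linear maps are arbitrary because the two entries of a shifted Wigner transform are shifted by
  different combinations of the parameter.\<close>

lemma schwartz_joint:
  fixes c :: "'p::euclidean_space \<Rightarrow> complex" and g :: "'a::euclidean_space \<Rightarrow> complex"
  assumes c: "c \<in> schwartz" and g: "g \<in> schwartz" and \<alpha>: "linear \<alpha>" and \<beta>: "linear \<beta>"
  shows "(\<lambda>(p, t). c p * (cis (2 * pi * (\<beta> p \<bullet> t)) * g (t - \<alpha> p))) \<in> schwartz"
proof -
  have bl: "bounded_linear \<alpha>" "bounded_linear \<beta>" using \<alpha> \<beta> by (simp_all add: linear_conv_bounded_linear)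
  have "(\<lambda>z. (\<lambda>(p, t). c p * g t) (fst z, snd z - \<alpha> (fst z))) \<in> schwartz"
  proof (rule schwartz_linear_inj[OF schwartz_tensor[OF c g]])
    show "linear (\<lambda>z. (fst z, snd z - \<alpha> (fst z)))"
      unfolding linear_conv_bounded_linear
      by (intro bounded_linear_intros bounded_linear_compose[OF bl(1)])
    show "inj (\<lambda>z. (fst z, snd z - \<alpha> (fst z)))" by (auto simp: inj_on_def prod_eq_iff)
  qed
  then have S: "(\<lambda>z. c (fst z) * g (snd z - \<alpha> (fst z))) \<in> schwartz" by simp
  have "(\<lambda>z. cis (2 * pi * (\<beta> (fst z) \<bullet> snd z)) * (c (fst z) * g (snd z - \<alpha> (fst z)))) \<in> schwartz"
  proof (rule schwartz_cis[OF S, where l = "\<lambda>h z. 2 * pi * (\<beta> (fst z) \<bullet> snd h + \<beta> (fst h) \<bullet> snd z)" and c = "\<lambda>_. 0"])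
    fix z :: "'p \<times> 'a"
    have "((\<lambda>z. \<beta> (fst z)) has_derivative (\<lambda>h. \<beta> (fst h))) (at z)"
      by (rule bounded_linear_imp_has_derivative) (intro bounded_linear_compose[OF bl(2)] bounded_linear_fst)
    then show "((\<lambda>z. 2 * pi * (\<beta> (fst z) \<bullet> snd z)) has_derivative (\<lambda>h. 2 * pi * (\<beta> (fst z) \<bullet> snd h + \<beta> (fst h) \<bullet> snd z) + 0)) (at z)"
      by (auto intro!: derivative_eq_intros)
    show "bounded_linear (\<lambda>z. 2 * pi * (\<beta> (fst z) \<bullet> snd b + \<beta> (fst b) \<bullet> snd z))" for b :: "'p \<times> 'a"
      by (intro bounded_linear_intros bounded_linear_compose[OF bl(2)])
  qed
  then show ?thesis by (simp add: case_prod_unfold mult_ac)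
qed

lemma schwartz_joint_tf_shift:
  fixes c :: "'a::euclidean_space \<times> 'a \<Rightarrow> complex"
  assumes "c \<in> schwartz" "g \<in> schwartz" shows "(\<lambda>(p, t). c p * tf_shift p g t) \<in> schwartz"
  using schwartz_joint[OF assms, of fst snd] unfolding tf_shift_def by (simp add: linear_fst linear_snd)

lemma schwartz_stft_fun_kernel:
  fixes g \<phi> :: "'a::euclidean_space \<Rightarrow> complex"
  assumes "\<phi> \<in> schwartz" "g \<in> schwartz"
  shows "(\<lambda>(x, t). \<phi> t * cnj (g (t - x))) \<in> schwartz"
proof -
  have "(\<lambda>z :: 'a \<times> 'a. (\<lambda>(x, t). \<phi> x * cnj (g t)) (snd z, snd z - fst z)) \<in> schwartz"
  proof (rule schwartz_linear_inj[OF schwartz_tensor[OF assms(1) schwartz_cnj[OF assms(2)]]])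
    show "linear (\<lambda>z :: 'a \<times> 'a. (snd z, snd z - fst z))"
      unfolding linear_conv_bounded_linear by (intro bounded_linear_intros)
    show "inj (\<lambda>z :: 'a \<times> 'a. (snd z, snd z - fst z))" by (auto simp: inj_on_def prod_eq_iff)
  qed
  then show ?thesis by (simp add: case_prod_unfold)
qed

lemma schwartz_stft_fun: "\<phi> \<in> schwartz \<Longrightarrow> g \<in> schwartz \<Longrightarrow> stft_fun g \<phi> \<in> schwartz"
  unfolding stft_fun_def by (intro schwartz_partial_fourier schwartz_stft_fun_kernel)

lemma stft_fun_fourier: "stft_fun g \<phi> (x, \<xi>) = fourier (\<lambda>t. \<phi> t * cnj (g (t - x))) \<xi>"
  by (simp add: stft_fun_def partial_fourier_def fourier_def)

text \<open>Covariance up to a phase factor. As the modulus depends on \<open>z - w\<close> only,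
  the reproducing formula becomes a convolution inequality.\<close>

lemma norm_stft_fun_tf_shift:
  assumes "g \<in> schwartz" "g' \<in> schwartz"
  shows "norm (stft_fun g (tf_shift w g') z) = norm (stft_fun g g' (z - w))"
proof -
  let ?f = "\<lambda>t. tf_shift w g' t * cnj (g (t - fst z)) * cis (- 2 * pi * (snd z \<bullet> t))"
  have S: "?f \<in> schwartz"
    using schwartz_modulate[OF schwartz_slice[OF schwartz_stft_fun_kernel[OF tf_shift_schwartz[OF assms(2)] assms(1)]], of "- 2 * pi" "snd z" w "fst z"]
    by (simp add: mult_ac)
  have "stft_fun g (tf_shift w g') z = (\<integral>t. ?f t \<partial>lborel)"
    by (cases z) (simp add: stft_fun_fourier fourier_def)
  also have "\<dots> = (\<integral>t. ?f (t + fst w) \<partial>lborel)"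
    by (rule integral_translate[OF schwartz_measurable[OF S], symmetric])
  also have "\<dots> = (\<integral>t. cis (2 * pi * ((snd w - snd z) \<bullet> fst w)) *
      (g' t * cnj (g (t - fst (z - w))) * cis (- 2 * pi * (snd (z - w) \<bullet> t))) \<partial>lborel)"
  proof (rule Bochner_Integration.integral_cong[OF refl])
    fix t
    have "cis (2 * pi * (snd w \<bullet> (t + fst w))) * cis (- 2 * pi * (snd z \<bullet> (t + fst w)))
       = cis (2 * pi * ((snd w - snd z) \<bullet> fst w)) * cis (- 2 * pi * (snd (z - w) \<bullet> t))"
      by (simp add: cis_mult algebra_simps inner_add_right inner_diff_left)
    then show "?f (t + fst w) = cis (2 * pi * ((snd w - snd z) \<bullet> fst w)) *
      (g' t * cnj (g (t - fst (z - w))) * cis (- 2 * pi * (snd (z - w) \<bullet> t)))"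
      unfolding tf_shift_def by (simp add: algebra_simps)
  qed
  also have "\<dots> = cis (2 * pi * ((snd w - snd z) \<bullet> fst w)) * stft_fun g g' (z - w)"
    by (cases "z - w") (simp add: stft_fun_fourier fourier_def mult.assoc)
  finally show ?thesis by (simp add: norm_mult)
qed

definition energy :: "('a::euclidean_space \<Rightarrow> complex) \<Rightarrow> real" where
  "energy g = (\<integral>x. (norm (g x))\<^sup>2 \<partial>lborel)"

text \<open>A nonempty open set is not negligible. Hence bounds of continuous functions that hold
  almost everywhere, such as those by an essential supremum, hold everywhere.\<close>

lemma AE_lborel_open:
  assumes "AE x in lborel. P x" "open {x::'a::euclidean_space. \<not> P x}" shows "P x"
proof -
  have "{x. \<not> P x} \<in> sets borel" using assms(2) by simp
  then have "{x. \<not> P x} \<in> null_sets lborel" using assms(1) by (subst AE_iff_null_sets) simp_all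
  then have "negligible {x. \<not> P x}" using null_sets_completionI by (auto simp: negligible_iff_null_sets)
  then have "{x. \<not> P x} = {}" using open_not_negligible[OF assms(2)] by blast
  then show ?thesis by auto
qed

lemma energy_pos:
  assumes g: "g \<in> schwartz" and "g x \<noteq> 0" shows "0 < energy g"
proof -
  obtain C where C: "0 \<le> C" "\<And>x. (1 + norm x) ^ 0 * norm (g x) \<le> C" using schwartz_decay[OF g] by blast
  have gi: "integrable lborel (\<lambda>x. C * norm (g x))" using schwartz_integrable[OF g] by auto
  have int: "integrable lborel (\<lambda>x. (norm (g x))\<^sup>2)"
    by (rule Bochner_Integration.integrable_bound[OF gi])
       (use C schwartz_measurable[OF g] in \<open>auto intro!: AE_I2 mult_right_mono simp: power2_eq_square\<close>)
  have ge: "0 \<le> energy g" unfolding energy_def by simp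
  moreover have "energy g \<noteq> 0"
  proof
    assume "energy g = 0"
    then have "AE x in lborel. (norm (g x))\<^sup>2 = 0"
      unfolding energy_def using integral_nonneg_eq_0_iff_AE[OF int] by simp
    then have "AE x in lborel. g x = 0" by simp
    moreover have "open {x. \<not> (g x = 0)}"
      using schwartz_continuous[OF g, of UNIV] by (intro open_Collect_neq) auto
    ultimately show False using AE_lborel_open \<open>g x \<noteq> 0\<close> by blast
  qed
  ultimately show ?thesis by simp
qed

lemma schwartz_slice_integrable: "H \<in> schwartz \<Longrightarrow> integrable lborel (\<lambda>p. H (p, x))"
  by (rule schwartz_integrable) (rule schwartz_slice')

lemma integral_prod_lborel:
  fixes f :: "'a::euclidean_space \<times> 'b::euclidean_space \<Rightarrow> complex"
  assumes "integrable lborel f"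
  shows "(\<integral>z. f z \<partial>lborel) = (\<integral>x. \<integral>y. f (x, y) \<partial>lborel \<partial>lborel)"
  using lborel_pair.integral_fst'[of f] assms by (simp add: lborel_prod)

text \<open>The integral over the frequency is Fourier inversion for \<open>\<phi>\<close> times a
  translated conjugate window and leaves \<open>\<phi> t\<close> times
  \<open>norm (g (t - x))\<close> squared. The integral over \<open>x\<close> then gives the
  energy.\<close>

lemma reproducing_pointwise:
  fixes g \<phi> :: "'a::euclidean_space \<Rightarrow> complex"
  assumes g: "g \<in> schwartz" and \<phi>: "\<phi> \<in> schwartz"
  shows "(\<integral>p. stft_fun g \<phi> p * tf_shift p g t \<partial>lborel) = of_real (energy g) * \<phi> t"
proof -
  have [measurable]: "g \<in> borel_measurable borel" by (rule schwartz_measurable[OF g])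
  have "integrable lborel (\<lambda>p. (\<lambda>(p, t). stft_fun g \<phi> p * tf_shift p g t) (p, t))"
    by (intro schwartz_slice_integrable schwartz_joint_tf_shift schwartz_stft_fun g \<phi>)
  then have "integrable lborel (\<lambda>p. stft_fun g \<phi> p * tf_shift p g t)" by simp
  then have "(\<integral>p. stft_fun g \<phi> p * tf_shift p g t \<partial>lborel) = (\<integral>x. \<integral>\<xi>. stft_fun g \<phi> (x, \<xi>) * tf_shift (x, \<xi>) g t \<partial>lborel \<partial>lborel)"
    by (rule integral_prod_lborel)
  also have "\<dots> = (\<integral>x. \<phi> t * of_real ((norm (g (t - x)))\<^sup>2) \<partial>lborel)"
  proof (rule Bochner_Integration.integral_cong[OF refl])
    fix x
    let ?f = "\<lambda>t. \<phi> t * cnj (g (t - x))"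
    have S: "?f \<in> schwartz" using schwartz_slice[OF schwartz_stft_fun_kernel[OF \<phi> g], of x] by simp
    have "(\<integral>\<xi>. stft_fun g \<phi> (x, \<xi>) * tf_shift (x, \<xi>) g t \<partial>lborel) = (\<integral>\<xi>. fourier ?f \<xi> * cis (2 * pi * (\<xi> \<bullet> t)) \<partial>lborel) * g (t - x)"
      unfolding integral_mult_left_zero[symmetric] by (simp add: stft_fun_fourier tf_shift_def mult.assoc)
    also have "\<dots> = \<phi> t * (g (t - x) * cnj (g (t - x)))"
      by (simp add: schwartz_fourier_inversion[OF S])
    finally show "(\<integral>\<xi>. stft_fun g \<phi> (x, \<xi>) * tf_shift (x, \<xi>) g t \<partial>lborel) = \<phi> t * of_real ((norm (g (t - x)))\<^sup>2)"
      by (simp only: complex_norm_square[symmetric])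
  qed
  also have "\<dots> = \<phi> t * (\<integral>x. of_real ((norm (g (t - x)))\<^sup>2) \<partial>lborel)" by (rule integral_mult_right_zero)
  also have "(\<integral>x. complex_of_real ((norm (g (t - x)))\<^sup>2) \<partial>lborel) = (\<integral>x. complex_of_real ((norm (g x))\<^sup>2) \<partial>lborel)"
    by (subst integral_scale[where c = "-1" and t = t and h = "\<lambda>x. complex_of_real ((norm (g x))\<^sup>2)"]) auto
  also have "\<dots> = of_real (energy g)" unfolding energy_def by (rule integral_complex_of_real)
  finally show ?thesis by (simp add: mult.commute)
qed

lemma reproducing:
  fixes g \<phi> :: "'a::euclidean_space \<Rightarrow> complex"
  assumes u: "u \<in> tempered" and g: "g \<in> schwartz" and \<phi>: "\<phi> \<in> schwartz"
  shows "of_real (energy g) * u \<phi> = (\<integral>p. cnj (stft_fun g \<phi> p) * stft g u p \<partial>lborel)"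
proof -
  let ?H = "\<lambda>(p, t). stft_fun g \<phi> p * tf_shift p g t"
  have H: "?H \<in> schwartz" by (intro schwartz_joint_tf_shift schwartz_stft_fun g \<phi>)
  have "param_integral (\<lambda>_. 1) ?H = (\<lambda>t. of_real (energy g) * \<phi> t)"
    unfolding param_integral_def by (simp add: reproducing_pointwise[OF g \<phi>])
  then have "of_real (energy g) * u \<phi> = u (param_integral (\<lambda>_. 1) ?H)"
    using tempered_cmult[OF u \<phi>, of "of_real (energy g)"] by simp
  also have "\<dots> = (\<integral>p. cnj 1 * u (\<lambda>t. ?H (p, t)) \<partial>lborel)"
    by (rule tempered_param_integral[OF u H, where K = 1 and m = 0]) auto
  also have "\<dots> = (\<integral>p. cnj (stft_fun g \<phi> p) * stft g u p \<partial>lborel)"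
    by (simp add: tempered_cmult[OF u tf_shift_schwartz[OF g]] stft_tf_shift)
  finally show ?thesis .
qed

text \<open>The tensor square of \<open>c\<close>, translated. It serves to localize in the
  parameter of a time-frequency shift.\<close>

lemma schwartz_nonzero_at:
  fixes c :: "'a::euclidean_space \<Rightarrow> complex"
  assumes "c \<in> schwartz" "c x \<noteq> 0"
  obtains c' :: "'a \<times> 'a \<Rightarrow> complex" where "c' \<in> schwartz" "c' z \<noteq> 0"
proof -
  have S: "(\<lambda>(p, q). c p * c q) \<in> schwartz" by (rule schwartz_tensor[OF assms(1) assms(1)])
  have "(\<lambda>p. (\<lambda>(p, q). c p * c q) (p + ((x, x) - z))) \<in> schwartz"
    by (rule schwartz_affine_inj[OF S, where L = "\<lambda>p. p"]) (auto simp: linear_ident[unfolded id_def] inj_on_def intro: linearI)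
  then show ?thesis by (rule that) (use assms(2) in simp)
qed

text \<open>Shifts multiplied by a Schwartz function of the parameter are slices of a jointly
  Schwartz function, so \<open>u\<close> maps them to a continuous function. Dividing by the
  multiplier gives continuity wherever it is nonzero.\<close>

lemma stft_continuous:
  fixes g :: "'a::euclidean_space \<Rightarrow> complex"
  assumes u: "u \<in> tempered" and g: "g \<in> schwartz"
  shows "continuous_on UNIV (stft g u)"
proof (cases "\<exists>x. g x \<noteq> 0")
  case False
  then have "stft g u = (\<lambda>_. 0)" using tempered_zero[OF u] by (simp add: fun_eq_iff stft_tf_shift tf_shift_def)
  then show ?thesis by simp
next
  case True
  then obtain x where x: "g x \<noteq> 0" by auto
  have "isCont (stft g u) z" for z
  proof -
    obtain c :: "'a \<times> 'a \<Rightarrow> complex" where c: "c \<in> schwartz" "c z \<noteq> 0" by (rule schwartz_nonzero_at[OF g x])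
    have H: "(\<lambda>(p, t). c p * tf_shift p g t) \<in> schwartz" by (rule schwartz_joint_tf_shift[OF c(1) g])
    have "continuous_on UNIV (\<lambda>p. u (\<lambda>t. (\<lambda>(p, t). c p * tf_shift p g t) (p, t)))"
      by (rule tempered_slice_continuous[OF u H])
    then have c1: "continuous_on UNIV (\<lambda>p. cnj (c p) * stft g u p)"
      by (simp add: tempered_cmult[OF u tf_shift_schwartz[OF g]] stft_tf_shift)
    have c2: "continuous_on UNIV (\<lambda>p. cnj (c p))" by (intro continuous_on_cnj schwartz_continuous c)
    have "isCont (\<lambda>p. (cnj (c p) * stft g u p) / cnj (c p)) z"
      using c1 c2 c(2) by (intro continuous_divide) (simp_all add: continuous_on_eq_continuous_at del: split_paired_All)
    moreover have "\<forall>\<^sub>F p in nhds z. (cnj (c p) * stft g u p) / cnj (c p) = stft g u p"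
    proof -
      have "open {p. c p \<noteq> 0}" using schwartz_continuous[OF c(1), of UNIV] by (intro open_Collect_neq) auto
      then have "\<forall>\<^sub>F p in nhds z. c p \<noteq> 0" using c(2) eventually_nhds_in_open[of "{p. c p \<noteq> 0}" z] by simp
      then show ?thesis by eventually_elim simp
    qed
    ultimately show ?thesis using isCont_cong by fast
  qed
  then show ?thesis by (simp add: continuous_at_imp_continuous_on)
qed

section \<open>Change of window for exponents below one\<close>

lemma ennreal_mult3:
  "0 \<le> a \<Longrightarrow> 0 \<le> b \<Longrightarrow> ennreal (a * (b * c)) = ennreal a * (ennreal b * ennreal c)"
  by (simp add: ennreal_mult')

lemma ennreal_mult4:
  "0 \<le> a \<Longrightarrow> 0 \<le> b \<Longrightarrow> 0 \<le> c \<Longrightarrow>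
    ennreal (a * (b * (c * d))) = ennreal a * (ennreal b * (ennreal c * ennreal d))"
  by (simp add: ennreal_mult')

lemma nn_integral_prod_lborel:
  fixes h :: "'a::euclidean_space \<Rightarrow> ennreal" and k :: "'b::euclidean_space \<Rightarrow> ennreal"
  assumes [measurable]: "h \<in> borel_measurable borel" "k \<in> borel_measurable borel"
  shows "(\<integral>\<^sup>+z. c * (h (fst z) * k (snd z)) \<partial>lborel) = c * ((\<integral>\<^sup>+x. h x \<partial>lborel) * (\<integral>\<^sup>+y. k y \<partial>lborel))"
proof -
  have [measurable]: "(fst :: 'a \<times> 'b \<Rightarrow> 'a) \<in> borel_measurable borel" "(snd :: 'a \<times> 'b \<Rightarrow> 'b) \<in> borel_measurable borel"
    by (intro borel_measurable_continuous_onI continuous_intros)+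
  have "(\<integral>\<^sup>+z. c * (h (fst z) * k (snd z)) \<partial>lborel) = c * (\<integral>\<^sup>+z. h (fst z) * k (snd z) \<partial>lborel)"
    by (intro nn_integral_cmult) measurable
  also
  have "(\<integral>\<^sup>+z. h (fst z) * k (snd z) \<partial>lborel) = (\<integral>\<^sup>+z. h (fst z) * k (snd z) \<partial>(lborel \<Otimes>\<^sub>M lborel))"
    by (simp add: lborel_prod)
  also have "\<dots> = (\<integral>\<^sup>+x. \<integral>\<^sup>+y. h x * k y \<partial>lborel \<partial>lborel)"
    by (subst lborel.nn_integral_fst[symmetric]) simp_all
  also have "\<dots> = (\<integral>\<^sup>+x. h x \<partial>lborel) * (\<integral>\<^sup>+y. k y \<partial>lborel)"
    by (simp add: nn_integral_cmult nn_integral_multc)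
  finally show ?thesis .
qed

lemma nn_integral_weight_translate:
  fixes y :: "'a::euclidean_space"
  shows "(\<integral>\<^sup>+x. ennreal (1 / (1 + norm (x - y)) ^ (2 * DIM('a))) \<partial>lborel)
   = ennreal (\<integral>x. 1 / (1 + norm (x::'a::euclidean_space)) ^ (2 * DIM('a)) \<partial>lborel)"
proof -
  have "(\<integral>\<^sup>+x. ennreal (1 / (1 + norm (x - y)) ^ (2 * DIM('a))) \<partial>lborel)
      = (\<integral>\<^sup>+x. ennreal (1 / (1 + norm (x::'a)) ^ (2 * DIM('a))) \<partial>lborel)"
    using nn_integral_translate[of "\<lambda>x. ennreal (1 / (1 + norm (x::'a)) ^ (2 * DIM('a)))" "- y"] by simp
  also have "\<dots> = ennreal (\<integral>x. 1 / (1 + norm (x::'a)) ^ (2 * DIM('a)) \<partial>lborel)"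
    by (rule nn_integral_eq_integral[OF integrable_weight]) auto
  finally show ?thesis .
qed

text \<open>The reproducing formula with window \<open>g\<close> is applied to a shift of
  \<open>g'\<close>, and covariance makes its kernel depend on \<open>z - w\<close>.\<close>

lemma stft_window_change:
  fixes g g' :: "'a::euclidean_space \<Rightarrow> complex"
  assumes u: "u \<in> tempered" and g: "g \<in> schwartz" and g': "g' \<in> schwartz"
  shows "ennreal (energy g * norm (stft g' u w)) \<le> (\<integral>\<^sup>+z. ennreal (norm (stft_fun g g' (z - w)) * norm (stft g u z)) \<partial>lborel)"
proof -
  let ?f = "\<lambda>z. cnj (stft_fun g (tf_shift w g') z) * stft g u z"
  have e: "of_real (energy g) * u (tf_shift w g') = (\<integral>z. ?f z \<partial>lborel)"
    by (rule reproducing[OF u g tf_shift_schwartz[OF g']])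
  have "0 \<le> energy g" by (simp add: energy_def)
  then have "energy g * norm (stft g' u w) = norm (of_real (energy g) * u (tf_shift w g'))"
    by (simp add: stft_tf_shift norm_mult)
  also have "\<dots> = norm (\<integral>z. ?f z \<partial>lborel)" by (simp only: e)
  finally have "ennreal (energy g * norm (stft g' u w)) = ennreal (norm (\<integral>z. ?f z \<partial>lborel))" by simp
  also have "\<dots> \<le> (\<integral>\<^sup>+z. ennreal (norm (?f z)) \<partial>lborel)"
  proof (cases "integrable lborel ?f")
    case True then show ?thesis by (rule integral_norm_bound_ennreal)
  next
    \<comment> \<open>Without integrability the left side is zero by convention.\<close>
    case False then show ?thesis by (simp add: not_integrable_integral_eq)
  qed
  finally show ?thesis by (simp add: norm_mult norm_stft_fun_tf_shift[OF g g'])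
qed

lemma stft_fun_decay:
  fixes g g' :: "'a::euclidean_space \<Rightarrow> complex"
  assumes "g \<in> schwartz" "g' \<in> schwartz"
  obtains C where "0 \<le> C" "\<And>z. norm (stft_fun g g' z) \<le> C * (1 / (1 + norm (fst z)) ^ k) * (1 / (1 + norm (snd z)) ^ l)"
proof -
  obtain C where C: "0 \<le> C" "\<And>z. (1 + norm z) ^ (k + l) * norm (stft_fun g g' z) \<le> C"
    using schwartz_decay[OF schwartz_stft_fun[OF assms(2,1)]] by blast
  have "norm (stft_fun g g' z) \<le> C * (1 / (1 + norm (fst z)) ^ k) * (1 / (1 + norm (snd z)) ^ l)" for z
  proof -
    have "norm (stft_fun g g' z) * ((1 + norm (fst z)) ^ k * (1 + norm (snd z)) ^ l)
       \<le> norm (stft_fun g g' z) * ((1 + norm z) ^ k * (1 + norm z) ^ l)"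
      using norm_fst_weight[of "fst z" k "snd z"] norm_snd_weight[of "snd z" l "fst z"]
      by (intro mult_left_mono mult_mono) auto
    also have "\<dots> \<le> C" using C(2)[of z] by (simp add: power_add mult_ac)
    finally have *: "norm (stft_fun g g' z) * ((1 + norm (fst z)) ^ k * (1 + norm (snd z)) ^ l) \<le> C" .
    have "0 < (1 + norm (fst z)) ^ k * (1 + norm (snd z)) ^ l" by (simp add: add_pos_nonneg)
    with * have "norm (stft_fun g g' z) \<le> C / ((1 + norm (fst z)) ^ k * (1 + norm (snd z)) ^ l)" by (simp only: pos_le_divide_eq)
    then show ?thesis by (simp add: field_simps)
  qed
  then show ?thesis using that C(1) by blast
qed

text \<open>As \<open>q\<close> may be below one, Young's inequality is not available. The Peetre-type supremum \<open>M\<close> of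
  the proof is finite by the polynomial growth of the short-time Fourier transform, once the factor
  \<open>(1 + \<epsilon> norm x)\<^sup>-\<^sup>N\<close> is included, and satisfies \<open>M \<le> K M\<^sup>1\<^sup>-\<^sup>q I\<close> with a constant \<open>K\<close> that does
  not depend on \<open>\<epsilon>\<close>. So \<open>M\<^sup>q \<le> K I\<close>, and \<open>\<epsilon>\<close> tends to zero.\<close>

lemma stft_peetre_bound:
  fixes g :: "'a::euclidean_space \<Rightarrow> complex"
  assumes u: "u \<in> tempered" and g: "g \<in> schwartz" and g0: "0 < energy g"
    and q: "0 < q" "q \<le> 1"
    and growth: "\<And>z. norm (stft g u z) \<le> C0 * (1 + norm z) ^ N"
    and [measurable]: "F \<in> borel_measurable borel"
    and F: "\<And>x \<xi>. ennreal (norm (stft g u (x, \<xi>)) powr q) \<le> F \<xi>"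
  obtains K where "0 \<le> K" "\<And>x \<xi> \<xi>0 I. (\<integral>\<^sup>+\<xi>. F \<xi> * ennreal ((1 + norm (\<xi> - \<xi>0)) powr (- real N * q)) \<partial>lborel) = ennreal I \<Longrightarrow> 0 \<le> I \<Longrightarrow>
     norm (stft g u (x, \<xi>)) powr q \<le> K * I * (1 + norm (\<xi> - \<xi>0)) powr (real N * q)"
proof -
  let ?D = "2 * DIM('a)"
  define V where "V = (\<lambda>z. norm (stft g u z))"
  have V0: "0 \<le> V z" for z by (simp add: V_def)
  \<comment> \<open>In position, \<open>N\<close> powers pay for the weight and
    \<open>2 * DIM('a)\<close> for integrability. In frequency \<open>N\<close> powers suffice,
    since integrability there is left to \<open>F\<close> with its own weight.\<close>
  obtain C where C: "0 \<le> C" "\<And>z. norm (stft_fun g g z) \<le> C * (1 / (1 + norm (fst z)) ^ (N + ?D)) * (1 / (1 + norm (snd z)) ^ N)"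
    by (rule stft_fun_decay[OF g g]) blast
  define J where "J = (\<integral>x. 1 / (1 + norm (x::'a)) ^ ?D \<partial>lborel)"
  have J0: "0 \<le> J" by (simp add: J_def)
  have J: "(\<integral>\<^sup>+x. ennreal (1 / (1 + norm (x - y::'a)) ^ ?D) \<partial>lborel) = ennreal J" for y
    unfolding J_def by (rule nn_integral_weight_translate)
  have C00: "0 \<le> C0" using order_trans[OF norm_ge_zero growth[of 0]] by simp
  have main: "V (x, \<xi>) powr q \<le> (C * J / energy g) * I * ((1 + \<epsilon> * norm x) ^ N * (1 + norm (\<xi> - \<xi>0)) ^ N) powr q"
    if I: "(\<integral>\<^sup>+\<xi>. F \<xi> * ennreal ((1 + norm (\<xi> - \<xi>0)) powr (- real N * q)) \<partial>lborel) = ennreal I" "0 \<le> I"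
      and \<epsilon>: "0 < \<epsilon>" "\<epsilon> \<le> 1" for x \<xi> \<xi>0 I \<epsilon>
  proof -
    define P where "P = (\<lambda>z :: 'a \<times> 'a. (1 + \<epsilon> * norm (fst z)) ^ N * (1 + norm (snd z - \<xi>0)) ^ N)"
    have P1: "1 \<le> P z" for z
      unfolding P_def using \<epsilon> by (intro mult_ge1_I) (auto intro!: one_le_power)
    then have P0: "0 < P z" for z using less_le_trans[OF zero_less_one] by blast
    define mm where "mm = (\<lambda>z. V z / P z)"
    have mm0: "0 \<le> mm z" for z using V0 P0 by (simp add: mm_def less_imp_le)
    have Vm: "V z = mm z * P z" for z using P0[of z] by (simp add: mm_def)
    \<comment> \<open>This bound only has to make the supremum finite, so its dependence on
      \<open>\<epsilon>\<close> is harmless.\<close>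
    have bdd: "mm z \<le> C0 * ((1 / \<epsilon>) ^ N * (1 + norm \<xi>0) ^ N)" for z
    proof -
      have "1 + norm z \<le> (1 + norm (fst z)) * (1 + norm (snd z))"
      proof -
        have "norm z \<le> norm (fst z) + norm (snd z)" using norm_Pair_le[of "fst z" "snd z"] by simp
        then show ?thesis using norm_1_triangle[of "norm (fst z)" "norm (snd z)"] by simp
      qed
      also have "\<dots> \<le> ((1 / \<epsilon>) * (1 + \<epsilon> * norm (fst z))) * ((1 + norm (snd z - \<xi>0)) * (1 + norm \<xi>0))"
      proof (intro mult_mono)
        show "1 + norm (fst z) \<le> (1 / \<epsilon>) * (1 + \<epsilon> * norm (fst z))" using \<epsilon> by (simp add: field_simps)
        show "1 + norm (snd z) \<le> (1 + norm (snd z - \<xi>0)) * (1 + norm \<xi>0)" using norm_1_triangle[of "snd z - \<xi>0" \<xi>0] by simp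
      qed (use \<epsilon> in auto)
      finally have "(1 + norm z) ^ N \<le> (((1 / \<epsilon>) * (1 + \<epsilon> * norm (fst z))) * ((1 + norm (snd z - \<xi>0)) * (1 + norm \<xi>0))) ^ N"
        by (intro power_mono) auto
      also have "\<dots> = ((1 / \<epsilon>) ^ N * (1 + norm \<xi>0) ^ N) * P z" by (simp only: power_mult_distrib P_def mult_ac)
      finally have "V z \<le> C0 * (((1 / \<epsilon>) ^ N * (1 + norm \<xi>0) ^ N) * P z)"
        unfolding V_def using order_trans[OF growth mult_left_mono[OF _ C00]] by blast
      then show ?thesis using P0[of z] by (simp only: mm_def pos_divide_le_eq mult.assoc)
    qed
    define M where "M = (SUP z. mm z)"
    have bddM: "bdd_above (range mm)" using bdd by (rule bdd_aboveI2)
    have mM: "mm z \<le> M" for z unfolding M_def by (rule cSUP_upper[OF UNIV_I bddM])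
    have M0: "0 \<le> M" using order_trans[OF mm0 mM] .
    have step: "energy g * mm w \<le> C * M powr (1 - q) * (J * I)" for w
    proof -
      have "ennreal (energy g * mm w) = ennreal (1 / P w) * ennreal (energy g * V w)"
        using P0[of w] g0 by (subst ennreal_mult'[symmetric]) (auto simp: mm_def V0 less_imp_le)
      also have "\<dots> \<le> ennreal (1 / P w) * (\<integral>\<^sup>+z. ennreal (norm (stft_fun g g (z - w)) * V z) \<partial>lborel)"
        unfolding V_def by (intro mult_left_mono stft_window_change[OF u g g]) simp
      also have "\<dots> = (\<integral>\<^sup>+z. ennreal (1 / P w) * ennreal (norm (stft_fun g g (z - w)) * V z) \<partial>lborel)"
      proof (rule nn_integral_cmult[symmetric])
        have [measurable]: "V \<in> borel_measurable borel" "stft_fun g g \<in> borel_measurable borel"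
          using borel_measurable_continuous_onI[OF stft_continuous[OF u g]] schwartz_measurable[OF schwartz_stft_fun[OF g g]] by (auto simp: V_def)
        show "(\<lambda>z. ennreal (norm (stft_fun g g (z - w)) * V z)) \<in> borel_measurable lborel" by measurable
      qed
      also have "\<dots> \<le> (\<integral>\<^sup>+z. ennreal (C * M powr (1 - q)) * (ennreal (1 / (1 + norm (fst z - fst w)) ^ ?D) *
          (F (snd z) * ennreal ((1 + norm (snd z - \<xi>0)) powr (- real N * q)))) \<partial>lborel)"
      proof (rule nn_integral_mono)
        fix z :: "'a \<times> 'a"
        let ?a = "1 + norm (fst (z - w))" and ?b = "1 + norm (snd (z - w))" and ?c = "1 + norm (snd z - \<xi>0)"
        have pos: "0 < ?a" "0 < ?b" "0 < ?c" by (simp_all add: add_pos_nonneg)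
        \<comment> \<open>Passing from \<open>w\<close> to \<open>z\<close> costs factors free of
          \<open>\<epsilon>\<close>, thanks to \<open>\<epsilon> \<le> 1\<close>. The decay of the
          cross transform of the window absorbs them.\<close>
        have "P z \<le> P w * (?a ^ N * ?b ^ N)"
        proof -
          have "1 + \<epsilon> * norm (fst z) \<le> (1 + \<epsilon> * norm (fst w)) * ?a"
          proof -
            have "\<epsilon> * norm (fst z) \<le> \<epsilon> * (norm (fst w) + norm (fst (z - w)))"
              using \<epsilon> norm_triangle_ineq[of "fst w" "fst z - fst w"] by (intro mult_left_mono) auto
            also have "\<dots> \<le> \<epsilon> * norm (fst w) + norm (fst (z - w))"
              using \<epsilon> mult_right_mono[of \<epsilon> 1 "norm (fst (z - w))"] by (simp add: distrib_left)
            finally have "1 + \<epsilon> * norm (fst z) \<le> 1 + \<epsilon> * norm (fst w) + norm (fst (z - w))" by simp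
            also have "\<dots> \<le> (1 + \<epsilon> * norm (fst w)) * ?a" using \<epsilon> by (simp add: algebra_simps)
            finally show ?thesis .
          qed
          moreover have "?c \<le> (1 + norm (snd w - \<xi>0)) * ?b"
            using norm_1_triangle[of "snd w - \<xi>0" "snd (z - w)"] by simp
          ultimately have "(1 + \<epsilon> * norm (fst z)) ^ N * ?c ^ N \<le> ((1 + \<epsilon> * norm (fst w)) * ?a) ^ N * ((1 + norm (snd w - \<xi>0)) * ?b) ^ N"
            using \<epsilon> by (intro mult_mono power_mono) auto
          then show ?thesis by (simp only: P_def power_mult_distrib mult_ac)
        qed
        \<comment> \<open>One full factor \<open>P z\<close> is kept, to be compared with
          \<open>P w\<close>. The remaining negative power is estimated through the frequency part
          of \<open>P\<close> alone.\<close>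
        have Pq: "P z powr (1 - q) \<le> P z * ?c powr (- real N * q)"
        proof -
          have "?c ^ N \<le> P z"
            unfolding P_def using \<epsilon> pos by (simp add: mult_left_le_one_le one_le_power)
          then have "P z powr (- q) \<le> (?c ^ N) powr (- q)"
            using q pos P0[of z] by (intro powr_mono2') auto
          also have "\<dots> = ?c powr (- real N * q)" using pos by (simp add: powr_realpow[symmetric] powr_powr)
          finally have "P z * P z powr (- q) \<le> P z * ?c powr (- real N * q)" using P0[of z] by (intro mult_left_mono) auto
          moreover have "P z * P z powr (- q) = P z powr (1 - q)"
            using P0[of z] powr_add[of "P z" 1 "- q"] by simp
          ultimately show ?thesis by simp
        qed
        \<comment> \<open>The power \<open>q\<close> of \<open>V\<close> stays in the integral, and
          the rest is bounded by \<open>M\<close> times \<open>P\<close>.\<close>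
        have Vq: "V z \<le> V z powr q * (M powr (1 - q) * P z powr (1 - q))"
        proof (cases "V z = 0")
          case False
          then have "V z = V z powr q * V z powr (1 - q)" using V0[of z] by (simp flip: powr_add)
          also have "V z powr (1 - q) = mm z powr (1 - q) * P z powr (1 - q)"
            using mm0[of z] P0[of z] by (simp add: Vm powr_mult)
          also have "V z powr q * (mm z powr (1 - q) * P z powr (1 - q)) \<le> V z powr q * (M powr (1 - q) * P z powr (1 - q))"
            using q mm0[of z] mM[of z] by (intro mult_left_mono mult_right_mono powr_mono2) auto
          finally show ?thesis .
        qed simp
        let ?G = "C * (1 / ?a ^ (N + ?D)) * (1 / ?b ^ N)"
        have G0: "0 \<le> ?G" using C pos by simp
        have "1 / P w * (norm (stft_fun g g (z - w)) * V z) \<le> 1 / P w * (?G * (V z powr q * (M powr (1 - q) * (P z * ?c powr (- real N * q)))))"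
        proof (intro mult_left_mono mult_mono)
          show "norm (stft_fun g g (z - w)) \<le> ?G" by (rule C)
          show "V z \<le> V z powr q * (M powr (1 - q) * (P z * ?c powr (- real N * q)))"
            by (rule order_trans[OF Vq]) (intro mult_left_mono Pq, auto)
        qed (use G0 V0 P0[of w] in auto)
        also have "\<dots> \<le> 1 / P w * (?G * (V z powr q * (M powr (1 - q) * ((P w * (?a ^ N * ?b ^ N)) * ?c powr (- real N * q)))))"
          using \<open>P z \<le> P w * (?a ^ N * ?b ^ N)\<close> P0[of w] G0 by (intro mult_left_mono mult_right_mono) auto
        also have "\<dots> = (C * M powr (1 - q)) * ((1 / ?a ^ ?D) * (V z powr q * ?c powr (- real N * q)))"
          using P0[of w] pos by (simp add: power_add field_simps)
        finally have "1 / P w * (norm (stft_fun g g (z - w)) * V z) \<le> (C * M powr (1 - q)) * ((1 / ?a ^ ?D) * (V z powr q * ?c powr (- real N * q)))" .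
        then have "ennreal (1 / P w * (norm (stft_fun g g (z - w)) * V z)) \<le> ennreal ((C * M powr (1 - q)) * ((1 / ?a ^ ?D) * (V z powr q * ?c powr (- real N * q))))"
          by (rule ennreal_leI)
        also have "\<dots> = ennreal (C * M powr (1 - q)) * (ennreal (1 / ?a ^ ?D) * (ennreal (V z powr q) * ennreal (?c powr (- real N * q))))"
          by (rule ennreal_mult4) (use C pos in simp_all)
        also have "\<dots> \<le> ennreal (C * M powr (1 - q)) * (ennreal (1 / ?a ^ ?D) * (F (snd z) * ennreal (?c powr (- real N * q))))"
          using F[of "fst z" "snd z"] by (intro mult_left_mono mult_right_mono) (auto simp: V_def)
        finally show "ennreal (1 / P w) * ennreal (norm (stft_fun g g (z - w)) * V z)
          \<le> ennreal (C * M powr (1 - q)) * (ennreal (1 / (1 + norm (fst z - fst w)) ^ ?D) *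
          (F (snd z) * ennreal ((1 + norm (snd z - \<xi>0)) powr (- real N * q))))"
          using P0[of w] V0[of z] by (subst ennreal_mult'[symmetric]) auto
      qed
      also have "\<dots> = ennreal (C * M powr (1 - q)) * ((\<integral>\<^sup>+x. ennreal (1 / (1 + norm (x - fst w)) ^ ?D) \<partial>lborel) *
          (\<integral>\<^sup>+\<xi>. F \<xi> * ennreal ((1 + norm (\<xi> - \<xi>0)) powr (- real N * q)) \<partial>lborel))"
        by (rule nn_integral_prod_lborel) measurable
      also have "\<dots> = ennreal (C * M powr (1 - q) * (J * I))"
        unfolding J I(1) using C J0 I(2) by (simp add: ennreal_mult')
      finally show ?thesis using C J0 I(2) M0 by (subst (asm) ennreal_le_iff) auto
    qed
    \<comment> \<open>\<open>M\<close> is finite by \<open>bddM\<close>, so a nonzero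
      \<open>M\<close> may be divided out of the inequality.\<close>
    have Mq: "M powr q \<le> (C * J / energy g) * I"
    proof (cases "M = 0")
      case True then show ?thesis using C J0 I(2) g0 by simp
    next
      case False
      then have Mp: "0 < M" using M0 by simp
      have "M \<le> (C * M powr (1 - q) * (J * I)) / energy g"
        unfolding M_def
      proof (rule cSUP_least)
        fix z show "mm z \<le> (C * (SUP z. mm z) powr (1 - q) * (J * I)) / energy g"
          using step[of z] g0 by (simp add: M_def field_simps)
      qed simp
      then have "M powr (q - 1) * M \<le> M powr (q - 1) * ((C * M powr (1 - q) * (J * I)) / energy g)"
        by (intro mult_left_mono) auto
      moreover have "M powr (q - 1) * M = M powr q" using Mp powr_add[of M "q - 1" 1] by simp
      moreover have "M powr (q - 1) * M powr (1 - q) = 1" using Mp by (simp flip: powr_add)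
      then have "M powr (q - 1) * ((C * M powr (1 - q) * (J * I)) / energy g) = C * J / energy g * I"
        by (simp add: mult_ac)
      ultimately show ?thesis by (simp only:)
    qed
    have "V (x, \<xi>) powr q = mm (x, \<xi>) powr q * P (x, \<xi>) powr q"
      using mm0[of "(x, \<xi>)"] P0[of "(x, \<xi>)"] by (simp add: Vm powr_mult)
    also have "\<dots> \<le> M powr q * P (x, \<xi>) powr q"
      using q mm0 mM by (intro mult_right_mono powr_mono2) auto
    also have "\<dots> \<le> (C * J / energy g) * I * P (x, \<xi>) powr q" by (intro mult_right_mono Mq) auto
    finally show ?thesis by (simp add: P_def)
  qed
  show ?thesis
  proof (rule that[of "C * J / energy g"])
    show "0 \<le> C * J / energy g" using C J0 g0 by simp
    fix x \<xi> \<xi>0 :: 'a and I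
    assume I: "(\<integral>\<^sup>+\<xi>. F \<xi> * ennreal ((1 + norm (\<xi> - \<xi>0)) powr (- real N * q)) \<partial>lborel) = ennreal I" "0 \<le> I"
    let ?e = "\<lambda>n. 1 / real (Suc n)"
    have c0: "?e \<longlonglongrightarrow> 0" by (rule lim_1_over_n[THEN LIMSEQ_Suc])
    have "(\<lambda>n. (C * J / energy g) * I * ((1 + ?e n * norm x) ^ N * (1 + norm (\<xi> - \<xi>0)) ^ N) powr q)
       \<longlonglongrightarrow> (C * J / energy g) * I * ((1 + 0 * norm x) ^ N * (1 + norm (\<xi> - \<xi>0)) ^ N) powr q"
      by (intro tendsto_intros c0) (auto simp: add_nonneg_eq_0_iff)
    then have "V (x, \<xi>) powr q \<le> (C * J / energy g) * I * ((1 + 0 * norm x) ^ N * (1 + norm (\<xi> - \<xi>0)) ^ N) powr q"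
      by (rule LIMSEQ_le_const) (intro exI[of _ 0] allI impI main[OF I], auto)
    moreover have "((1 + norm (\<xi> - \<xi>0)) ^ N) powr q = (1 + norm (\<xi> - \<xi>0)) powr (real N * q)"
      by (simp add: powr_realpow[symmetric] powr_powr add_pos_nonneg)
    ultimately show "norm (stft g u (x, \<xi>)) powr q \<le> C * J / energy g * I * (1 + norm (\<xi> - \<xi>0)) powr (real N * q)"
      by (simp add: V_def)
  qed
qed

text \<open>If the integral is finite, \<open>stft_peetre_bound\<close> says that the transform with
  window \<open>g\<close> grows at most like the \<open>N\<close>-th power of the distance of the
  frequency from \<open>\<xi>0\<close>. The rapid decay of the cross transform of the two windows
  integrates this growth.\<close>

lemma stft_window_bound:
  fixes g g' :: "'a::euclidean_space \<Rightarrow> complex"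
  assumes u: "u \<in> tempered" and g: "g \<in> schwartz" and g0: "0 < energy g" and g': "g' \<in> schwartz"
    and q: "0 < q" "q \<le> 1"
    and growth: "\<And>z. norm (stft g u z) \<le> C0 * (1 + norm z) ^ N"
    and Fm: "F \<in> borel_measurable borel"
    and F: "\<And>x \<xi>. ennreal (norm (stft g u (x, \<xi>)) powr q) \<le> F \<xi>"
  obtains K where "0 < K" "\<And>x \<xi>0. ennreal (norm (stft g' u (x, \<xi>0)) powr q)
      \<le> ennreal K * (\<integral>\<^sup>+\<xi>. F \<xi> * ennreal ((1 + norm (\<xi> - \<xi>0)) powr (- real N * q)) \<partial>lborel)"
proof -
  let ?D = "2 * DIM('a)"
  obtain K where K: "0 \<le> K" "\<And>x \<xi> \<xi>0 I. (\<integral>\<^sup>+\<xi>. F \<xi> * ennreal ((1 + norm (\<xi> - \<xi>0)) powr (- real N * q)) \<partial>lborel) = ennreal I \<Longrightarrow> 0 \<le> I \<Longrightarrow>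
     norm (stft g u (x, \<xi>)) powr q \<le> K * I * (1 + norm (\<xi> - \<xi>0)) powr (real N * q)"
    by (rule stft_peetre_bound[OF u g g0 q growth Fm F]) blast
  obtain C where C: "0 \<le> C" "\<And>z. norm (stft_fun g g' z) \<le> C * (1 / (1 + norm (fst z)) ^ ?D) * (1 / (1 + norm (snd z)) ^ (N + ?D))"
    by (rule stft_fun_decay[OF g g']) blast
  define J where "J = (\<integral>x. 1 / (1 + norm (x::'a)) ^ ?D \<partial>lborel)"
  have J0: "0 \<le> J" by (simp add: J_def)
  have J: "(\<integral>\<^sup>+x. ennreal (1 / (1 + norm (x - y::'a)) ^ ?D) \<partial>lborel) = ennreal J" for y
    unfolding J_def by (rule nn_integral_weight_translate)
  define B where "B = (C * (J * J) / energy g) powr q * K"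
  have B0: "0 \<le> B" using K by (simp add: B_def)
  \<comment> \<open>Adding 1 keeps the constant positive, so the right side is infinite and the
    bound trivial when the integral diverges.\<close>
  have bound: "ennreal (norm (stft g' u (x, \<xi>0)) powr q)
      \<le> ennreal (B + 1) * (\<integral>\<^sup>+\<xi>. F \<xi> * ennreal ((1 + norm (\<xi> - \<xi>0)) powr (- real N * q)) \<partial>lborel)" (is "_ \<le> _ * ?I") for x \<xi>0
  proof (cases "?I = \<infinity>")
    case True then show ?thesis using B0 by (simp add: ennreal_mult_top ennreal_top_mult)
  next
    case False
    then obtain I where I: "?I = ennreal I" "0 \<le> I" by (cases ?I) auto
    define T where "T = (K * I) powr (1 / q)"
    have V: "norm (stft g u z) \<le> T * (1 + norm (snd z - \<xi>0)) ^ N" for z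
    proof -
      have c: "0 < 1 + norm (snd z - \<xi>0)" by (simp add: add_pos_nonneg)
      have "norm (stft g u z) = (norm (stft g u z) powr q) powr (1 / q)" using q by (simp add: powr_powr)
      also have "\<dots> \<le> (K * I * (1 + norm (snd z - \<xi>0)) powr (real N * q)) powr (1 / q)"
        using K(2)[OF I, of "fst z" "snd z"] q by (intro powr_mono2) auto
      also have "\<dots> = T * ((1 + norm (snd z - \<xi>0)) powr (real N * q)) powr (1 / q)"
        using K I by (simp add: T_def powr_mult)
      also have "((1 + norm (snd z - \<xi>0)) powr (real N * q)) powr (1 / q) = (1 + norm (snd z - \<xi>0)) ^ N"
        using q c by (simp add: powr_powr powr_realpow)
      finally show ?thesis .
    qed
    have T0: "0 \<le> T" by (simp add: T_def)
    let ?w = "(x, \<xi>0)"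
    have "ennreal (energy g * norm (stft g' u ?w)) \<le> (\<integral>\<^sup>+z. ennreal (norm (stft_fun g g' (z - ?w)) * norm (stft g u z)) \<partial>lborel)"
      by (rule stft_window_change[OF u g g'])
    also have "\<dots> \<le> (\<integral>\<^sup>+z. ennreal (C * T) * (ennreal (1 / (1 + norm (fst z - x)) ^ ?D) * ennreal (1 / (1 + norm (snd z - \<xi>0)) ^ ?D)) \<partial>lborel)"
    proof (rule nn_integral_mono)
      fix z :: "'a \<times> 'a"
      have pos: "0 < 1 + norm (fst z - x)" "0 < 1 + norm (snd z - \<xi>0)" by (simp_all add: add_pos_nonneg)
      have "norm (stft_fun g g' (z - ?w)) * norm (stft g u z)
        \<le> (C * (1 / (1 + norm (fst z - x)) ^ ?D) * (1 / (1 + norm (snd z - \<xi>0)) ^ (N + ?D))) * (T * (1 + norm (snd z - \<xi>0)) ^ N)"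
        using C(2)[of "z - ?w"] V[of z] C(1) by (intro mult_mono) auto
      also have "\<dots> = (C * T) * ((1 / (1 + norm (fst z - x)) ^ ?D) * (1 / (1 + norm (snd z - \<xi>0)) ^ ?D))"
        using pos by (simp add: power_add field_simps)
      finally have "ennreal (norm (stft_fun g g' (z - ?w)) * norm (stft g u z)) \<le> ennreal ((C * T) * ((1 / (1 + norm (fst z - x)) ^ ?D) * (1 / (1 + norm (snd z - \<xi>0)) ^ ?D)))"
        by (rule ennreal_leI)
      also have "\<dots> = ennreal (C * T) * (ennreal (1 / (1 + norm (fst z - x)) ^ ?D) * ennreal (1 / (1 + norm (snd z - \<xi>0)) ^ ?D))"
        by (rule ennreal_mult3) (use C T0 in simp_all)
      finally show "ennreal (norm (stft_fun g g' (z - ?w)) * norm (stft g u z)) \<le> ennreal (C * T) * (ennreal (1 / (1 + norm (fst z - x)) ^ ?D) * ennreal (1 / (1 + norm (snd z - \<xi>0)) ^ ?D))" .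
    qed
    also have "\<dots> = ennreal (C * T) * ((\<integral>\<^sup>+y. ennreal (1 / (1 + norm (y - x)) ^ ?D) \<partial>lborel) * (\<integral>\<^sup>+y. ennreal (1 / (1 + norm (y - \<xi>0)) ^ ?D) \<partial>lborel))"
      by (rule nn_integral_prod_lborel) measurable
    also have "\<dots> = ennreal (C * T * (J * J))"
      unfolding J using C J0 T0 by (simp add: ennreal_mult')
    finally have "energy g * norm (stft g' u ?w) \<le> C * T * (J * J)"
      using C J0 T0 by (subst (asm) ennreal_le_iff) auto
    then have "norm (stft g' u ?w) \<le> (C * (J * J) / energy g) * T" using g0 by (simp add: field_simps)
    then have "norm (stft g' u ?w) powr q \<le> ((C * (J * J) / energy g) * T) powr q" using q by (intro powr_mono2) auto
    also have "\<dots> = (C * (J * J) / energy g) powr q * T powr q"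
      by (rule powr_mult)
    also have "T powr q = K * I" using q K I by (simp add: T_def powr_powr)
    finally have "norm (stft g' u ?w) powr q \<le> B * I" by (simp add: B_def mult.assoc)
    also have "\<dots> \<le> (B + 1) * I" using I by (intro mult_right_mono) auto
    finally have "ennreal (norm (stft g' u ?w) powr q) \<le> ennreal ((B + 1) * I)" by (rule ennreal_leI)
    also have "\<dots> = ennreal (B + 1) * ?I" unfolding I(1) using B0 I(2) by (intro ennreal_mult) auto
    finally show ?thesis .
  qed
  show ?thesis by (rule that[OF _ bound]) (use B0 in simp)
qed

section \<open>Polynomial weights under convolution and linear maps\<close>

lemma v_weight_pos: "0 < v_weight s z"
proof -
  have "0 < 1 + (norm z)\<^sup>2" by (simp add: add_pos_nonneg)
  then show ?thesis by (simp add: v_weight_def)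
qed

lemma square_weight_powr: "((1 + norm z)\<^sup>2) powr (s / 2) = (1 + norm z) powr s"
proof -
  have "(1 + norm z)\<^sup>2 = (1 + norm z) powr 2" by (subst powr_numeral) (simp_all add: add_pos_nonneg)
  then show ?thesis by (simp only: powr_powr) simp
qed

lemma v_weight_le: "0 \<le> s \<Longrightarrow> v_weight s z \<le> (1 + norm z) powr s"
proof -
  assume s: "0 \<le> s"
  have "1 + (norm z)\<^sup>2 \<le> (1 + norm z)\<^sup>2" by (simp add: power2_sum)
  then have "(1 + (norm z)\<^sup>2) powr (s / 2) \<le> ((1 + norm z)\<^sup>2) powr (s / 2)"
    using s by (intro powr_mono2) (auto intro: add_nonneg_nonneg)
  also have "\<dots> = (1 + norm z) powr s"
    by (rule square_weight_powr)
  finally show ?thesis by (simp add: v_weight_def)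
qed

lemma v_weight_ge: "0 \<le> s \<Longrightarrow> (1 + norm z) powr s \<le> 2 powr (s / 2) * v_weight s z"
proof -
  assume s: "0 \<le> s"
  have "(1 + norm z)\<^sup>2 \<le> 2 * (1 + (norm z)\<^sup>2)"
    using zero_le_power2[of "norm z - 1"] by (simp add: power2_eq_square algebra_simps)
  then have "((1 + norm z)\<^sup>2) powr (s / 2) \<le> (2 * (1 + (norm z)\<^sup>2)) powr (s / 2)"
    using s by (intro powr_mono2) auto
  moreover have "((1 + norm z)\<^sup>2) powr (s / 2) = (1 + norm z) powr s"
    by (rule square_weight_powr)
  ultimately show ?thesis by (simp only: v_weight_def powr_mult)
qed

text \<open>With \<open>\<xi> = R \<eta>\<close> the kernel decays in
  \<open>\<zeta> - \<eta>\<close>, and moving the weight from \<open>\<zeta>\<close> to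
  \<open>\<xi>\<close> costs \<open>s\<close> powers of \<open>1 + norm (\<zeta> - \<eta>)\<close>.
  The hypothesis on \<open>N\<close> leaves enough powers for integrability.\<close>

lemma v_weight_convolution:
  fixes R :: "'a::euclidean_space \<Rightarrow> 'a"
  assumes R: "linear R" "inj R" and s: "0 \<le> s" and q: "0 < q" and N: "s * q + real (2 * DIM('a)) \<le> real N * q"
  obtains C where "0 \<le> C" "\<And>\<xi>. (\<integral>\<^sup>+\<zeta>. ennreal ((1 + norm (\<xi> - R \<zeta>)) powr (- real N * q)) * ennreal (v_weight s \<zeta> powr q) \<partial>lborel)
     \<le> ennreal C * ennreal (v_weight s \<xi> powr q)"
proof -
  obtain \<kappa> where \<kappa>: "\<And>x. norm x \<le> \<kappa> * norm (R x)" by (rule linear_inj_bound[OF R]) blast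
  \<comment> \<open>A constant of at least 1 allows comparing \<open>1 + norm x\<close> with
    \<open>1 + norm (R x)\<close> as well.\<close>
  define k where "k = max 1 \<kappa>"
  have k1: "1 \<le> k" by (simp add: k_def)
  have kR: "1 + norm x \<le> k * (1 + norm (R x))" for x
  proof -
    have "norm x \<le> k * norm (R x)"
      by (rule order_trans[OF \<kappa>]) (auto simp: k_def intro!: mult_right_mono)
    then show ?thesis using k1 by (simp add: distrib_left)
  qed
  define J where "J = (\<integral>x. 1 / (1 + norm (x::'a)) ^ (2 * DIM('a)) \<partial>lborel)"
  have J0: "0 \<le> J" by (simp add: J_def)
  define A where "A = k powr (real N * q) * (k powr s * 2 powr (s / 2)) powr q"
  have A0: "0 \<le> A" by (simp add: A_def)
  show ?thesis
  proof (rule that[of "A * J"])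
    show "0 \<le> A * J" using A0 J0 by simp
    fix \<xi>
    have "surj R" using linear_injective_imp_surjective[OF R] by simp
    then obtain \<eta> where \<eta>: "\<xi> = R \<eta>" by (rule surjE)
    have pt: "(1 + norm (\<xi> - R \<zeta>)) powr (- real N * q) * v_weight s \<zeta> powr q
        \<le> A * v_weight s \<xi> powr q * (1 / (1 + norm (\<zeta> - \<eta>)) ^ (2 * DIM('a)))" for \<zeta>
    proof -
      let ?m = "1 + norm (\<zeta> - \<eta>)"
      have m1: "1 \<le> ?m" by simp
      have "?m \<le> k * (1 + norm (\<xi> - R \<zeta>))"
        using kR[of "\<eta> - \<zeta>"] by (simp add: \<eta> linear_diff[OF R(1)] norm_minus_commute)
      then have "?m / k \<le> 1 + norm (\<xi> - R \<zeta>)" using k1 by (simp add: field_simps)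
      then have "(1 + norm (\<xi> - R \<zeta>)) powr (- real N * q) \<le> (?m / k) powr (- real N * q)"
        using q divide_pos_pos[OF less_le_trans[OF zero_less_one m1] less_le_trans[OF zero_less_one k1]]
        by (intro powr_mono2') auto
      also have "\<dots> = k powr (real N * q) * ?m powr (- real N * q)"
        using k1 m1 by (simp add: powr_divide powr_minus field_simps)
      finally have 1: "(1 + norm (\<xi> - R \<zeta>)) powr (- real N * q) \<le> k powr (real N * q) * ?m powr (- real N * q)" .
      have "v_weight s \<zeta> \<le> (1 + norm \<zeta>) powr s" by (rule v_weight_le[OF s])
      also have "\<dots> \<le> ((k * (1 + norm \<xi>)) * ?m) powr s"
      proof (rule powr_mono2[OF s])
        have "1 + norm \<zeta> \<le> (1 + norm \<eta>) * ?m" using norm_1_triangle[of \<eta> "\<zeta> - \<eta>"] by simp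
        also have "\<dots> \<le> (k * (1 + norm \<xi>)) * ?m" using kR[of \<eta>] by (intro mult_right_mono) (simp_all add: \<eta>)
        finally show "1 + norm \<zeta> \<le> (k * (1 + norm \<xi>)) * ?m" .
      qed simp
      also have "\<dots> = k powr s * (1 + norm \<xi>) powr s * ?m powr s" by (simp only: powr_mult)
      also have "\<dots> \<le> k powr s * (2 powr (s / 2) * v_weight s \<xi>) * ?m powr s"
        by (intro mult_left_mono mult_right_mono v_weight_ge s) auto
      finally have "v_weight s \<zeta> powr q \<le> (k powr s * (2 powr (s / 2) * v_weight s \<xi>) * ?m powr s) powr q"
        using q v_weight_pos[of s \<zeta>] by (intro powr_mono2) auto
      also have "\<dots> = (k powr s * 2 powr (s / 2)) powr q * v_weight s \<xi> powr q * ?m powr (s * q)"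
        by (simp only: powr_mult powr_powr mult.assoc)
      finally have 2: "v_weight s \<zeta> powr q \<le> (k powr s * 2 powr (s / 2)) powr q * v_weight s \<xi> powr q * ?m powr (s * q)" .
      have "(1 + norm (\<xi> - R \<zeta>)) powr (- real N * q) * v_weight s \<zeta> powr q
        \<le> (k powr (real N * q) * ?m powr (- real N * q)) * ((k powr s * 2 powr (s / 2)) powr q * v_weight s \<xi> powr q * ?m powr (s * q))"
        by (intro mult_mono 1 2) auto
      also have "\<dots> = A * v_weight s \<xi> powr q * (?m powr (- real N * q) * ?m powr (s * q))"
        by (simp only: A_def mult_ac)
      also have "?m powr (- real N * q) * ?m powr (s * q) = ?m powr (s * q - real N * q)"
        by (simp flip: powr_add)
      also have "\<dots> \<le> ?m powr (- real (2 * DIM('a)))" using N m1 by (intro powr_mono) auto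
      also have "\<dots> = 1 / ?m ^ (2 * DIM('a))"
        by (simp only: powr_minus powr_realpow[OF less_le_trans[OF zero_less_one m1]] divide_inverse mult_1_left)
      finally show ?thesis using A0 by (simp add: mult_left_mono)
    qed
    have "(\<integral>\<^sup>+\<zeta>. ennreal ((1 + norm (\<xi> - R \<zeta>)) powr (- real N * q)) * ennreal (v_weight s \<zeta> powr q) \<partial>lborel)
       \<le> (\<integral>\<^sup>+\<zeta>. ennreal (A * v_weight s \<xi> powr q) * ennreal (1 / (1 + norm (\<zeta> - \<eta>)) ^ (2 * DIM('a))) \<partial>lborel)"
    proof (rule nn_integral_mono)
      fix \<zeta>
      show "ennreal ((1 + norm (\<xi> - R \<zeta>)) powr (- real N * q)) * ennreal (v_weight s \<zeta> powr q)
        \<le> ennreal (A * v_weight s \<xi> powr q) * ennreal (1 / (1 + norm (\<zeta> - \<eta>)) ^ (2 * DIM('a)))"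
        using ennreal_leI[OF pt[of \<zeta>]] A0 by (simp add: ennreal_mult'[symmetric])
    qed
    also have "\<dots> = ennreal (A * v_weight s \<xi> powr q) * ennreal J"
      by (subst nn_integral_cmult) (simp_all add: nn_integral_weight_translate J_def)
    also have "\<dots> = ennreal (A * J) * ennreal (v_weight s \<xi> powr q)"
      using A0 J0 by (simp add: ennreal_mult'[symmetric] mult_ac)
    finally show "(\<integral>\<^sup>+\<zeta>. ennreal ((1 + norm (\<xi> - R \<zeta>)) powr (- real N * q)) * ennreal (v_weight s \<zeta> powr q) \<partial>lborel)
     \<le> ennreal (A * J) * ennreal (v_weight s \<xi> powr q)" .
  qed
qed

section \<open>Transfer of membership between modulation spaces\<close>

lemma ennpowr_ge: "0 \<le> a \<Longrightarrow> 0 \<le> q \<Longrightarrow> ennreal a \<le> x \<Longrightarrow> ennreal (a powr q) \<le> ennpowr x q"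
  by (cases x) (auto simp: ennpowr_def intro!: ennreal_leI powr_mono2)

lemma ennpowr_finite_iff: "ennpowr x r < \<infinity> \<longleftrightarrow> x < \<infinity>"
  by (cases x) (auto simp: ennpowr_def)

lemma modulation_qnorm_finite_iff:
  assumes "0 < q"
  shows "modulation_qnorm g \<infinity> (ennreal q) m u < \<infinity> \<longleftrightarrow>
    (\<integral>\<^sup>+\<xi>. ennpowr (esssup lborel (\<lambda>x. ennreal (norm (stft g u (x, \<xi>)) * m (x, \<xi>)))) q \<partial>lborel) < \<infinity>"
  using assms by (simp only: modulation_qnorm_def Lp_qnorm_def ennpowr_finite_iff if_True refl)
    (simp add: ennpowr_finite_iff[unfolded infinity_ennreal_def])

text \<open>The norm takes a supremum over positions, so \<open>y'\<close> may depend on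
  \<open>y\<close> and \<open>\<zeta>\<close> in any way. With \<open>u' = u\<close>,
  \<open>R\<close> the identity, \<open>g1 = G\<close> and \<open>c = 1\<close> this is independence
  of the window.\<close>

theorem modulation_space_transfer:
  fixes u u' :: "'a::euclidean_space distr"
  assumes u: "u \<in> modulation_space g \<infinity> (ennreal q) (one_tensor_v s)" and u': "u' \<in> tempered"
    and g: "g \<in> schwartz" and g0: "g \<noteq> (\<lambda>_. 0)" and g1: "g1 \<in> schwartz" and G: "G \<in> schwartz"
    and q: "0 < q" "q \<le> 1" and s: "0 \<le> s"
    and R: "linear R" "inj R" and c: "0 \<le> c"
    and rel: "\<And>y \<zeta>. \<exists>y'. norm (stft G u' (y, \<zeta>)) \<le> c * norm (stft g1 u (y', R \<zeta>))"
  shows "u' \<in> modulation_space G \<infinity> (ennreal q) (one_tensor_v s)"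
proof -
  let ?v = "v_weight s :: 'a \<Rightarrow> real"
  have ut: "u \<in> tempered" using u by (simp add: modulation_space_def)
  obtain x0 where "g x0 \<noteq> 0" using g0 by auto
  then have eg: "0 < energy g" by (rule energy_pos[OF g])
  define E where "E = (\<lambda>\<xi>. esssup lborel (\<lambda>x. ennreal (norm (stft g u (x, \<xi>)) * ?v \<xi>)))"
  have Efin: "(\<integral>\<^sup>+\<xi>. ennpowr (E \<xi>) q \<partial>lborel) < \<infinity>"
    using u by (simp only: modulation_space_def mem_Collect_eq modulation_qnorm_finite_iff[OF q(1)] E_def one_tensor_v_def prod.case)
  note cont = stft_continuous[OF ut g]
  have contx: "continuous_on UNIV (\<lambda>x. stft g u (x, \<xi>))" for \<xi>
    by (rule continuous_on_compose2[OF cont]) (auto intro!: continuous_intros)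
  have contxi: "continuous_on UNIV (\<lambda>\<xi>. stft g u (x, \<xi>))" for x
    by (rule continuous_on_compose2[OF cont]) (auto intro!: continuous_intros)
  \<comment> \<open>A countable supremum is measurable, and by continuity in \<open>x\<close> the
    one over a dense set already bounds all positions.\<close>
  obtain D :: "'a set" where D: "countable D" "\<And>X. open X \<Longrightarrow> X \<noteq> {} \<Longrightarrow> \<exists>d\<in>D. d \<in> X"
    by (erule countable_dense_setE)
  define F where "F = (\<lambda>\<xi>. SUP x\<in>D. ennreal (norm (stft g u (x, \<xi>)) powr q))"
  have Fm [measurable]: "F \<in> borel_measurable borel"
    unfolding F_def
  proof (rule borel_measurable_SUP[OF D(1)])
    fix x
    have [measurable]: "(\<lambda>\<xi>. stft g u (x, \<xi>)) \<in> borel_measurable borel" using contxi by (rule borel_measurable_continuous_onI)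
    show "(\<lambda>\<xi>. ennreal (norm (stft g u (x, \<xi>)) powr q)) \<in> borel_measurable borel" by measurable
  qed
  have FV: "ennreal (norm (stft g u (x, \<xi>)) powr q) \<le> F \<xi>" for x \<xi>
  proof (rule ccontr)
    let ?X = "{x. F \<xi> < ennreal (norm (stft g u (x, \<xi>)) powr q)}"
    assume "\<not> ennreal (norm (stft g u (x, \<xi>)) powr q) \<le> F \<xi>"
    then have "?X \<noteq> {}" by (auto simp: not_le)
    moreover have "open ?X"
    proof (rule open_Collect_less)
      show "continuous_on UNIV (\<lambda>x. ennreal (norm (stft g u (x, \<xi>)) powr q))"
        by (intro continuous_on_ennreal continuous_on_powr' continuous_on_norm contx continuous_on_const) (use q in auto)
    qed simp
    ultimately obtain d where "d \<in> D" "d \<in> ?X" using D(2) by blast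
    then show False unfolding F_def by (auto simp: not_le[symmetric] intro: SUP_upper2)
  qed
  have FE: "F \<xi> * ennreal (?v \<xi> powr q) \<le> ennpowr (E \<xi>) q" for \<xi>
  proof -
    have VE: "ennreal (norm (stft g u (x, \<xi>)) * ?v \<xi>) \<le> E \<xi>" for x
    proof (rule AE_lborel_open[where P = "\<lambda>x. ennreal (norm (stft g u (x, \<xi>)) * ?v \<xi>) \<le> E \<xi>"])
      show "AE x in lborel. ennreal (norm (stft g u (x, \<xi>)) * ?v \<xi>) \<le> E \<xi>"
        unfolding E_def by (rule esssup_AE)
      show "open {x. \<not> ennreal (norm (stft g u (x, \<xi>)) * ?v \<xi>) \<le> E \<xi>}"
        unfolding not_le
      proof (rule open_Collect_less)
        show "continuous_on UNIV (\<lambda>x. ennreal (norm (stft g u (x, \<xi>)) * ?v \<xi>))"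
          by (intro continuous_on_ennreal continuous_on_mult continuous_on_norm contx continuous_on_const)
      qed simp
    qed
    have "F \<xi> * ennreal (?v \<xi> powr q) = (SUP x\<in>D. ennreal (norm (stft g u (x, \<xi>)) powr q) * ennreal (?v \<xi> powr q))"
      unfolding F_def by (rule SUP_mult_right_ennreal)
    also have "\<dots> \<le> ennpowr (E \<xi>) q"
    proof (rule SUP_least)
      fix x
      have "ennreal ((norm (stft g u (x, \<xi>)) * ?v \<xi>) powr q) \<le> ennpowr (E \<xi>) q"
        using q v_weight_pos[of s \<xi>] by (intro ennpowr_ge VE) auto
      then show "ennreal (norm (stft g u (x, \<xi>)) powr q) * ennreal (?v \<xi> powr q) \<le> ennpowr (E \<xi>) q"
        by (simp add: powr_mult ennreal_mult')
    qed
    finally show ?thesis .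
  qed
  have Ffin: "(\<integral>\<^sup>+\<xi>. F \<xi> * ennreal (?v \<xi> powr q) \<partial>lborel) < \<infinity>"
    by (rule le_less_trans[OF nn_integral_mono[OF FE] Efin])
  obtain C0 N0 where growth0: "0 \<le> C0" "\<And>z. norm (stft g u z) \<le> C0 * (1 + norm z) ^ N0"
    by (rule stft_growth[OF ut g]) blast
  \<comment> \<open>Large enough for the growth of the transform of \<open>u\<close> and for the
    convolution with the weight; the growth bound survives a larger exponent.\<close>
  define N where "N = max N0 (nat \<lceil>s + real (2 * DIM('a)) / q\<rceil>)"
  have growth: "norm (stft g u z) \<le> C0 * (1 + norm z) ^ N" for z
    by (rule order_trans[OF growth0(2) mult_left_mono[OF weight_mono growth0(1)]]) (simp add: N_def)
  have "s + real (2 * DIM('a)) / q \<le> real N" unfolding N_def by linarith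
  then have N: "s * q + real (2 * DIM('a)) \<le> real N * q" using q by (simp add: field_simps)
  define I where "I = (\<lambda>\<xi>0. \<integral>\<^sup>+\<xi>. F \<xi> * ennreal ((1 + norm (\<xi> - \<xi>0)) powr (- real N * q)) \<partial>lborel)"
  obtain K where K: "0 < K" "\<And>x \<xi>0. ennreal (norm (stft g1 u (x, \<xi>0)) powr q) \<le> ennreal K * I \<xi>0"
    unfolding I_def by (rule stft_window_bound[OF ut g eg g1 q growth Fm FV]) blast
  define E' where "E' = (\<lambda>\<zeta>. esssup lborel (\<lambda>y. ennreal (norm (stft G u' (y, \<zeta>)) * ?v \<zeta>)))"
  \<comment> \<open>If the right side is infinite there is nothing to prove. Otherwise
    \<open>q\<close>-th roots give a bound for every position, which passes to the essential
    supremum.\<close>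
  have E'le: "ennpowr (E' \<zeta>) q \<le> ennreal (c powr q * K) * (I (R \<zeta>) * ennreal (?v \<zeta> powr q))" for \<zeta>
  proof (cases "ennreal (c powr q * K) * (I (R \<zeta>) * ennreal (?v \<zeta> powr q))")
    case (real z)
    have pt: "norm (stft G u' (y, \<zeta>)) * ?v \<zeta> \<le> z powr (1 / q)" for y
    proof -
      obtain y' where y': "norm (stft G u' (y, \<zeta>)) \<le> c * norm (stft g1 u (y', R \<zeta>))" using rel by blast
      have "(norm (stft G u' (y, \<zeta>)) * ?v \<zeta>) powr q \<le> (c * norm (stft g1 u (y', R \<zeta>)) * ?v \<zeta>) powr q"
        using q v_weight_pos[of s \<zeta>] y' by (intro powr_mono2 mult_right_mono) auto
      also have "\<dots> = c powr q * (norm (stft g1 u (y', R \<zeta>)) powr q * ?v \<zeta> powr q)" by (simp only: powr_mult mult.assoc)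
      finally have "ennreal ((norm (stft G u' (y, \<zeta>)) * ?v \<zeta>) powr q) \<le> ennreal (c powr q * (norm (stft g1 u (y', R \<zeta>)) powr q * ?v \<zeta> powr q))"
        by (rule ennreal_leI)
      also have "\<dots> = ennreal (c powr q) * (ennreal (norm (stft g1 u (y', R \<zeta>)) powr q) * ennreal (?v \<zeta> powr q))"
        by (rule ennreal_mult3) auto
      also have "\<dots> \<le> ennreal (c powr q) * ((ennreal K * I (R \<zeta>)) * ennreal (?v \<zeta> powr q))"
        by (intro mult_left_mono mult_right_mono K) auto
      also have "\<dots> = ennreal (c powr q * K) * (I (R \<zeta>) * ennreal (?v \<zeta> powr q))"
        using K by (simp add: ennreal_mult' mult.assoc)
      also have "\<dots> = ennreal z" by (rule real(2))
      finally have "(norm (stft G u' (y, \<zeta>)) * ?v \<zeta>) powr q \<le> z" using real(1) by (subst (asm) ennreal_le_iff)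
      then have "((norm (stft G u' (y, \<zeta>)) * ?v \<zeta>) powr q) powr (1 / q) \<le> z powr (1 / q)"
        using q by (intro powr_mono2) auto
      then show ?thesis using q v_weight_pos[of s \<zeta>] by (simp add: powr_powr less_imp_le)
    qed
    have "E' \<zeta> \<le> ennreal (z powr (1 / q))"
      unfolding E'_def
    proof (rule esssup_I)
      have "continuous_on UNIV (\<lambda>x. stft G u' (x, \<zeta>))"
        by (rule continuous_on_compose2[OF stft_continuous[OF u' G]]) (auto intro!: continuous_intros)
      then have [measurable]: "(\<lambda>x. stft G u' (x, \<zeta>)) \<in> borel_measurable borel" by (rule borel_measurable_continuous_onI)
      show "(\<lambda>y. ennreal (norm (stft G u' (y, \<zeta>)) * ?v \<zeta>)) \<in> borel_measurable lborel" by measurable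
      show "AE y in lborel. ennreal (norm (stft G u' (y, \<zeta>)) * ?v \<zeta>) \<le> ennreal (z powr (1 / q))"
        by (intro AE_I2 ennreal_leI pt)
    qed
    then obtain e where e: "E' \<zeta> = ennreal e" "0 \<le> e" "e \<le> z powr (1 / q)"
      by (cases "E' \<zeta>") (auto simp: top_unique)
    have "e powr q \<le> (z powr (1 / q)) powr q" using e q by (intro powr_mono2) auto
    also have "\<dots> = z" using q real(1) by (simp add: powr_powr)
    finally show ?thesis unfolding real(2) using e by (simp add: ennpowr_def ennreal_leI)
  qed simp
  obtain C where C: "0 \<le> C" "\<And>\<xi>. (\<integral>\<^sup>+\<zeta>. ennreal ((1 + norm (\<xi> - R \<zeta>)) powr (- real N * q)) * ennreal (?v \<zeta> powr q) \<partial>lborel)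
     \<le> ennreal C * ennreal (?v \<xi> powr q)"
    by (rule v_weight_convolution[OF R s q(1) N]) blast
  have [measurable]: "R \<in> borel_measurable borel"
    by (rule borel_measurable_continuous_onI) (rule linear_continuous_on, use R in \<open>simp add: linear_conv_bounded_linear\<close>)
  have [measurable]: "?v \<in> borel_measurable borel" unfolding v_weight_def[abs_def] by measurable
  have "(\<integral>\<^sup>+\<zeta>. I (R \<zeta>) * ennreal (?v \<zeta> powr q) \<partial>lborel)
     = (\<integral>\<^sup>+\<zeta>. \<integral>\<^sup>+\<xi>. F \<xi> * (ennreal ((1 + norm (\<xi> - R \<zeta>)) powr (- real N * q)) * ennreal (?v \<zeta> powr q)) \<partial>lborel \<partial>lborel)"
    unfolding I_def by (subst nn_integral_multc[symmetric]) (simp_all add: mult.assoc)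
  \<comment> \<open>After the interchange the inner integral over \<open>\<zeta>\<close> only
    contains the kernel and the weight, and the convolution bound moves the weight to
    \<open>\<xi>\<close>, where it meets \<open>F\<close>.\<close>
  also have "\<dots> = (\<integral>\<^sup>+\<xi>. \<integral>\<^sup>+\<zeta>. F \<xi> * (ennreal ((1 + norm (\<xi> - R \<zeta>)) powr (- real N * q)) * ennreal (?v \<zeta> powr q)) \<partial>lborel \<partial>lborel)"
    by (rule lborel_pair.Fubini') measurable
  also have "\<dots> \<le> (\<integral>\<^sup>+\<xi>. F \<xi> * (ennreal C * ennreal (?v \<xi> powr q)) \<partial>lborel)"
    by (intro nn_integral_mono) (subst nn_integral_cmult, measurable, intro mult_left_mono C, simp)
  also have "\<dots> = ennreal C * (\<integral>\<^sup>+\<xi>. F \<xi> * ennreal (?v \<xi> powr q) \<partial>lborel)"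
    by (subst nn_integral_cmult[symmetric]) (simp_all add: mult_ac)
  also have "\<dots> < \<infinity>" using Ffin by (simp add: ennreal_mult_less_top)
  finally have "(\<integral>\<^sup>+\<zeta>. I (R \<zeta>) * ennreal (?v \<zeta> powr q) \<partial>lborel) < \<infinity>" .
  then have "ennreal (c powr q * K) * (\<integral>\<^sup>+\<zeta>. I (R \<zeta>) * ennreal (?v \<zeta> powr q) \<partial>lborel) < \<infinity>"
    by (simp add: ennreal_mult_less_top)
  moreover have "(\<integral>\<^sup>+\<zeta>. ennpowr (E' \<zeta>) q \<partial>lborel) \<le> ennreal (c powr q * K) * (\<integral>\<^sup>+\<zeta>. I (R \<zeta>) * ennreal (?v \<zeta> powr q) \<partial>lborel)"
  proof -
    have [measurable]: "I \<in> borel_measurable borel" unfolding I_def by measurable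
    have "(\<integral>\<^sup>+\<zeta>. ennpowr (E' \<zeta>) q \<partial>lborel) \<le> (\<integral>\<^sup>+\<zeta>. ennreal (c powr q * K) * (I (R \<zeta>) * ennreal (?v \<zeta> powr q)) \<partial>lborel)"
      by (rule nn_integral_mono) (rule E'le)
    also have "\<dots> = ennreal (c powr q * K) * (\<integral>\<^sup>+\<zeta>. I (R \<zeta>) * ennreal (?v \<zeta> powr q) \<partial>lborel)"
      by (rule nn_integral_cmult) measurable
    finally show ?thesis .
  qed
  ultimately have "(\<integral>\<^sup>+\<zeta>. ennpowr (E' \<zeta>) q \<partial>lborel) < \<infinity>" by (rule le_less_trans[rotated])
  then show ?thesis using u'
    by (simp only: modulation_space_def mem_Collect_eq modulation_qnorm_finite_iff[OF q(1)] E'_def one_tensor_v_def prod.case)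
qed

section \<open>Density of Wigner transforms\<close>

lemma wigner_kernel_schwartz:
  fixes f g :: "real^'d \<Rightarrow> complex"
  assumes "f \<in> schwartz" "g \<in> schwartz"
  shows "(\<lambda>(x, t). f (x + t /\<^sub>R 2) * cnj (g (x - t /\<^sub>R 2))) \<in> schwartz"
proof -
  let ?L = "\<lambda>z :: (real^'d) \<times> (real^'d). (fst z + snd z /\<^sub>R 2, fst z - snd z /\<^sub>R 2)"
  have "(\<lambda>z. (\<lambda>(x, t). f x * cnj (g t)) (?L z)) \<in> schwartz"
  proof (rule schwartz_linear_inj[OF schwartz_tensor[OF assms(1) schwartz_cnj[OF assms(2)]]])
    show "linear ?L" unfolding linear_conv_bounded_linear by (intro bounded_linear_intros)
    show "inj ?L"
    proof (rule injI)
      fix z z' :: "(real^'d) \<times> (real^'d)" assume eq: "?L z = ?L z'"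
      then have 1: "fst z + snd z /\<^sub>R 2 = fst z' + snd z' /\<^sub>R 2" "fst z - snd z /\<^sub>R 2 = fst z' - snd z' /\<^sub>R 2" by auto
      have "2 *\<^sub>R fst z = 2 *\<^sub>R fst z'" using arg_cong2[OF 1, of "(+)"] by (simp add: scaleR_2)
      then have f: "fst z = fst z'" by simp
      with 1 have "snd z = snd z'" by simp
      with f show "z = z'" by (simp add: prod_eq_iff)
    qed
  qed
  then show ?thesis by (simp add: case_prod_unfold)
qed

lemma wigner_partial_fourier: "wigner f g = partial_fourier (\<lambda>_. 1) (\<lambda>(x, t). f (x + t /\<^sub>R 2) * cnj (g (x - t /\<^sub>R 2)))"
  by (simp add: wigner_def partial_fourier_def)

lemma wigner_schwartz: "f \<in> schwartz \<Longrightarrow> g \<in> schwartz \<Longrightarrow> wigner f g \<in> schwartz"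
  unfolding wigner_partial_fourier by (intro schwartz_partial_fourier wigner_kernel_schwartz)

text \<open>The test function on which \<open>wigner_distr\<close> evaluates the tensor product. It
  undoes the Wigner transform, by Fourier inversion.\<close>

definition wigner_inv :: "('d::finite phase \<Rightarrow> complex) \<Rightarrow> (real^'d) \<times> (real^'d) \<Rightarrow> complex" where
  "wigner_inv \<Phi> = (\<lambda>(a, b). \<integral>\<xi>. \<Phi> ((a + b) /\<^sub>R 2, \<xi>) * cis (2 * pi * (\<xi> \<bullet> (a - b))) \<partial>lborel)"

lemma wigner_distr_inv: "wigner_distr u v \<Phi> = u (\<lambda>a. v (\<lambda>b. cnj (wigner_inv \<Phi> (a, b))))"
  by (simp add: wigner_distr_def distr_tensor_cnj_def wigner_inv_def)

lemma wigner_inv_wigner: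
  fixes f g :: "real^'d \<Rightarrow> complex"
  assumes "f \<in> schwartz" "g \<in> schwartz"
  shows "wigner_inv (wigner f g) (a, b) = f a * cnj (g b)"
proof -
  let ?x = "(a + b) /\<^sub>R 2"
  let ?k = "\<lambda>t. f (?x + t /\<^sub>R 2) * cnj (g (?x - t /\<^sub>R 2))"
  have S: "?k \<in> schwartz" using schwartz_slice[OF wigner_kernel_schwartz[OF assms], of ?x] by simp
  have "wigner_inv (wigner f g) (a, b) = (\<integral>\<xi>. fourier ?k \<xi> * cis (2 * pi * (\<xi> \<bullet> (a - b))) \<partial>lborel)"
    by (simp add: wigner_inv_def wigner_def fourier_def)
  also have "\<dots> = ?k (a - b)" by (rule schwartz_fourier_inversion[OF S])
  also have "\<dots> = f a * cnj (g b)"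
  proof -
    have "?x + (a - b) /\<^sub>R 2 = a" "?x - (a - b) /\<^sub>R 2 = b"
      by (simp_all add: scaleR_add_right scaleR_diff_right flip: scaleR_add_left)
    then show ?thesis by simp
  qed
  finally show ?thesis .
qed

text \<open>Moyal's identity for distributions. It makes Wigner transforms convenient test
  functions, because the two entries separate.\<close>

lemma wigner_distr_wigner:
  assumes U: "U \<in> tempered" and V: "V \<in> tempered" and fg: "f \<in> schwartz" "g \<in> schwartz"
  shows "wigner_distr U V (wigner f g) = U f * cnj (V g)"
proof -
  have "wigner_distr U V (wigner f g) = U (\<lambda>a. V (\<lambda>b. cnj (f a) * g b))"
    by (simp add: wigner_distr_inv wigner_inv_wigner[OF fg])
  also have "\<dots> = U (\<lambda>a. V g * f a)"
    by (subst tempered_cmult[OF V fg(2)]) (simp add: mult.commute)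
  also have "\<dots> = U f * cnj (V g)" by (simp add: tempered_cmult[OF U fg(1)])
  finally show ?thesis .
qed

text \<open>The two shifts have midpoint \<open>(x0, \<xi>0)\<close>, and their difference
  \<open>(- \<zeta>2, \<zeta>1)\<close> is the frequency turned by the symplectic form. The phase
  factor of the first entry compensates the one that arises when the integration variable is shifted
  by \<open>\<zeta>2\<close>.\<close>

lemma wigner_covariance:
  fixes g1 :: "real^'d \<Rightarrow> complex"
  assumes g1: "g1 \<in> schwartz"
  shows "wigner (\<lambda>a. cis (2 * pi * (\<xi>0 \<bullet> \<zeta>2)) * tf_shift (x0 - \<zeta>2 /\<^sub>R 2, \<xi>0 + \<zeta>1 /\<^sub>R 2) g1 a)
      (tf_shift (x0 + \<zeta>2 /\<^sub>R 2, \<xi>0 - \<zeta>1 /\<^sub>R 2) g1) = tf_shift ((x0, \<xi>0), (\<zeta>1, \<zeta>2)) (wigner g1 g1)"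
    (is "wigner ?e ?f = _")
proof (rule ext, rule prod.induct)
  fix x \<xi> :: "real^'d"
  let ?k = "\<lambda>t. g1 ((x - x0) + t /\<^sub>R 2) * cnj (g1 ((x - x0) - t /\<^sub>R 2)) * cis (- 2 * pi * ((\<xi> - \<xi>0) \<bullet> t))"
  have S: "?k \<in> schwartz"
    using schwartz_modulate[OF schwartz_slice[OF wigner_kernel_schwartz[OF g1 g1]], of "- 2 * pi" "\<xi> - \<xi>0" "x - x0"]
    by (simp add: mult_ac)
  have "?e (x + t /\<^sub>R 2) * cnj (?f (x - t /\<^sub>R 2)) * cis (- 2 * pi * (\<xi> \<bullet> t))
      = cis (2 * pi * (\<zeta>1 \<bullet> x + \<zeta>2 \<bullet> \<xi>)) * ?k (t + \<zeta>2)" for t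
  proof -
    have a1: "x + t /\<^sub>R 2 - (x0 - \<zeta>2 /\<^sub>R 2) = (x - x0) + (t + \<zeta>2) /\<^sub>R 2" "x - t /\<^sub>R 2 - (x0 + \<zeta>2 /\<^sub>R 2) = (x - x0) - (t + \<zeta>2) /\<^sub>R 2"
      by (simp_all add: scaleR_add_right)
    have a2: "2 * pi * (\<xi>0 \<bullet> \<zeta>2) + 2 * pi * ((\<xi>0 + \<zeta>1 /\<^sub>R 2) \<bullet> (x + t /\<^sub>R 2)) - 2 * pi * ((\<xi>0 - \<zeta>1 /\<^sub>R 2) \<bullet> (x - t /\<^sub>R 2)) + - 2 * pi * (\<xi> \<bullet> t)
       = 2 * pi * (\<zeta>1 \<bullet> x + \<zeta>2 \<bullet> \<xi>) + - 2 * pi * ((\<xi> - \<xi>0) \<bullet> (t + \<zeta>2))"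
      by (simp add: inner_add_left inner_add_right inner_diff_left inner_diff_right inner_commute field_simps)
    have "?e (x + t /\<^sub>R 2) * cnj (?f (x - t /\<^sub>R 2)) * cis (- 2 * pi * (\<xi> \<bullet> t))
      = (cis (2 * pi * (\<xi>0 \<bullet> \<zeta>2)) * cis (2 * pi * ((\<xi>0 + \<zeta>1 /\<^sub>R 2) \<bullet> (x + t /\<^sub>R 2))) * cis (- (2 * pi * ((\<xi>0 - \<zeta>1 /\<^sub>R 2) \<bullet> (x - t /\<^sub>R 2)))) * cis (- 2 * pi * (\<xi> \<bullet> t)))
        * (g1 ((x - x0) + (t + \<zeta>2) /\<^sub>R 2) * cnj (g1 ((x - x0) - (t + \<zeta>2) /\<^sub>R 2)))"
      unfolding tf_shift_def fst_conv snd_conv a1 complex_cnj_mult cis_cnj by (simp only: mult_ac)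
    also have "cis (2 * pi * (\<xi>0 \<bullet> \<zeta>2)) * cis (2 * pi * ((\<xi>0 + \<zeta>1 /\<^sub>R 2) \<bullet> (x + t /\<^sub>R 2))) * cis (- (2 * pi * ((\<xi>0 - \<zeta>1 /\<^sub>R 2) \<bullet> (x - t /\<^sub>R 2)))) * cis (- 2 * pi * (\<xi> \<bullet> t))
      = cis (2 * pi * (\<zeta>1 \<bullet> x + \<zeta>2 \<bullet> \<xi>)) * cis (- 2 * pi * ((\<xi> - \<xi>0) \<bullet> (t + \<zeta>2)))"
      unfolding cis_mult a2[symmetric] by (rule arg_cong[of _ _ cis]) simp
    finally show ?thesis by (simp only: mult_ac)
  qed
  then have "wigner ?e ?f (x, \<xi>) = (\<integral>t. cis (2 * pi * (\<zeta>1 \<bullet> x + \<zeta>2 \<bullet> \<xi>)) * ?k (t + \<zeta>2) \<partial>lborel)"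
    by (simp only: wigner_def prod.case)
  also have "\<dots> = cis (2 * pi * (\<zeta>1 \<bullet> x + \<zeta>2 \<bullet> \<xi>)) * (\<integral>t. ?k (t + \<zeta>2) \<partial>lborel)"
    by (rule integral_mult_right_zero)
  also have "(\<integral>t. ?k (t + \<zeta>2) \<partial>lborel) = (\<integral>t. ?k t \<partial>lborel)"
    by (rule integral_translate[OF schwartz_measurable[OF S]])
  also have "\<dots> = wigner g1 g1 (x - x0, \<xi> - \<xi>0)" by (simp only: wigner_def prod.case)
  finally show "wigner ?e ?f (x, \<xi>) = tf_shift ((x0, \<xi>0), (\<zeta>1, \<zeta>2)) (wigner g1 g1) (x, \<xi>)"
    by (simp add: tf_shift_def)
qed

text \<open>The span of the Wigner transforms is dense: the reproducing formula with window \<open>W(g, g)\<close>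
  expands \<open>\<Phi>\<close> into time-frequency shifts of the window, which are Wigner transforms by covariance.\<close>

theorem wigner_distr_eqI:
  fixes \<Lambda> :: "'d::finite phase distr"
  assumes \<Lambda>: "\<Lambda> \<in> tempered" and U: "U \<in> tempered" and V: "V \<in> tempered" and \<Phi>: "\<Phi> \<in> schwartz"
    and eq: "\<And>f g. f \<in> schwartz \<Longrightarrow> g \<in> schwartz \<Longrightarrow> \<Lambda> (wigner f g) = U f * cnj (V g)"
  shows "\<Lambda> \<Phi> = wigner_distr U V \<Phi>"
\<comment> \<open>This split replaces the construction of a nonzero Schwartz function: if there were
  none, all slices of \<open>\<Phi>\<close> would vanish, and both sides with them.\<close>
proof (cases "\<exists>g1 :: real^'d \<Rightarrow> complex. g1 \<in> schwartz \<and> g1 \<noteq> (\<lambda>_. 0)")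
  case False
  then have "(\<lambda>\<xi>. \<Phi> (x, \<xi>)) = (\<lambda>_. 0)" for x using schwartz_slice[OF \<Phi>, of x] by blast
  then have "\<Phi> z = 0" for z by (cases z) (simp add: fun_eq_iff)
  then have "\<Phi> = (\<lambda>_. 0)" by blast
  then show ?thesis
    by (simp add: wigner_distr_inv wigner_inv_def case_prod_unfold tempered_zero \<Lambda> U V)
next
  case True
  then obtain g1 :: "real^'d \<Rightarrow> complex" where g1: "g1 \<in> schwartz" and "g1 \<noteq> (\<lambda>_. 0)" by auto
  then obtain a0 where a0: "g1 a0 \<noteq> 0" by (auto simp: fun_eq_iff)
  define W where "W = wigner g1 g1"
  have W: "W \<in> schwartz" unfolding W_def by (rule wigner_schwartz[OF g1 g1])
  \<comment> \<open>The inverse transform of \<open>W\<close> at \<open>(a0, a0)\<close> is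
    \<open>g1 a0\<close> times its conjugate.\<close>
  have "\<exists>z. W z \<noteq> 0"
  proof (rule ccontr)
    assume "\<not> (\<exists>z. W z \<noteq> 0)"
    then have "wigner_inv W (a0, a0) = 0" by (simp add: wigner_inv_def)
    then show False using a0 by (simp add: W_def wigner_inv_wigner[OF g1 g1])
  qed
  then have E: "0 < energy W" using energy_pos[OF W] by auto
  define c where "c = stft_fun W \<Phi>"
  have c: "c \<in> schwartz" unfolding c_def by (rule schwartz_stft_fun[OF \<Phi> W])
  \<comment> \<open>Positions and frequencies of the two shifts whose cross Wigner transform is the
    shift of \<open>W\<close> by \<open>p\<close>; \<open>\<theta>\<close> is the phase factor that
    goes with them.\<close>
  define \<alpha> \<beta> \<alpha>' \<beta>' :: "'d phase \<times> 'd phase \<Rightarrow> real^'d" where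
    "\<alpha> = (\<lambda>p. fst (fst p) - snd (snd p) /\<^sub>R 2)" and "\<beta> = (\<lambda>p. snd (fst p) + fst (snd p) /\<^sub>R 2)"
    and "\<alpha>' = (\<lambda>p. fst (fst p) + snd (snd p) /\<^sub>R 2)" and "\<beta>' = (\<lambda>p. snd (fst p) - fst (snd p) /\<^sub>R 2)"
  have lin: "linear \<alpha>" "linear \<beta>" "linear \<alpha>'" "linear \<beta>'"
    unfolding \<alpha>_def \<beta>_def \<alpha>'_def \<beta>'_def
    by (auto intro!: linearI simp: scaleR_add_right scaleR_diff_right)
  define \<theta> where "\<theta> = (\<lambda>p :: 'd phase \<times> 'd phase. cis (2 * pi * (snd (fst p) \<bullet> snd (snd p))))"
  define e where "e = (\<lambda>p a. \<theta> p * tf_shift (\<alpha> p, \<beta> p) g1 a)"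
  define f where "f = (\<lambda>p. tf_shift (\<alpha>' p, \<beta>' p) g1)"
  have cov: "wigner (e p) (f p) = tf_shift p W" for p
    unfolding e_def f_def W_def \<theta>_def \<alpha>_def \<beta>_def \<alpha>'_def \<beta>'_def
    using wigner_covariance[OF g1, of "snd (fst p)" "snd (snd p)" "fst (fst p)" "fst (snd p)"] by simp
  have eS: "e p \<in> schwartz" for p unfolding e_def by (intro schwartz_cmult tf_shift_schwartz g1)
  have fS: "f p \<in> schwartz" for p unfolding f_def by (intro tf_shift_schwartz g1)
  have c\<theta>: "(\<lambda>p. \<theta> p * c p) \<in> schwartz"
    unfolding \<theta>_def
  proof (rule schwartz_cis[OF c, where l = "\<lambda>h p. 2 * pi * (snd (fst p) \<bullet> snd (snd h) + snd (fst h) \<bullet> snd (snd p))" and c = "\<lambda>_. 0"])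
    show "((\<lambda>p. 2 * pi * (snd (fst p) \<bullet> snd (snd p))) has_derivative
       (\<lambda>h. 2 * pi * (snd (fst p) \<bullet> snd (snd h) + snd (fst h) \<bullet> snd (snd p)) + 0)) (at p)" for p :: "'d phase \<times> 'd phase"
      by (auto intro!: derivative_eq_intros)
    show "bounded_linear (\<lambda>p. 2 * pi * (snd (fst p) \<bullet> snd (snd b) + snd (fst b) \<bullet> snd (snd p)))" for b :: "'d phase \<times> 'd phase"
      by (intro bounded_linear_intros)
  qed
  have H1: "(\<lambda>(p, b). cnj (c p) * f p b) \<in> schwartz"
    using schwartz_joint[OF schwartz_cnj[OF c] g1 lin(3,4)] by (simp add: f_def tf_shift_def)
  have H2: "(\<lambda>(p, a). c p * e p a) \<in> schwartz"
    using schwartz_joint[OF c\<theta> g1 lin(1,2)] by (simp add: e_def tf_shift_def mult_ac)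
  \<comment> \<open>The reproducing formula for \<open>\<Phi>\<close> under the inverse Wigner map,
    which turns each shift of \<open>W\<close> into a product of a function of \<open>a\<close> and
    a function of \<open>b\<close>.\<close>
  have expand: "of_real (energy W) * wigner_inv \<Phi> (a, b) = (\<integral>p. c p * (e p a * cnj (f p b)) \<partial>lborel)" for a b
  proof -
    let ?x = "(a + b) /\<^sub>R 2"
    let ?h = "\<lambda>\<xi> p. c p * tf_shift p W (?x, \<xi>) * cis (2 * pi * (\<xi> \<bullet> (a - b)))"
    have "(\<lambda>z. (\<lambda>(p, z). c p * tf_shift p W z) ((snd z, (0, fst z)) + (0, (?x, 0)))) \<in> schwartz"
    proof (rule schwartz_affine_inj[OF schwartz_joint_tf_shift[OF c W]])
      show "linear (\<lambda>z :: (real^'d) \<times> ('d phase \<times> 'd phase). (snd z, (0 :: real^'d, fst z)))"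
        by (auto intro!: linearI)
      show "inj (\<lambda>z :: (real^'d) \<times> ('d phase \<times> 'd phase). (snd z, (0 :: real^'d, fst z)))"
        by (auto simp: inj_on_def prod_eq_iff)
    qed
    from schwartz_modulate[OF this, of "2 * pi" "(a - b, 0)"]
    have "(\<lambda>(\<xi>, p). ?h \<xi> p) \<in> schwartz" by (simp add: case_prod_unfold inner_prod_def inner_commute mult_ac)
    then have int: "integrable (lborel \<Otimes>\<^sub>M lborel) (\<lambda>(\<xi>, p). ?h \<xi> p)"
      by (simp add: lborel_prod schwartz_integrable)
    have "of_real (energy W) * wigner_inv \<Phi> (a, b) = (\<integral>\<xi>. (of_real (energy W) * \<Phi> (?x, \<xi>)) * cis (2 * pi * (\<xi> \<bullet> (a - b))) \<partial>lborel)"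
      unfolding wigner_inv_def prod.case integral_mult_right_zero[symmetric] by (simp only: mult.assoc)
    also have "\<dots> = (\<integral>\<xi>. \<integral>p. ?h \<xi> p \<partial>lborel \<partial>lborel)"
      unfolding reproducing_pointwise[OF W \<Phi>, symmetric] integral_mult_left_zero[symmetric] c_def ..
    also have "\<dots> = (\<integral>p. \<integral>\<xi>. ?h \<xi> p \<partial>lborel \<partial>lborel)"
      using int by (rule lborel_pair.Fubini_integral[symmetric])
    also have "(\<lambda>p. \<integral>\<xi>. ?h \<xi> p \<partial>lborel) = (\<lambda>p. c p * wigner_inv (tf_shift p W) (a, b))"
      unfolding wigner_inv_def prod.case integral_mult_right_zero[symmetric] by (simp only: mult.assoc)
    also have "\<dots> = (\<lambda>p. c p * (e p a * cnj (f p b)))"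
      unfolding cov[symmetric] wigner_inv_wigner[OF eS fS] ..
    finally show ?thesis .
  qed
  obtain B where B: "\<And>a. (1 + norm a) ^ 0 * norm (g1 a) \<le> B" using schwartz_decay[OF g1] by blast
  have contlin: "continuous_on UNIV L" if "linear L" for L :: "'d phase \<times> 'd phase \<Rightarrow> real^'d"
    by (rule linear_continuous_on) (use that in \<open>simp add: linear_conv_bounded_linear\<close>)
  \<comment> \<open>For fixed \<open>a\<close> the factor in \<open>a\<close> is a bounded
    coefficient, with which \<open>V\<close> can be moved under the integral. The resulting values
    \<open>V (f p)\<close> grow polynomially and are the coefficient when \<open>U\<close> is
    moved.\<close>
  have b1: "(\<lambda>p. cnj (e p a)) \<in> borel_measurable borel" "\<And>p. norm (cnj (e p a)) \<le> B * (1 + norm p) ^ 0" for a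
  proof -
    have "continuous_on UNIV (\<lambda>p. cnj (e p a))"
      unfolding e_def \<theta>_def tf_shift_def fst_conv snd_conv
      by (intro continuous_intros contlin lin continuous_on_compose2[OF schwartz_continuous[OF g1, of UNIV]]) auto
    then show "(\<lambda>p. cnj (e p a)) \<in> borel_measurable borel" by (rule borel_measurable_continuous_onI)
    show "norm (cnj (e p a)) \<le> B * (1 + norm p) ^ 0" for p
      using B[of "a - \<alpha> p"] by (simp add: e_def \<theta>_def tf_shift_def norm_mult)
  qed
  have VF: "V (f p) = stft g1 V (\<alpha>' p, \<beta>' p)" for p by (simp add: f_def stft_tf_shift)
  obtain C N where C: "0 \<le> C" "\<And>z. norm (stft g1 V z) \<le> C * (1 + norm z) ^ N"
    by (rule stft_growth[OF V g1]) blast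
  have b2: "(\<lambda>p. V (f p)) \<in> borel_measurable borel"
  proof -
    have "continuous_on UNIV (\<lambda>p. V (f p))"
      unfolding VF by (intro continuous_on_compose2[OF stft_continuous[OF V g1]] continuous_on_Pair contlin lin) auto
    then show ?thesis by (rule borel_measurable_continuous_onI)
  qed
  \<comment> \<open>Each component of \<open>p\<close> has norm at most \<open>norm p\<close>, so
    the pair has norm at most three times \<open>norm p\<close>; this explains the base 4.\<close>
  have b2': "norm (V (f p)) \<le> (C * 4 ^ N) * (1 + norm p) ^ N" for p
  proof -
    have n: "norm (fst (fst p)) \<le> norm p" "norm (snd (fst p)) \<le> norm p" "norm (fst (snd p)) \<le> norm p" "norm (snd (snd p)) \<le> norm p"
      using norm_fst_le[of "fst (fst p)" "snd (fst p)"] norm_snd_le[of "snd (fst p)" "fst (fst p)"]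
        norm_fst_le[of "fst (snd p)" "snd (snd p)"] norm_snd_le[of "snd (snd p)" "fst (snd p)"]
        norm_fst_le[of "fst p" "snd p"] norm_snd_le[of "snd p" "fst p"] by auto
    have "norm (\<alpha>' p, \<beta>' p) \<le> norm (\<alpha>' p) + norm (\<beta>' p)" by (rule norm_Pair_le)
    moreover have "norm (\<alpha>' p) \<le> norm (fst (fst p)) + norm (snd (snd p)) / 2"
      unfolding \<alpha>'_def by (rule order_trans[OF norm_triangle_ineq]) simp
    moreover have "norm (\<beta>' p) \<le> norm (snd (fst p)) + norm (fst (snd p)) / 2"
      unfolding \<beta>'_def by (rule order_trans[OF norm_triangle_ineq4]) simp
    ultimately have "1 + norm (\<alpha>' p, \<beta>' p) \<le> 4 * (1 + norm p)" using n norm_ge_zero[of p] by argo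
    then have "(1 + norm (\<alpha>' p, \<beta>' p)) ^ N \<le> 4 ^ N * (1 + norm p) ^ N"
      unfolding power_mult_distrib[symmetric] by (intro power_mono) simp_all
    then show ?thesis unfolding VF using order_trans[OF C(2) mult_left_mono[OF _ C(1)]] by (simp add: mult.assoc)
  qed
  let ?E = "complex_of_real (energy W)"
  have E0: "?E \<noteq> 0" using E by simp
  have inner: "?E * V (\<lambda>b. cnj (wigner_inv \<Phi> (a, b))) = param_integral (\<lambda>p. V (f p)) (\<lambda>(p, a). c p * e p a) a" for a
  proof -
    have P: "param_integral (\<lambda>p. cnj (e p a)) (\<lambda>(p, b). cnj (c p) * f p b) = (\<lambda>b. ?E * cnj (wigner_inv \<Phi> (a, b)))"
    proof
      fix b
      have "param_integral (\<lambda>p. cnj (e p a)) (\<lambda>(p, b). cnj (c p) * f p b) b = (\<integral>p. cnj (c p * (e p a * cnj (f p b))) \<partial>lborel)"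
        by (simp add: param_integral_def mult_ac)
      also have "\<dots> = cnj (\<integral>p. c p * (e p a * cnj (f p b)) \<partial>lborel)" by (rule Bochner_Integration.integral_cnj)
      finally show "param_integral (\<lambda>p. cnj (e p a)) (\<lambda>(p, b). cnj (c p) * f p b) b = ?E * cnj (wigner_inv \<Phi> (a, b))"
        by (simp add: expand[symmetric])
    qed
    \<comment> \<open>Values of \<open>V\<close> carry information on Schwartz functions only. That
      its test function is one follows from the parameter integral, after division by the
      energy.\<close>
    have "param_integral (\<lambda>p. cnj (e p a)) (\<lambda>(p, b). cnj (c p) * f p b) \<in> schwartz" by (rule schwartz_param_integral[OF H1 b1])
    then have "(\<lambda>b. (1 / ?E) * (?E * cnj (wigner_inv \<Phi> (a, b)))) \<in> schwartz" unfolding P by (rule schwartz_cmult)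
    then have S: "(\<lambda>b. cnj (wigner_inv \<Phi> (a, b))) \<in> schwartz" using E0 by simp
    have "?E * V (\<lambda>b. cnj (wigner_inv \<Phi> (a, b))) = V (\<lambda>b. ?E * cnj (wigner_inv \<Phi> (a, b)))"
      by (simp add: tempered_cmult[OF V S])
    also have "\<dots> = (\<integral>p. cnj (cnj (e p a)) * V (\<lambda>b. (\<lambda>(p, b). cnj (c p) * f p b) (p, b)) \<partial>lborel)"
      unfolding P[symmetric] by (rule tempered_param_integral[OF V H1 b1])
    also have "\<dots> = param_integral (\<lambda>p. V (f p)) (\<lambda>(p, a). c p * e p a) a"
      by (simp add: tempered_cmult[OF V fS] param_integral_def mult_ac)
    finally show ?thesis .
  qed
  have "param_integral (\<lambda>p. V (f p)) (\<lambda>(p, a). c p * e p a) \<in> schwartz" by (rule schwartz_param_integral[OF H2 b2 b2'])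
  then have "(\<lambda>a. (1 / ?E) * (?E * V (\<lambda>b. cnj (wigner_inv \<Phi> (a, b))))) \<in> schwartz"
    unfolding inner by (rule schwartz_cmult)
  then have S: "(\<lambda>a. V (\<lambda>b. cnj (wigner_inv \<Phi> (a, b)))) \<in> schwartz" using E0 by simp
  have "?E * wigner_distr U V \<Phi> = U (\<lambda>a. ?E * V (\<lambda>b. cnj (wigner_inv \<Phi> (a, b))))"
    by (simp add: wigner_distr_inv tempered_cmult[OF U S])
  also have "\<dots> = U (param_integral (\<lambda>p. V (f p)) (\<lambda>(p, a). c p * e p a))" by (simp only: inner)
  also have "\<dots> = (\<integral>p. cnj (V (f p)) * U (\<lambda>a. (\<lambda>(p, a). c p * e p a) (p, a)) \<partial>lborel)"
    by (rule tempered_param_integral[OF U H2 b2 b2'])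
  also have "\<dots> = (\<integral>p. cnj (stft_fun W \<Phi> p) * stft W \<Lambda> p \<partial>lborel)"
    by (simp add: tempered_cmult[OF U eS] stft_tf_shift cov[symmetric] eq[OF eS fS] mult_ac flip: c_def)
  also have "\<dots> = ?E * \<Lambda> \<Phi>" by (rule reproducing[OF \<Lambda> W \<Phi>, symmetric])
  finally show ?thesis using E0 by simp
qed

section \<open>The symbol of the adjoint\<close>

context seminorm_scale begin

lemma sbounded_linear_inj:
  fixes L :: "'b::euclidean_space \<Rightarrow> 'a::euclidean_space"
  assumes "sbounded F" "linear L" "inj L"
  shows "sbounded (\<lambda>i x. F i (L x))"
proof -
  obtain \<kappa> where "\<And>x. norm x \<le> \<kappa> * norm (L x)" by (rule linear_inj_bound[OF assms(2,3)]) blast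
  then have "sbounded (\<lambda>i x. F i (L x + 0))"
    using assms by (intro sbounded_compose_affine[where \<kappa> = \<kappa>]) (auto simp: linear_conv_bounded_linear intro: moderate_const)
  then show ?thesis by simp
qed

lemma sbounded_chirp:
  fixes F :: "'i \<Rightarrow> 'a::euclidean_space \<times> 'a \<Rightarrow> complex"
  assumes "sbounded F"
  shows "sbounded (\<lambda>i z. cis (c * (fst z \<bullet> snd z)) * F i z)"
proof (rule sbounded_cis[OF assms, where Q' = "\<lambda>i z h. c * (fst z \<bullet> snd h + fst h \<bullet> snd z)"])
  show "((\<lambda>z. c * (fst z \<bullet> snd z)) has_derivative (\<lambda>h. c * (fst z \<bullet> snd h + fst h \<bullet> snd z))) (at z)" for z :: "'a \<times> 'a"
    by (auto intro!: derivative_eq_intros)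
  show "sbounded (\<lambda>i z. of_real (c * (fst z \<bullet> snd b + fst b \<bullet> snd z)) * F i z)" if "sbounded F" for b and F :: "'i \<Rightarrow> 'a \<times> 'a \<Rightarrow> complex"
    by (rule sbounded_linear_mult[OF that]) (intro bounded_linear_intros)
qed

end

text \<open>The Schwartz kernel of the Kohn--Nirenberg operator with symbol \<open>\<sigma>\<close> is
  \<open>\<phi> \<mapsto> \<langle>\<sigma>, kn_op \<phi>\<rangle>\<close>.\<close>

definition kn_op :: "('a::euclidean_space \<times> 'a \<Rightarrow> complex) \<Rightarrow> 'a \<times> 'a \<Rightarrow> complex" where
  "kn_op \<phi> = (\<lambda>z. cis (- 2 * pi * (fst z \<bullet> snd z)) * partial_fourier (\<lambda>_. 1) \<phi> (fst z, - snd z))"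

text \<open>Undoes \<open>kn_op\<close>: the chirp is cancelled and the transform in the second
  variable inverted. The forward transform appears because \<open>kn_op\<close> evaluates at the
  reflected frequency.\<close>

definition kn_inv :: "('a::euclidean_space \<times> 'a \<Rightarrow> complex) \<Rightarrow> 'a \<times> 'a \<Rightarrow> complex" where
  "kn_inv \<Psi> = partial_fourier (\<lambda>_. 1) (\<lambda>z. cis (2 * pi * (fst z \<bullet> snd z)) * \<Psi> z)"

text \<open>Conjugating the value of a kernel on \<open>flip_cnj Q \<phi>\<close> conjugates the
  kernel, exchanges its variables and changes both by the inverse of \<open>Q\<close>, up to a
  Jacobian. With the identity for \<open>Q\<close> the result is the kernel of the adjoint.\<close>

definition flip_cnj :: "('a \<Rightarrow> 'a) \<Rightarrow> ('a \<times> 'a \<Rightarrow> complex) \<Rightarrow> 'a \<times> 'a \<Rightarrow> complex" where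
  "flip_cnj Q \<phi> = (\<lambda>z. cnj (\<phi> (Q (snd z), Q (fst z))))"

text \<open>\<open>kn_inv\<close> passes to test functions of the kernel, where the adjoint is a
  mere flip, and \<open>kn_op\<close> returns to test functions of the symbol.\<close>

definition adjoint_symbol :: "('a::euclidean_space \<Rightarrow> 'a) \<Rightarrow> ('a \<times> 'a \<Rightarrow> complex) \<Rightarrow> 'a \<times> 'a \<Rightarrow> complex" where
  "adjoint_symbol Q \<Psi> = kn_op (flip_cnj Q (kn_inv \<Psi>))"

context seminorm_scale begin

lemma sbounded_kn_op:
  fixes F :: "'i \<Rightarrow> 'a::euclidean_space \<times> 'a \<Rightarrow> complex"
  assumes "sbounded F" shows "sbounded (\<lambda>i. kn_op (F i))"
  unfolding kn_op_def
proof (rule sbounded_chirp)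
  show "sbounded (\<lambda>i z. partial_fourier (\<lambda>_. 1) (F i) (fst z, - snd z))"
    by (rule sbounded_linear_inj[OF sbounded_partial_fourier[OF assms], where L = "\<lambda>z. (fst z, - snd z)"])
       (auto intro!: linearI simp: inj_on_def prod_eq_iff)
qed

lemma sbounded_kn_inv:
  fixes F :: "'i \<Rightarrow> 'a::euclidean_space \<times> 'a \<Rightarrow> complex"
  assumes "sbounded F" shows "sbounded (\<lambda>i. kn_inv (F i))"
  unfolding kn_inv_def by (intro sbounded_partial_fourier sbounded_chirp assms)

lemma sbounded_flip_cnj:
  fixes F :: "'i \<Rightarrow> 'a::euclidean_space \<times> 'a \<Rightarrow> complex"
  assumes "sbounded F" "linear Q" "inj Q" shows "sbounded (\<lambda>i. flip_cnj Q (F i))"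
  unfolding flip_cnj_def
proof (rule sbounded_cnj, rule sbounded_linear_inj[OF assms(1), where L = "\<lambda>z. (Q (snd z), Q (fst z))"])
  show "linear (\<lambda>z. (Q (snd z), Q (fst z)))"
    by (intro linearI) (simp_all add: linear_add[OF assms(2)] linear_scale[OF assms(2)])
  show "inj (\<lambda>z. (Q (snd z), Q (fst z)))" using assms(3) by (auto simp: inj_on_def prod_eq_iff)
qed

lemma sbounded_adjoint_symbol:
  fixes F :: "'i \<Rightarrow> 'a::euclidean_space \<times> 'a \<Rightarrow> complex"
  assumes "sbounded F" "linear Q" "inj Q" shows "sbounded (\<lambda>i. adjoint_symbol Q (F i))"
  unfolding adjoint_symbol_def by (intro sbounded_kn_op sbounded_flip_cnj sbounded_kn_inv assms)

end

lemma schwartz_flip_cnj: "\<phi> \<in> schwartz \<Longrightarrow> linear Q \<Longrightarrow> inj Q \<Longrightarrow> flip_cnj Q \<phi> \<in> schwartz"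
  unfolding schwartz_iff_sbounded by (rule single.sbounded_flip_cnj)

lemma schwartz_kn_inv: "\<phi> \<in> schwartz \<Longrightarrow> kn_inv \<phi> \<in> schwartz"
  unfolding schwartz_iff_sbounded by (rule single.sbounded_kn_inv)

lemma schwartz_adjoint_symbol: "\<phi> \<in> schwartz \<Longrightarrow> linear Q \<Longrightarrow> inj Q \<Longrightarrow> adjoint_symbol Q \<phi> \<in> schwartz"
  unfolding schwartz_iff_sbounded by (rule single.sbounded_adjoint_symbol)

lemma schwartz_chirp: "\<phi> \<in> schwartz \<Longrightarrow> (\<lambda>z. cis (c * (fst z \<bullet> snd z)) * \<phi> z) \<in> schwartz"
  unfolding schwartz_iff_sbounded by (rule single.sbounded_chirp)

lemma partial_fourier_lincomb:
  assumes "F \<in> schwartz" "G \<in> schwartz"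
  shows "partial_fourier (\<lambda>_. 1) (\<lambda>z. a * F z + b * G z) z = a * partial_fourier (\<lambda>_. 1) F z + b * partial_fourier (\<lambda>_. 1) G z"
proof -
  note i = partial_fourier_integrable[of _ "\<lambda>_. 1" 1 0 "fst z" "snd z", simplified]
  have "partial_fourier (\<lambda>_. 1) (\<lambda>z. a * F z + b * G z) z
     = (\<integral>t. a * (F (fst z, t) * cis (- (2 * pi * (snd z \<bullet> t)))) + b * (G (fst z, t) * cis (- (2 * pi * (snd z \<bullet> t)))) \<partial>lborel)"
    by (simp add: partial_fourier_def case_prod_unfold algebra_simps)
  also have "\<dots> = a * (\<integral>t. F (fst z, t) * cis (- (2 * pi * (snd z \<bullet> t))) \<partial>lborel) + b * (\<integral>t. G (fst z, t) * cis (- (2 * pi * (snd z \<bullet> t))) \<partial>lborel)"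
    using i[OF assms(1)] i[OF assms(2)] by simp
  finally show ?thesis by (simp add: partial_fourier_def case_prod_unfold)
qed

lemma flip_cnj_lincomb:
  "flip_cnj Q (\<lambda>z. a * F z + b * G z) = (\<lambda>z. cnj a * flip_cnj Q F z + cnj b * flip_cnj Q G z)"
  by (simp add: flip_cnj_def)

lemma adjoint_symbol_lincomb:
  assumes F: "F \<in> schwartz" and G: "G \<in> schwartz" and Q: "linear Q" "inj Q"
  shows "adjoint_symbol Q (\<lambda>z. a * F z + b * G z) = (\<lambda>z. cnj a * adjoint_symbol Q F z + cnj b * adjoint_symbol Q G z)"
proof -
  have 1: "kn_inv (\<lambda>z. a * F z + b * G z) = (\<lambda>z. a * kn_inv F z + b * kn_inv G z)"
    using partial_fourier_lincomb[OF schwartz_chirp[OF F, of "2 * pi"] schwartz_chirp[OF G, of "2 * pi"], of a b]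
    by (simp add: kn_inv_def fun_eq_iff algebra_simps)
  show ?thesis
    unfolding adjoint_symbol_def 1 flip_cnj_lincomb
    using partial_fourier_lincomb[OF schwartz_flip_cnj[OF schwartz_kn_inv[OF F] Q] schwartz_flip_cnj[OF schwartz_kn_inv[OF G] Q], of "cnj a" "cnj b"]
    by (simp add: kn_op_def fun_eq_iff algebra_simps)
qed

text \<open>Three antilinear maps in a row, \<open>A\<close>, \<open>u\<close> and conjugation, give
  an antilinear functional. Its seminorm bound comes from the boundedness of \<open>A\<close> as a
  family indexed by the Schwartz functions.\<close>

lemma tempered_cnj_comp:
  fixes u :: "'b::euclidean_space distr" and A :: "('a::euclidean_space \<Rightarrow> complex) \<Rightarrow> 'b \<Rightarrow> complex"
  assumes u: "u \<in> tempered" and A: "op.sbounded A"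
    and lin: "\<And>F G a b. F \<in> schwartz \<Longrightarrow> G \<in> schwartz \<Longrightarrow> A (\<lambda>z. a * F z + b * G z) = (\<lambda>z. cnj a * A F z + cnj b * A G z)"
  shows "(\<lambda>\<Psi>. of_real c * cnj (u (A \<Psi>))) \<in> tempered"
  unfolding tempered_def
proof (intro CollectI conjI ballI allI)
  fix F G :: "'a \<Rightarrow> complex" and a b assume F: "F \<in> schwartz" and G: "G \<in> schwartz"
  show "of_real c * cnj (u (A (\<lambda>x. a * F x + b * G x))) = cnj a * (of_real c * cnj (u (A F))) + cnj b * (of_real c * cnj (u (A G)))"
    unfolding lin[OF F G] tempered_lincomb[OF u op.sbounded_schwartz[OF A F] op.sbounded_schwartz[OF A G]]
    by (simp add: algebra_simps)
next
  obtain N C where C: "0 \<le> C" "\<And>f. f \<in> schwartz \<Longrightarrow> norm (u f) \<le> C * schwartz_norm N f"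
    using tempered_bound[OF u] by metis
  obtain M C' where C': "0 \<le> C'" "\<forall>F\<in>schwartz. schwartz_norm N (A F) \<le> C' * schwartz_norm M F"
    using op.sbounded_norm_le[OF A, of N] by (elim exE conjE)
  show "\<exists>N C. \<forall>F\<in>schwartz. norm (of_real c * cnj (u (A F))) \<le> C * schwartz_norm N F"
  proof (rule exI[of _ M], rule exI[of _ "\<bar>c\<bar> * (C * C')"], rule ballI)
    fix F :: "'a \<Rightarrow> complex" assume F: "F \<in> schwartz"
    have "norm (u (A F)) \<le> C * (C' * schwartz_norm M F)"
      using order_trans[OF C(2)[OF op.sbounded_schwartz[OF A F]] mult_left_mono[OF C'(2)[rule_format, OF F] C(1)]] .
    then have "\<bar>c\<bar> * norm (u (A F)) \<le> \<bar>c\<bar> * (C * (C' * schwartz_norm M F))" by (rule mult_left_mono) simp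
    then show "norm (of_real c * cnj (u (A F))) \<le> \<bar>c\<bar> * (C * C') * schwartz_norm M F"
      by (simp add: norm_mult mult.assoc)
  qed
qed

text \<open>In the adjoint the two arguments trade places, and so do the two continuity
  requirements: temperedness of each image and weak continuity in the function.\<close>

lemma continuous_operator_adjoint:
  assumes "continuous_operator T" shows "continuous_operator (L2_adjoint T)"
proof -
  have T1: "T f \<in> tempered" if "f \<in> schwartz" for f using assms that by (simp add: continuous_operator_def)
  have T2: "T (\<lambda>x. a * f x + b * g x) \<phi> = a * T f \<phi> + b * T g \<phi>" if "f \<in> schwartz" "g \<in> schwartz" "\<phi> \<in> schwartz" for f g \<phi> a b
    using assms that by (simp add: continuous_operator_def)
  have T3: "\<exists>N C. \<forall>f\<in>schwartz. norm (T f \<phi>) \<le> C * schwartz_norm N f" if "\<phi> \<in> schwartz" for \<phi>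
    using assms that by (simp add: continuous_operator_def)
  show ?thesis unfolding continuous_operator_def
  proof (intro conjI ballI allI)
    fix f :: "'a \<Rightarrow> complex" assume f: "f \<in> schwartz"
    show "L2_adjoint T f \<in> tempered"
      unfolding tempered_def L2_adjoint_def using T3[OF f] by (simp add: T2 f)
    show "\<exists>N C. \<forall>g\<in>schwartz. norm (L2_adjoint T g f) \<le> C * schwartz_norm N g"
      using T1[OF f] unfolding tempered_def L2_adjoint_def by simp
    fix g \<phi> :: "'a \<Rightarrow> complex" and a b assume "g \<in> schwartz" "\<phi> \<in> schwartz"
    then show "L2_adjoint T (\<lambda>x. a * f x + b * g x) \<phi> = a * L2_adjoint T f \<phi> + b * L2_adjoint T g \<phi>"
      using f by (simp add: L2_adjoint_def tempered_lincomb[OF T1])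
  qed
qed

text \<open>By Moyal's identity the required equation holds when tested on Wigner transforms, and
  \<open>wigner_distr_eqI\<close> extends it to all test functions.\<close>

lemma wigner_kernel_adjoint:
  fixes T :: "(real^'d) operator"
  assumes T: "continuous_operator T" and k: "is_wigner_kernel T k"
  shows "is_wigner_kernel (L2_adjoint T) (\<lambda>\<phi>. cnj (k (flip_cnj (\<lambda>z. z) \<phi>)))"
proof -
  obtain K where K: "continuous_operator K"
    and KW: "\<And>f g \<Phi>. f \<in> schwartz \<Longrightarrow> g \<in> schwartz \<Longrightarrow> \<Phi> \<in> schwartz \<Longrightarrow> K (wigner f g) \<Phi> = wigner_distr (T f) (T g) \<Phi>"
    and Kk: "is_schwartz_kernel K k"
    using k unfolding is_wigner_kernel_def by (elim exE conjE) simp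
  have kt: "k \<in> tempered" and kK: "\<And>f g. f \<in> schwartz \<Longrightarrow> g \<in> schwartz \<Longrightarrow> K f g = k (\<lambda>(z, w). g z * cnj (f w))"
    using Kk by (simp_all add: is_schwartz_kernel_def)
  have Tt: "T f \<in> tempered" if "f \<in> schwartz" for f using T that by (simp add: continuous_operator_def)
  note K' = continuous_operator_adjoint[OF K] and T' = continuous_operator_adjoint[OF T]
  have T't: "L2_adjoint T f \<in> tempered" if "f \<in> schwartz" for f using T' that by (simp add: continuous_operator_def)
  show ?thesis unfolding is_wigner_kernel_def
  proof (intro exI[of _ "L2_adjoint K"] conjI ballI)
    show "continuous_operator (L2_adjoint K)" by (rule K')
    show "is_schwartz_kernel (L2_adjoint K) (\<lambda>\<phi>. cnj (k (flip_cnj (\<lambda>z. z) \<phi>)))"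
      unfolding is_schwartz_kernel_def
    proof (intro conjI ballI)
      have "(\<lambda>\<phi>. of_real 1 * cnj (k (flip_cnj (\<lambda>z. z) \<phi>))) \<in> tempered"
        by (rule tempered_cnj_comp[OF kt op.sbounded_flip_cnj[OF op_sbounded_id] flip_cnj_lincomb])
           (auto intro: linearI)
      then show "(\<lambda>\<phi>. cnj (k (flip_cnj (\<lambda>z. z) \<phi>))) \<in> tempered" by simp
      show "L2_adjoint K f g = cnj (k (flip_cnj (\<lambda>z. z) (\<lambda>(z, w). g z * cnj (f w))))"
        if "f \<in> schwartz" "g \<in> schwartz" for f g
        using kK[OF that(2,1)] by (simp add: L2_adjoint_def flip_cnj_def case_prod_unfold mult.commute)
    qed
    fix f g :: "real^'d \<Rightarrow> complex" and \<Phi> :: "'d phase \<Rightarrow> complex"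
    assume f: "f \<in> schwartz" and g: "g \<in> schwartz" and \<Phi>: "\<Phi> \<in> schwartz"
    show "L2_adjoint K (wigner f g) \<Phi> = wigner_distr (L2_adjoint T f) (L2_adjoint T g) \<Phi>"
    proof (rule wigner_distr_eqI[OF _ T't[OF f] T't[OF g] \<Phi>])
      show "L2_adjoint K (wigner f g) \<in> tempered"
        using K' wigner_schwartz[OF f g] by (simp add: continuous_operator_def)
      fix u v :: "real^'d \<Rightarrow> complex" assume u: "u \<in> schwartz" and v: "v \<in> schwartz"
      show "L2_adjoint K (wigner f g) (wigner u v) = L2_adjoint T f u * cnj (L2_adjoint T g v)"
        by (simp add: L2_adjoint_def KW[OF u v wigner_schwartz[OF f g]] wigner_distr_wigner[OF Tt[OF u] Tt[OF v] f g])
    qed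
  qed
qed

section \<open>Kohn--Nirenberg kernels and time-frequency shifts\<close>

lemma kn_op_tensor:
  "kn_op (\<lambda>(z, w). g z * cnj (f w)) = (\<lambda>(x, \<eta>). cis (- 2 * pi * (x \<bullet> \<eta>)) * (g x * cnj (fourier f \<eta>)))"
proof -
  have "partial_fourier (\<lambda>_. 1) (\<lambda>(z, w). g z * cnj (f w)) (x, - \<eta>) = g x * cnj (fourier f \<eta>)" for x \<eta>
  proof -
    have "cnj (fourier f \<eta>) = (\<integral>t. cnj (f t * cis (- 2 * pi * (\<eta> \<bullet> t))) \<partial>lborel)"
      unfolding fourier_def by (rule Bochner_Integration.integral_cnj[symmetric])
    then show ?thesis
      unfolding partial_fourier_def prod.case by (simp add: cis_cnj mult.assoc)
  qed
  then show ?thesis by (simp add: kn_op_def fun_eq_iff)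
qed

text \<open>Tensors are enough, since a Schwartz kernel is compared with its operator on
  tensors.\<close>

lemma kn_inv_kn_op_tensor:
  assumes f: "f \<in> schwartz"
  shows "kn_inv (kn_op (\<lambda>(z, w). g z * cnj (f w))) = (\<lambda>(z, w). g z * cnj (f w))"
proof (rule ext, rule prod.induct)
  fix z w
  have "kn_inv (kn_op (\<lambda>(z, w). g z * cnj (f w))) (z, w)
     = (\<integral>\<eta>. g z * cnj (fourier f \<eta> * cis (2 * pi * (\<eta> \<bullet> w))) \<partial>lborel)"
    unfolding kn_inv_def kn_op_tensor partial_fourier_def prod.case
  proof (rule Bochner_Integration.integral_cong[OF refl])
    fix \<eta>
    have "cis (2 * pi * (z \<bullet> \<eta>)) * cis (- 2 * pi * (z \<bullet> \<eta>)) = 1" by (simp add: cis_mult)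
    moreover have "cis (- 2 * pi * (w \<bullet> \<eta>)) = cnj (cis (2 * pi * (\<eta> \<bullet> w)))" by (simp add: cis_cnj inner_commute)
    ultimately show "1 * (cis (2 * pi * (fst (z, \<eta>) \<bullet> snd (z, \<eta>))) * (cis (- 2 * pi * (z \<bullet> \<eta>)) * (g z * cnj (fourier f \<eta>))) * cis (- 2 * pi * (w \<bullet> \<eta>)))
       = g z * cnj (fourier f \<eta> * cis (2 * pi * (\<eta> \<bullet> w)))"
      unfolding fst_conv snd_conv complex_cnj_mult by (simp only: mult.assoc[symmetric]) (simp add: mult_ac)
  qed
  also have "\<dots> = g z * cnj (\<integral>\<eta>. fourier f \<eta> * cis (2 * pi * (\<eta> \<bullet> w)) \<partial>lborel)"
    unfolding integral_mult_right_zero Bochner_Integration.integral_cnj ..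
  also have "\<dots> = g z * cnj (f w)" by (simp only: schwartz_fourier_inversion[OF f])
  finally show "kn_inv (kn_op (\<lambda>(z, w). g z * cnj (f w))) (z, w) = (case (z, w) of (z, w) \<Rightarrow> g z * cnj (f w))" by simp
qed

text \<open>The chirp adds positions to frequencies, and the partial transform exchanges position
  and frequency in the second variable. Both act linearly on the parameters of a shift, up to a
  phase factor.\<close>

lemma kn_inv_tf_shift:
  assumes "\<Psi> \<in> schwartz"
  shows "\<exists>c. norm c = 1 \<and> kn_inv (tf_shift ((y1, y2), (\<zeta>1, \<zeta>2)) \<Psi>) = (\<lambda>z. c * tf_shift ((y1, y1 + \<zeta>2), (y2 + \<zeta>1, - y2)) (kn_inv \<Psi>) z)"
proof (rule exI[of _ "cis (2 * pi * (\<zeta>2 \<bullet> y2))"], rule conjI, simp, rule ext, rule prod.induct)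
  fix x w
  let ?k = "\<lambda>\<eta>. \<Psi> (x - y1, \<eta>) * cis (2 * pi * ((x + \<zeta>2 - w) \<bullet> \<eta>))"
  let ?c = "cis (2 * pi * (\<zeta>2 \<bullet> y2)) * cis (2 * pi * ((y2 + \<zeta>1) \<bullet> x + - y2 \<bullet> w))"
  have S: "?k \<in> schwartz"
    using schwartz_modulate[OF schwartz_slice[OF assms], of "2 * pi" "x + \<zeta>2 - w" "x - y1"] by (simp add: mult.commute)
  have "kn_inv (tf_shift ((y1, y2), (\<zeta>1, \<zeta>2)) \<Psi>) (x, w) = (\<integral>\<eta>. ?c * ?k (\<eta> + - y2) \<partial>lborel)"
    unfolding kn_inv_def partial_fourier_def prod.case
  proof (rule Bochner_Integration.integral_cong[OF refl])
    fix \<eta>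
    have "cis (2 * pi * (x \<bullet> \<eta>)) * cis (2 * pi * (\<zeta>1 \<bullet> x + \<zeta>2 \<bullet> \<eta>)) * cis (- 2 * pi * (w \<bullet> \<eta>))
      = ?c * cis (2 * pi * ((x + \<zeta>2 - w) \<bullet> (\<eta> + - y2)))"
      unfolding cis_mult by (rule arg_cong[of _ _ cis])
        (simp add: inner_add_left inner_add_right inner_diff_left inner_diff_right inner_commute algebra_simps)
    then show "1 * (cis (2 * pi * (fst (x, \<eta>) \<bullet> snd (x, \<eta>))) * tf_shift ((y1, y2), (\<zeta>1, \<zeta>2)) \<Psi> (x, \<eta>) * cis (- 2 * pi * (w \<bullet> \<eta>)))
      = ?c * ?k (\<eta> + - y2)"
      by (simp add: tf_shift_def mult_ac)
  qed
  also have "\<dots> = ?c * (\<integral>\<eta>. ?k \<eta> \<partial>lborel)"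
    unfolding integral_mult_right_zero integral_translate[OF schwartz_measurable[OF S]] ..
  also have "(\<integral>\<eta>. ?k \<eta> \<partial>lborel) = kn_inv \<Psi> (x - y1, w - (y1 + \<zeta>2))"
    unfolding kn_inv_def partial_fourier_def prod.case
  proof (rule Bochner_Integration.integral_cong[OF refl])
    fix \<eta>
    have "cis (2 * pi * ((x + \<zeta>2 - w) \<bullet> \<eta>)) = cis (2 * pi * ((x - y1) \<bullet> \<eta>)) * cis (- 2 * pi * ((w - (y1 + \<zeta>2)) \<bullet> \<eta>))"
      unfolding cis_mult by (rule arg_cong[of _ _ cis]) (simp add: inner_add_left inner_diff_left algebra_simps)
    then show "?k \<eta> = 1 * (cis (2 * pi * (fst (x - y1, \<eta>) \<bullet> snd (x - y1, \<eta>))) * \<Psi> (x - y1, \<eta>) * cis (- 2 * pi * ((w - (y1 + \<zeta>2)) \<bullet> \<eta>)))"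
      by (simp add: mult_ac)
  qed
  finally show "kn_inv (tf_shift ((y1, y2), (\<zeta>1, \<zeta>2)) \<Psi>) (x, w)
    = cis (2 * pi * (\<zeta>2 \<bullet> y2)) * tf_shift ((y1, y1 + \<zeta>2), (y2 + \<zeta>1, - y2)) (kn_inv \<Psi>) (x, w)"
    by (simp add: tf_shift_def mult.assoc)
qed

lemma kn_op_tf_shift:
  assumes "\<phi> \<in> schwartz"
  shows "\<exists>c. norm c = 1 \<and> kn_op (tf_shift ((a, b), (\<alpha>, \<beta>)) \<phi>) = (\<lambda>z. c * tf_shift ((a, - \<beta>), (\<alpha> + \<beta>, b - a)) (kn_op \<phi>) z)"
proof (rule exI[of _ "cis (2 * pi * (\<beta> \<bullet> b - a \<bullet> \<beta>))"], rule conjI, simp, rule ext, rule prod.induct)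
  fix x \<eta>
  let ?k = "\<lambda>t. \<phi> (x - a, t) * cis (2 * pi * ((\<eta> + \<beta>) \<bullet> t))"
  let ?c = "cis (2 * pi * (\<alpha> \<bullet> x + \<beta> \<bullet> b + \<eta> \<bullet> b))"
  have S: "?k \<in> schwartz"
    using schwartz_modulate[OF schwartz_slice[OF assms], of "2 * pi" "\<eta> + \<beta>" "x - a"] by (simp add: mult.commute)
  have "partial_fourier (\<lambda>_. 1) (tf_shift ((a, b), (\<alpha>, \<beta>)) \<phi>) (x, - \<eta>) = (\<integral>t. ?c * ?k (t + - b) \<partial>lborel)"
    unfolding partial_fourier_def prod.case
  proof (rule Bochner_Integration.integral_cong[OF refl])
    fix t
    have "cis (2 * pi * (\<alpha> \<bullet> x + \<beta> \<bullet> t)) * cis (- 2 * pi * (- \<eta> \<bullet> t)) = ?c * cis (2 * pi * ((\<eta> + \<beta>) \<bullet> (t + - b)))"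
      unfolding cis_mult by (rule arg_cong[of _ _ cis])
        (simp add: inner_add_left inner_add_right inner_diff_left inner_diff_right algebra_simps)
    then show "1 * (tf_shift ((a, b), (\<alpha>, \<beta>)) \<phi> (x, t) * cis (- 2 * pi * (- \<eta> \<bullet> t))) = ?c * ?k (t + - b)"
      by (simp add: tf_shift_def mult_ac)
  qed
  also have "\<dots> = ?c * (\<integral>t. ?k t \<partial>lborel)"
    unfolding integral_mult_right_zero integral_translate[OF schwartz_measurable[OF S]] ..
  also have "(\<integral>t. ?k t \<partial>lborel) = partial_fourier (\<lambda>_. 1) \<phi> (x - a, - (\<eta> - - \<beta>))"
  proof -
    have "- 2 * pi * ((- (\<eta> - - \<beta>)) \<bullet> t) = 2 * pi * ((\<eta> + \<beta>) \<bullet> t)" for t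
      by (simp add: inner_add_left inner_diff_left algebra_simps)
    then show ?thesis unfolding partial_fourier_def prod.case by (simp only: mult_1_left)
  qed
  finally have e: "partial_fourier (\<lambda>_. 1) (tf_shift ((a, b), (\<alpha>, \<beta>)) \<phi>) (x, - \<eta>) = ?c * partial_fourier (\<lambda>_. 1) \<phi> (x - a, - (\<eta> - - \<beta>))" .
  have "cis (- 2 * pi * (x \<bullet> \<eta>)) * ?c = cis (2 * pi * (\<beta> \<bullet> b - a \<bullet> \<beta>)) * cis (2 * pi * ((\<alpha> + \<beta>) \<bullet> x + (b - a) \<bullet> \<eta>)) * cis (- 2 * pi * ((x - a) \<bullet> (\<eta> - - \<beta>)))"
    unfolding cis_mult by (rule arg_cong[of _ _ cis])
      (simp add: inner_add_left inner_add_right inner_diff_left inner_diff_right inner_commute algebra_simps)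
  then show "kn_op (tf_shift ((a, b), (\<alpha>, \<beta>)) \<phi>) (x, \<eta>)
     = cis (2 * pi * (\<beta> \<bullet> b - a \<bullet> \<beta>)) * tf_shift ((a, - \<beta>), (\<alpha> + \<beta>, b - a)) (kn_op \<phi>) (x, \<eta>)"
    unfolding kn_op_def fst_conv snd_conv e by (simp add: tf_shift_def mult.assoc[symmetric])
qed

text \<open>Translations are pulled back by the inverse \<open>P\<close> and modulations by the
  adjoint of \<open>Q\<close>; conjugation reverses the frequencies.\<close>

lemma flip_cnj_tf_shift:
  assumes Q: "linear Q" and P: "\<And>x. Q (P x) = x"
  shows "flip_cnj Q (tf_shift ((a, b), (\<alpha>, \<beta>)) \<phi>) = tf_shift ((P b, P a), (- adjoint Q \<beta>, - adjoint Q \<alpha>)) (flip_cnj Q \<phi>)"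
proof (rule ext, rule prod.induct)
  fix z w
  have adj: "adjoint Q v \<bullet> x = v \<bullet> Q x" for v x
    using adjoint_works[OF Q, of x v] by (simp add: inner_commute)
  show "flip_cnj Q (tf_shift ((a, b), (\<alpha>, \<beta>)) \<phi>) (z, w) = tf_shift ((P b, P a), (- adjoint Q \<beta>, - adjoint Q \<alpha>)) (flip_cnj Q \<phi>) (z, w)"
    by (simp add: flip_cnj_def tf_shift_def cis_cnj adj linear_diff[OF Q] P algebra_simps)
qed

lemma kn_op_cmult: "kn_op (\<lambda>z. c * \<phi> z) = (\<lambda>z. c * kn_op \<phi> z)"
proof -
  have "partial_fourier (\<lambda>_. 1) (\<lambda>z. c * \<phi> z) z = c * partial_fourier (\<lambda>_. 1) \<phi> z" for z
    unfolding partial_fourier_def case_prod_unfold integral_mult_right_zero[symmetric] by (simp add: mult_ac)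
  then show ?thesis by (simp add: kn_op_def fun_eq_iff)
qed

text \<open>The positions \<open>y1\<close> and \<open>y2\<close> do not enter the new frequency:
  those that \<open>kn_inv\<close> adds to the parameters cancel when \<open>kn_op\<close> returns.
  This is what makes the modulation norms comparable.\<close>

lemma adjoint_symbol_tf_shift:
  assumes \<Psi>: "\<Psi> \<in> schwartz" and Q: "linear Q" "inj Q" and P: "\<And>x. Q (P x) = x"
    and Pl: "linear P"
  shows "\<exists>c. norm c = 1 \<and> adjoint_symbol Q (tf_shift ((y1, y2), (\<zeta>1, \<zeta>2)) \<Psi>)
     = (\<lambda>z. c * tf_shift ((P (y1 + \<zeta>2), adjoint Q (y2 + \<zeta>1)), (- adjoint Q \<zeta>1, - P \<zeta>2)) (adjoint_symbol Q \<Psi>) z)"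
proof -
  obtain c1 where c1: "norm c1 = 1" "kn_inv (tf_shift ((y1, y2), (\<zeta>1, \<zeta>2)) \<Psi>) = (\<lambda>z. c1 * tf_shift ((y1, y1 + \<zeta>2), (y2 + \<zeta>1, - y2)) (kn_inv \<Psi>) z)"
    using kn_inv_tf_shift[OF \<Psi>, of y1 y2 \<zeta>1 \<zeta>2] by (elim exE conjE)
  let ?\<phi> = "flip_cnj Q (kn_inv \<Psi>)"
  have \<phi>: "?\<phi> \<in> schwartz" by (intro schwartz_flip_cnj schwartz_kn_inv \<Psi> Q)
  obtain c2 where c2: "norm c2 = 1" "kn_op (tf_shift ((P (y1 + \<zeta>2), P y1), (- adjoint Q (- y2), - adjoint Q (y2 + \<zeta>1))) ?\<phi>)
     = (\<lambda>z. c2 * tf_shift ((P (y1 + \<zeta>2), - (- adjoint Q (y2 + \<zeta>1))), (- adjoint Q (- y2) + - adjoint Q (y2 + \<zeta>1), P y1 - P (y1 + \<zeta>2))) (kn_op ?\<phi>) z)"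
    using kn_op_tf_shift[OF \<phi>, of "P (y1 + \<zeta>2)" "P y1" "- adjoint Q (- y2)" "- adjoint Q (y2 + \<zeta>1)"]
    by (elim exE conjE)
  have fl: "flip_cnj Q (\<lambda>z. c1 * F z) = (\<lambda>z. cnj c1 * flip_cnj Q F z)" for F by (simp add: flip_cnj_def)
  have al: "linear (adjoint Q)" by (rule adjoint_linear[OF Q(1)])
  have "adjoint_symbol Q (tf_shift ((y1, y2), (\<zeta>1, \<zeta>2)) \<Psi>) = (\<lambda>z. cnj c1 * (c2 * tf_shift ((P (y1 + \<zeta>2), - (- adjoint Q (y2 + \<zeta>1))), (- adjoint Q (- y2) + - adjoint Q (y2 + \<zeta>1), P y1 - P (y1 + \<zeta>2))) (adjoint_symbol Q \<Psi>) z))"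
    unfolding adjoint_symbol_def c1(2) fl kn_op_cmult flip_cnj_tf_shift[OF Q(1) P] c2(2) ..
  also have "- adjoint Q (- y2) + - adjoint Q (y2 + \<zeta>1) = - adjoint Q \<zeta>1"
    by (simp add: linear_add[OF al] linear_neg[OF al])
  also have "P y1 - P (y1 + \<zeta>2) = - P \<zeta>2" by (simp add: linear_add[OF Pl])
  finally show ?thesis
    using c1(1) c2(1) by (intro exI[of _ "cnj c1 * c2"]) (simp add: norm_mult mult.assoc)
qed

lemma kohn_nirenberg_kn_op: "kohn_nirenberg \<sigma> f g = \<sigma> (kn_op (\<lambda>(z, w). g z * cnj (f w)))"
  by (simp add: kohn_nirenberg_def type_I_def kn_op_tensor)

text \<open>The new symbol is defined by duality, so the modulus of its short-time Fourier transform
  is, up to the factor \<open>\<bar>c\<bar>\<close>, that of \<open>\<sigma>\<close> with window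
  \<open>adjoint_symbol Q G\<close> at a linearly related frequency. The real factor
  \<open>c\<close> makes room for a Jacobian.\<close>

theorem kohn_nirenberg_kernel_flip:
  fixes Q P :: "'a::euclidean_space \<Rightarrow> 'a"
  assumes Q: "linear Q" and P: "linear P" and QP: "\<And>x. Q (P x) = x" and PQ: "\<And>x. P (Q x) = x"
    and \<sigma>: "\<sigma> \<in> modulation_space G \<infinity> (ennreal q) (one_tensor_v s)"
    and G: "G \<in> schwartz" "G \<noteq> (\<lambda>_. 0)" and q: "0 < q" "q \<le> 1" and s: "0 \<le> s"
    and h: "is_schwartz_kernel (kohn_nirenberg \<sigma>) h"
  obtains \<sigma>' where "\<sigma>' \<in> modulation_space G \<infinity> (ennreal q) (one_tensor_v s)"
    "is_schwartz_kernel (kohn_nirenberg \<sigma>') (\<lambda>\<phi>. of_real c * cnj (h (flip_cnj Q \<phi>)))"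
proof -
  have injQ: "inj Q" and injP: "inj P" using PQ QP by (metis injI)+
  have \<sigma>t: "\<sigma> \<in> tempered" using \<sigma> by (simp add: modulation_space_def)
  have ht: "h \<in> tempered" and hk: "\<And>f g. f \<in> schwartz \<Longrightarrow> g \<in> schwartz \<Longrightarrow> kohn_nirenberg \<sigma> f g = h (\<lambda>(z, w). g z * cnj (f w))"
    using h by (simp_all add: is_schwartz_kernel_def)
  define \<sigma>' where "\<sigma>' = (\<lambda>\<Psi>. of_real c * cnj (\<sigma> (adjoint_symbol Q \<Psi>)))"
  have \<sigma>'t: "\<sigma>' \<in> tempered"
    unfolding \<sigma>'_def
    by (rule tempered_cnj_comp[OF \<sigma>t op.sbounded_adjoint_symbol[OF op_sbounded_id Q injQ] adjoint_symbol_lincomb[OF _ _ Q injQ]])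
  show ?thesis
  proof (rule that)
    show "\<sigma>' \<in> modulation_space G \<infinity> (ennreal q) (one_tensor_v s)"
    proof (rule modulation_space_transfer[OF \<sigma> \<sigma>'t G schwartz_adjoint_symbol[OF G(1) Q injQ] G(1) q s])
      \<comment> \<open>The action of \<open>adjoint_symbol\<close> on the frequencies of
        shifts.\<close>
      let ?R = "\<lambda>\<zeta>. (- adjoint Q (fst \<zeta>), - P (snd \<zeta>))"
      have al: "linear (adjoint Q)" by (rule adjoint_linear[OF Q])
      have "v = 0" if "adjoint Q v = 0" for v
      proof -
        have "P v \<bullet> adjoint Q v = Q (P v) \<bullet> v" by (rule adjoint_works[OF Q])
        then show ?thesis using that by (simp add: QP)
      qed
      then have ainj: "inj (adjoint Q)" by (simp add: linear_injective_0[OF al])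
      show "linear ?R" by (intro linearI) (simp_all add: linear_add[OF al] linear_add[OF P] linear_scale[OF al] linear_scale[OF P])
      show "inj ?R"
      proof (rule injI)
        fix a b assume "?R a = ?R b"
        then have "adjoint Q (fst a) = adjoint Q (fst b)" "P (snd a) = P (snd b)" by simp_all
        then show "a = b" using injD[OF ainj, of "fst a" "fst b"] injD[OF injP, of "snd a" "snd b"] by (simp add: prod_eq_iff)
      qed
      show "0 \<le> \<bar>c\<bar>" by simp
      fix y \<zeta> :: "'a \<times> 'a"
      obtain y1 y2 \<zeta>1 \<zeta>2 where y: "y = (y1, y2)" "\<zeta> = (\<zeta>1, \<zeta>2)" by (cases y, cases \<zeta>)
      let ?y' = "(P (y1 + \<zeta>2), adjoint Q (y2 + \<zeta>1))"
      let ?z = "(?y', (- adjoint Q \<zeta>1, - P \<zeta>2))"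
      obtain d where d: "norm d = 1" "adjoint_symbol Q (tf_shift ((y1, y2), (\<zeta>1, \<zeta>2)) G) = (\<lambda>z. d * tf_shift ?z (adjoint_symbol Q G) z)"
        using adjoint_symbol_tf_shift[OF G(1) Q injQ QP P, of y1 y2 \<zeta>1 \<zeta>2] by (elim exE conjE)
      have "stft G \<sigma>' (y, \<zeta>) = of_real c * cnj (cnj d * stft (adjoint_symbol Q G) \<sigma> ?z)"
        unfolding stft_tf_shift \<sigma>'_def y d(2)
        by (simp only: tempered_cmult[OF \<sigma>t tf_shift_schwartz[OF schwartz_adjoint_symbol[OF G(1) Q injQ]]])
      then have "norm (stft G \<sigma>' (y, \<zeta>)) \<le> \<bar>c\<bar> * norm (stft (adjoint_symbol Q G) \<sigma> (?y', ?R \<zeta>))"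
        using d(1) by (simp add: norm_mult y)
      then show "\<exists>y'. norm (stft G \<sigma>' (y, \<zeta>)) \<le> \<bar>c\<bar> * norm (stft (adjoint_symbol Q G) \<sigma> (y', ?R \<zeta>))" by (rule exI)
    qed
    show "is_schwartz_kernel (kohn_nirenberg \<sigma>') (\<lambda>\<phi>. of_real c * cnj (h (flip_cnj Q \<phi>)))"
      unfolding is_schwartz_kernel_def
    proof (intro conjI ballI)
      show "(\<lambda>\<phi>. of_real c * cnj (h (flip_cnj Q \<phi>))) \<in> tempered"
        by (rule tempered_cnj_comp[OF ht op.sbounded_flip_cnj[OF op_sbounded_id Q injQ] flip_cnj_lincomb])
      fix f g :: "'a \<Rightarrow> complex" assume f: "f \<in> schwartz" and g: "g \<in> schwartz"
      have fl: "flip_cnj Q (\<lambda>(z, w). g z * cnj (f w)) = (\<lambda>(z, w). f (Q z) * cnj (g (Q w)))"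
        by (simp add: flip_cnj_def fun_eq_iff)
      have "kohn_nirenberg \<sigma>' f g = of_real c * cnj (\<sigma> (kn_op (\<lambda>(z, w). f (Q z) * cnj (g (Q w)))))"
        by (simp add: kohn_nirenberg_kn_op \<sigma>'_def adjoint_symbol_def kn_inv_kn_op_tensor[OF f] fl)
      also have "\<sigma> (kn_op (\<lambda>(z, w). f (Q z) * cnj (g (Q w)))) = kohn_nirenberg \<sigma> (\<lambda>x. g (Q x)) (\<lambda>x. f (Q x))"
        by (simp add: kohn_nirenberg_kn_op)
      also have "\<dots> = h (\<lambda>(z, w). f (Q z) * cnj (g (Q w)))"
        by (rule hk[OF schwartz_linear_inj[OF g Q injQ] schwartz_linear_inj[OF f Q injQ]])
      finally show "kohn_nirenberg \<sigma>' f g = of_real c * cnj (h (flip_cnj Q (\<lambda>(z, w). g z * cnj (f w))))"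
        by (simp only: fl)
    qed
  qed
qed

section \<open>Matrices acting on phase space, and the adjoint in the class of Fourier integral
  operators\<close>

lemma phase_vec_vec_phase [simp]: "phase_vec (vec_phase v) = v"
  by (simp add: phase_vec_def vec_phase_def vec_eq_iff split: sum.split)

lemma vec_phase_phase_vec [simp]: "vec_phase (phase_vec z) = z"
  by (simp add: phase_vec_def vec_phase_def vec_eq_iff prod_eq_iff case_prod_unfold)

lemma phase_apply_compose: "phase_apply A (phase_apply B z) = phase_apply (A ** B) z"
  by (simp add: phase_apply_def matrix_vector_mul_assoc)

lemma phase_apply_mat_1: "phase_apply (mat 1) z = z"
  by (simp add: phase_apply_def)

lemma linear_phase_apply: "linear (phase_apply S)"
proof -
  have 1: "phase_vec (x + y) = phase_vec x + phase_vec y" "phase_vec (c *\<^sub>R x) = c *\<^sub>R phase_vec x" for x y :: "'d::finite phase" and c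
    by (simp_all add: phase_vec_def vec_eq_iff case_prod_unfold split: sum.split)
  have 2: "vec_phase (x + y) = vec_phase x + vec_phase y" "vec_phase (c *\<^sub>R x) = c *\<^sub>R (vec_phase x :: 'd::finite phase)" for x y c
    by (simp_all add: vec_phase_def vec_eq_iff prod_eq_iff)
  show ?thesis
    by (rule linearI) (simp_all add: phase_apply_def 1 2 matrix_vector_right_distrib matrix_vector_mult_scaleR)
qed

lemma matrix_inv_inverse: "invertible A \<Longrightarrow> A ** matrix_inv A = mat 1 \<and> matrix_inv A ** A = mat 1"
  unfolding invertible_def matrix_inv_def by (rule someI_ex)

lemmas matrix_inv_right = matrix_inv_inverse[THEN conjunct1]
  and matrix_inv_left = matrix_inv_inverse[THEN conjunct2]

text \<open>If \<open>S\<close> annihilates \<open>v\<close>, so does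
  \<open>?J = transpose S ** ?J ** S\<close>, and \<open>?J\<close> is injective.\<close>

lemma Sp_invertible:
  fixes S :: "real^('d::finite + 'd)^('d + 'd)"
  assumes "S \<in> Sp" shows "invertible S"
proof -
  let ?J = "block_matrix 0 (mat 1) (- mat 1) 0 :: real^('d + 'd)^('d + 'd)"
  have J0: "v = 0" if "?J *v v = 0" for v
  proof -
    obtain x \<xi> where x: "vec_phase v = (x, \<xi>)" by (cases "vec_phase v")
    have v: "v = phase_vec (x, \<xi>)" using arg_cong[OF x, of phase_vec] by simp
    have "phase_apply ?J (x, \<xi>) = vec_phase 0" using that by (simp add: phase_apply_def v)
    moreover have "(- mat 1) *v x = - x"
      using matrix_vector_mult_diff_rdistrib[of 0 "mat 1" x] by simp
    ultimately have "x = 0" "\<xi> = 0"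
      by (simp_all add: phase_apply_block_matrix vec_phase_def vec_eq_iff)
    then show ?thesis by (simp add: v phase_vec_def vec_eq_iff split: sum.split)
  qed
  have "v = 0" if "S *v v = 0" for v
  proof (rule J0)
    have "?J *v v = (transpose S ** ?J ** S) *v v" using assms by (simp add: Sp_def)
    also have "\<dots> = (transpose S ** ?J) *v (S *v v)" by (simp add: matrix_vector_mul_assoc)
    finally show "?J *v v = 0" using that by simp
  qed
  then have "inj ((*v) S)" by (simp add: linear_injective_0)
  then show ?thesis by (simp add: invertible_left_inverse matrix_left_invertible_injective)
qed

theorem FIO_adjoint:
  fixes T :: "(real^'d) operator"
  assumes T: "T \<in> FIO G q s S" and S: "invertible S"
    and G: "G \<in> schwartz" "G \<noteq> (\<lambda>_. 0)" and q: "0 < q" "q \<le> 1" and s: "0 \<le> s"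
  shows "L2_adjoint T \<in> FIO G q s (matrix_inv S)"
proof -
  obtain k h \<sigma> where Tc: "continuous_operator T" and k: "is_wigner_kernel T k"
    and \<sigma>: "\<sigma> \<in> modulation_space G \<infinity> (ennreal q) (one_tensor_v s)"
    and h: "is_schwartz_kernel (kohn_nirenberg \<sigma>) h" and kh: "\<And>\<phi>. \<phi> \<in> schwartz \<Longrightarrow> k \<phi> = pullback_snd S h \<phi>"
    using T unfolding FIO_def by auto
  define P Q where "P = phase_apply S" and "Q = phase_apply (matrix_inv S)"
  note inv = matrix_inv_right[OF S] matrix_inv_left[OF S]
  have PQ: "P (Q x) = x" and QP: "Q (P x) = x" for x
    by (simp_all add: P_def Q_def phase_apply_compose inv phase_apply_mat_1)
  have lin: "linear Q" "linear P" unfolding P_def Q_def by (rule linear_phase_apply)+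
  have inv_inv: "invertible (matrix_inv S)" unfolding invertible_def using inv by blast
  have "matrix_inv (matrix_inv S) = (S ** matrix_inv S) ** matrix_inv (matrix_inv S)" by (simp add: inv)
  also have "\<dots> = S" by (simp add: matrix_mul_assoc[symmetric] matrix_inv_right[OF inv_inv])
  finally have invinv: "matrix_inv (matrix_inv S) = S" .
  from inv_inv have det: "det (matrix_inv S) \<noteq> 0" by (simp add: invertible_det_nz)
  \<comment> \<open>The pullback along \<open>S\<close> divides by \<open>\<bar>det S\<bar>\<close>,
    the one along the inverse on the other side by \<open>\<bar>det (matrix_inv S)\<bar>\<close>.
    This factor balances the two.\<close>
  define c where "c = \<bar>det (matrix_inv S)\<bar> / \<bar>det S\<bar>"
  define h' where "h' = (\<lambda>\<phi>. of_real c * cnj (h (flip_cnj Q \<phi>)))"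
  obtain \<sigma>' where \<sigma>': "\<sigma>' \<in> modulation_space G \<infinity> (ennreal q) (one_tensor_v s)" "is_schwartz_kernel (kohn_nirenberg \<sigma>') h'"
    unfolding h'_def using kohn_nirenberg_kernel_flip[OF lin QP PQ \<sigma> G q s h] by blast
  show ?thesis unfolding FIO_def
  proof (intro CollectI conjI exI)
    show "continuous_operator (L2_adjoint T)" by (rule continuous_operator_adjoint[OF Tc])
    show "is_wigner_kernel (L2_adjoint T) (\<lambda>\<phi>. cnj (k (flip_cnj (\<lambda>z. z) \<phi>)))" by (rule wigner_kernel_adjoint[OF Tc k])
    show "\<sigma>' \<in> modulation_space G \<infinity> (ennreal q) (one_tensor_v s)" "is_schwartz_kernel (kohn_nirenberg \<sigma>') h'" by (rule \<sigma>')+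
    show "\<forall>\<phi>\<in>schwartz. cnj (k (flip_cnj (\<lambda>z. z) \<phi>)) = pullback_snd (matrix_inv S) h' \<phi>"
    proof
      fix \<phi> :: "'d phase \<times> 'd phase \<Rightarrow> complex" assume \<phi>: "\<phi> \<in> schwartz"
      have "flip_cnj (\<lambda>z. z) \<phi> \<in> schwartz" by (rule schwartz_flip_cnj[OF \<phi>]) (auto intro: linearI)
      then have "k (flip_cnj (\<lambda>z. z) \<phi>) = h (\<lambda>(z, w). cnj (\<phi> (Q w, z))) / of_real \<bar>det S\<bar>"
        by (simp add: kh pullback_snd_def flip_cnj_def Q_def)
      \<comment> \<open>With this, both sides evaluate \<open>h\<close> on one and the same test
        function.\<close>
      moreover have "flip_cnj Q (\<lambda>(z, w). \<phi> (z, phase_apply S w)) = (\<lambda>(z, w). cnj (\<phi> (Q w, z)))"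
        using PQ by (simp add: flip_cnj_def P_def fun_eq_iff)
      then have "pullback_snd (matrix_inv S) h' \<phi> = of_real c * cnj (h (\<lambda>(z, w). cnj (\<phi> (Q w, z)))) / of_real \<bar>det (matrix_inv S)\<bar>"
        by (simp add: pullback_snd_def invinv h'_def)
      ultimately show "cnj (k (flip_cnj (\<lambda>z. z) \<phi>)) = pullback_snd (matrix_inv S) h' \<phi>"
        using det by (simp add: c_def)
    qed
  qed
qed

theorem corollary5p3:
  fixes A B C D :: "real^'d^'d"
    and S :: "real^('d + 'd)^('d + 'd)"
    and q s :: real
    and g :: "'d phase \<Rightarrow> complex"
    and G :: "'d phase \<times> 'd phase \<Rightarrow> complex"
    and \<sigma> :: "'d phase distr"
    and T_I T_II :: "(real^'d) operator"
  assumes "0 < q" "q \<le> 1" "0 \<le> s"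
    and "g \<in> schwartz" "g \<noteq> (\<lambda>_. 0)"
    and "G \<in> schwartz" "G \<noteq> (\<lambda>_. 0)"
    and "S = block_matrix A B C D" "S \<in> Sp" "det A \<noteq> 0"
    and "\<sigma> \<in> modulation_space g \<infinity> (ennreal q) (one_tensor_v s)"
    and "T_I = type_I (quadratic_phase A B C) \<sigma>"
    and "T_II = L2_adjoint T_I"
    and "T_I \<in> FIO G q s S"
  shows "T_II \<in> FIO G q s (matrix_inv S)"
  using FIO_adjoint[OF \<open>T_I \<in> FIO G q s S\<close> Sp_invertible[OF \<open>S \<in> Sp\<close>]] assms by blast

end
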